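(* Let $n\ge 2$, let $Q=\{x\in\mathbb{R}^n:\sum_{i=1}^n x_i^2/a_i=1\}$ with $0<a_1<\cdots<a_n$, and let $\lambda_1,\ldots,\lambda_{n-1}$ be distinct real numbers with $\{\lambda_1,\ldots,\lambda_{n-1}\}\cap\{a_1,\ldots,a_n\}=\emptyset$. The nonsingular billiard trajectories inside $Q$ sharing the caustics $Q_{\lambda_1},\ldots,Q_{\lambda_{n-1}}$ are periodic with: (1) elliptic period $m=n$ if the roots of $t^n-\prod_{j=1}^n(t-a_j)$ are the caustic parameters $\lambda_1,\ldots,\lambda_{n-1}$; (2) elliptic period $m=n+1$ if there exists $d\in\mathbb{R}$ such that the roots of $t^{n+1}-(t-d)^2\prod_{k=1}^{n-1}(t-\lambda_k)$ are the ellipsoidal parameters $a_1,\ldots,a_n$; and (3) elliptic period $m=2n-1$ if all the roots of $t^{2n-1}-\prod_{j=1}^n(t-a_j)\prod_{k=1}^{n-1}(t-\lambda_k)$ are double.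
   Context: Confocal quadrics: $Q_\lambda=\{x\in\mathbb{R}^n:\sum_{i=1}^n x_i^2/(a_i-\lambda)=1\}$ for $\lambda\in\mathbb{R}\setminus\{a_1,\ldots,a_n\}$. All the lines containing segments of a billiard trajectory inside $Q$ are tangent to the same $n-1$ confocal quadrics $Q_{\lambda_1},\ldots,Q_{\lambda_{n-1}}$, called the caustics of the trajectory; the $\lambda_k$ are its caustic parameters. A trajectory is nonsingular if it has $n-1$ distinct nonsingular caustics (i.e. the $\lambda_k$ are distinct and none equals some $a_j$). Jacobi elliptic coordinates: a generic point $x\in\mathbb{R}^n$ lies on exactly $n$ quadrics $Q_{\mu_0},\ldots,Q_{\mu_{n-1}}$ with $\mu_0<a_1<\mu_1<\cdots<a_{n-1}<\mu_{n-1}<a_n$; $(\mu_0,\ldots,\mu_{n-1})$ are its elliptic coordinates (extended by continuity to all points). Let $\{c_1,\ldots,c_{2n-1}\}=\{a_j\}\cup\{\lambda_k\}$ with $c_0:=0<c_1<\cdots<c_{2n-1}$. Along a nonsingular trajectory, $\mu_j$ oscillates in $[c_{2j},c_{2j+1}]$, $j=0,\ldots,n-1$. If the trajectory is periodic, its period $m_0$ is the least number of bounces after which it closes, and its winding numbers $m_0,\ldots,m_{n-1}$ are the numbers of complete oscillations (round trips) of $\mu_j$ in $[c_{2j},c_{2j+1}]$ along one period (so the $0$-th is the period). One has $\gcd(m_0,\ldots,m_{n-1})\in\{1,2\}$, and the elliptic period is $m=m_0/\gcd(m_0,\ldots,m_{n-1})$, i.e. the number of bounces after which the trajectory closes in elliptic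 coordinates. All nonsingular trajectories sharing the same caustics have the same periodicity, period and winding numbers. *)

theory Defs
  imports "HOL-Analysis.Analysis" "HOL-Computational_Algebra.Polynomial"
begin

text \<open>
  The ambient space is \<open>real ^ 'n\<close>, with \<open>n = CARD('n)\<close>; the parameters
  \<open>a\<^sub>1 < \<dots> < a\<^sub>n\<close> are given by a function on the index type, and the caustic
  parameters \<open>\<lambda>\<^sub>1, \<dots>, \<lambda>\<^bsub>n-1\<^esub>\<close> by the values of \<open>lam\<close> on \<open>{1..n-1}\<close>.
\<close>

section \<open>Confocal quadrics and tangent lines\<close>

definition quadric_form :: "('n::finite \<Rightarrow> real) \<Rightarrow> real \<Rightarrow> real ^ 'n \<Rightarrow> real ^ 'n \<Rightarrow> real" where
  "quadric_form a l x y = (\<Sum>i\<in>UNIV. x $ i * y $ i / (a i - l))"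

text \<open>Meaningful only for \<open>l \<notin> range a\<close>; the ellipsoid itself is \<open>confocal_quadric a 0\<close>.\<close>

definition confocal_quadric :: "('n::finite \<Rightarrow> real) \<Rightarrow> real \<Rightarrow> (real ^ 'n) set" where
  "confocal_quadric a l = {x. (\<Sum>i\<in>UNIV. (x $ i)\<^sup>2 / (a i - l)) = 1}"

text \<open>
  The line \<open>p + \<real> v\<close> is tangent to the quadric either at one of its points (where \<open>v\<close> is
  conjugate to the point), or at its point at infinity, i.e. it is an asymptote of the
  quadric. The second case is needed: for instance, a segment through the centre of an ellipse
  lies on an asymptote of its hyperbolic caustic.
\<close>

definition tangent_line :: "('n::finite \<Rightarrow> real) \<Rightarrow> real \<Rightarrow> real ^ 'n \<Rightarrow> real ^ 'n \<Rightarrow> bool" where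
  "tangent_line a l p v \<longleftrightarrow>
     (\<exists>t. p + t *\<^sub>R v \<in> confocal_quadric a l \<and> quadric_form a l (p + t *\<^sub>R v) v = 0)
     \<or> (quadric_form a l v v = 0 \<and> quadric_form a l p v = 0)"

section \<open>Billiard trajectories\<close>

text \<open>Reflection in the hyperplane orthogonal to \<open>w\<close>.\<close>

definition reflect :: "real ^ 'n::finite \<Rightarrow> real ^ 'n \<Rightarrow> real ^ 'n" where
  "reflect w v = v - (2 * (v \<bullet> w) / (w \<bullet> w)) *\<^sub>R w"

definition ellipsoid_normal :: "('n::finite \<Rightarrow> real) \<Rightarrow> real ^ 'n \<Rightarrow> real ^ 'n" where
  "ellipsoid_normal a x = (\<chi> i. x $ i / a i)"

text \<open>A trajectory is given by its bi-infinite sequence of impact points.\<close>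

definition billiard_trajectory :: "('n::finite \<Rightarrow> real) \<Rightarrow> (int \<Rightarrow> real ^ 'n) \<Rightarrow> bool" where
  "billiard_trajectory a q \<longleftrightarrow>
     (\<forall>k. q k \<in> confocal_quadric a 0) \<and>
     (\<forall>k. q (k + 1) \<noteq> q k) \<and>
     (\<forall>k. sgn (q (k + 1) - q k) = reflect (ellipsoid_normal a (q k)) (sgn (q k - q (k - 1))))"

definition has_caustics ::
  "('n::finite \<Rightarrow> real) \<Rightarrow> (nat \<Rightarrow> real) \<Rightarrow> (int \<Rightarrow> real ^ 'n) \<Rightarrow> bool" where
  "has_caustics a lam q \<longleftrightarrow>
     (\<forall>j\<in>{1..CARD('n) - 1}. \<forall>k. tangent_line a (lam j) (q k) (q (k + 1) - q k))"

definition periodic_trajectory :: "(int \<Rightarrow> real ^ 'n::finite) \<Rightarrow> bool" where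
  "periodic_trajectory q \<longleftrightarrow> (\<exists>m::nat. 0 < m \<and> (\<forall>k. q (k + int m) = q k))"

definition trajectory_period :: "(int \<Rightarrow> real ^ 'n::finite) \<Rightarrow> nat" where
  "trajectory_period q = (LEAST m. 0 < m \<and> (\<forall>k. q (k + int m) = q k))"

text \<open>
  The continuous trajectory, parametrised so that the segment from \<open>q k\<close> to \<open>q (k + 1)\<close> is
  traversed during \<open>[k, k + 1]\<close>; one period then takes time \<open>trajectory_period q\<close>.
\<close>

definition trajectory_path :: "(int \<Rightarrow> real ^ 'n::finite) \<Rightarrow> real \<Rightarrow> real ^ 'n" where
  "trajectory_path q t = q \<lfloor>t\<rfloor> + frac t *\<^sub>R (q (\<lfloor>t\<rfloor> + 1) - q \<lfloor>t\<rfloor>)"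

section \<open>Jacobi elliptic coordinates\<close>

definition confocal_params :: "('n::finite \<Rightarrow> real) \<Rightarrow> real ^ 'n \<Rightarrow> real set" where
  "confocal_params a x = {m. m \<notin> range a \<and> x \<in> confocal_quadric a m}"

definition generic_points :: "('n::finite \<Rightarrow> real) \<Rightarrow> (real ^ 'n) set" where
  "generic_points a = {x. finite (confocal_params a x) \<and> card (confocal_params a x) = CARD('n)}"

text \<open>
  At generic points, \<open>\<mu>\<^sub>j\<close> is the \<open>j\<close>-th smallest parameter (counting from 0); the limit extends
  \<open>\<mu>\<^sub>j\<close> by continuity to all points.
\<close>

definition elliptic_coordinate :: "('n::finite \<Rightarrow> real) \<Rightarrow> nat \<Rightarrow> real ^ 'n \<Rightarrow> real" where
  "elliptic_coordinate a j x =
     Lim (at x within generic_points a) (\<lambda>y. sorted_list_of_set (confocal_params a y) ! j)"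

section \<open>Winding numbers and elliptic period\<close>

text \<open>\<open>c\<^sub>0 = 0\<close>, and \<open>c\<^sub>1 < \<dots> < c\<^bsub>2n-1\<^esub>\<close> are the ellipsoidal and caustic parameters.\<close>

definition sorted_param ::
  "('n::finite \<Rightarrow> real) \<Rightarrow> (nat \<Rightarrow> real) \<Rightarrow> nat \<Rightarrow> real" where
  "sorted_param a lam i =
     (0 # sorted_list_of_set (range a \<union> lam ` {1..CARD('n) - 1})) ! i"

text \<open>
  Within some time window \<open>[s 0, s 0 + L]\<close>, \<open>f\<close> makes exactly \<open>k\<close> successive monotone round
  trips from \<open>\<alpha>\<close> up to \<open>\<beta>\<close> and back to \<open>\<alpha>\<close>. If \<open>f\<close> has period \<open>L > 0\<close>, there is at most one
  such \<open>k\<close>.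
\<close>

definition round_trips :: "(real \<Rightarrow> real) \<Rightarrow> real \<Rightarrow> real \<Rightarrow> real \<Rightarrow> nat \<Rightarrow> bool" where
  "round_trips f \<alpha> \<beta> L k \<longleftrightarrow>
     (\<exists>s u :: nat \<Rightarrow> real. s k = s 0 + L \<and>
        (\<forall>i<k. s i < u i \<and> u i < s (Suc i) \<and>
               f (s i) = \<alpha> \<and> f (u i) = \<beta> \<and> f (s (Suc i)) = \<alpha> \<and>
               strict_mono_on {s i..u i} f \<and>
               strict_antimono_on {u i..s (Suc i)} f))"

text \<open>The \<open>j\<close>-th winding number of a periodic trajectory, for \<open>j < n\<close>.\<close>

definition trajectory_winding_number ::
  "('n::finite \<Rightarrow> real) \<Rightarrow> (nat \<Rightarrow> real) \<Rightarrow> (int \<Rightarrow> real ^ 'n) \<Rightarrow> nat \<Rightarrow> nat" where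
  "trajectory_winding_number a lam q j =
     (THE k. round_trips (\<lambda>t. elliptic_coordinate a j (trajectory_path q t))
               (sorted_param a lam (2 * j)) (sorted_param a lam (2 * j + 1))
               (real (trajectory_period q)) k)"

text \<open>
  \<open>m\<^sub>0 / gcd (m\<^sub>0, \<dots>, m\<^bsub>n-1\<^esub>)\<close>. The division is exact: the \<open>0\<close>-th winding number is the period,
  since \<open>\<mu>\<^sub>0\<close> vanishes precisely at the impacts.
\<close>

definition elliptic_period ::
  "('n::finite \<Rightarrow> real) \<Rightarrow> (nat \<Rightarrow> real) \<Rightarrow> (int \<Rightarrow> real ^ 'n) \<Rightarrow> nat" where
  "elliptic_period a lam q =
     trajectory_period q div Gcd (trajectory_winding_number a lam q ` {..<CARD('n)})"

text \<open>All billiard trajectories with the given caustics are periodic with elliptic period \<open>m\<close>.\<close>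

definition all_periodic_with_elliptic_period ::
  "('n::finite \<Rightarrow> real) \<Rightarrow> (nat \<Rightarrow> real) \<Rightarrow> nat \<Rightarrow> bool" where
  "all_periodic_with_elliptic_period a lam m \<longleftrightarrow>
     (\<forall>q. billiard_trajectory a q \<and> has_caustics a lam q \<longrightarrow>
          periodic_trajectory q \<and> elliptic_period a lam q = m)"

end

theory Submission
  imports Defs "HOL-Computational_Algebra.Fundamental_Theorem_Algebra"
begin

text \<open>
  For a line \<open>x + h v\<close> of a trajectory (with \<open>v\<close> a unit vector) and \<open>A(s) = \<Prod>\<^sub>j (a\<^sub>j - s)\<close>, let \<open>U\<close>, \<open>V\<close>, \<open>W\<close> be
  the polynomials \<open>A(s) (1 - Q\<^sub>s(x, x))\<close>, \<open>A(s) Q\<^sub>s(x, v)\<close>, \<open>A(s) Q\<^sub>s(v, v)\<close>. Tangency to the caustics means that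
  \<open>V\<^sup>2 + U W = - R\<close> with \<open>R(s) = \<Prod>\<^sub>i (s - c\<^sub>i)\<close>, and the roots of \<open>U\<close> are the elliptic coordinates of \<open>x\<close>.
  Each pair of coordinates \<open>(x\<^sub>i, v\<^sub>i)\<close> evolves by a discrete string equation with parameter \<open>s = a\<^sub>i\<close>, and the
  matrix \<open>L\<close> with rows \<open>(V, U)\<close>, \<open>(W, - V)\<close> is conjugated by the transfer matrices of this equation.

  Each of the three conditions yields an identity \<open>\<alpha>\<^sup>2 + \<beta>\<^sup>2 R = s\<^bsup>2m\<^esup>\<close>: write \<open>s\<^sup>m = F + G\<close> with
  \<open>4 F G = \<beta>\<^sup>2 R\<close> and put \<open>\<alpha> = F - G\<close>. Comparing the growth of eigenvectors as \<open>s \<rightarrow> 0\<close> shows that the transfer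
  matrix over \<open>m\<close> bounces is \<open>(\<alpha> + \<beta> L) / s\<^sup>m\<close>. Evaluated at \<open>s = a\<^sub>i\<close>, this gives \<open>q\<^bsub>k+m\<^esub> = \<sigma> q\<^sub>k\<close> with a common
  sign \<open>\<sigma>\<close>.

  The coordinate \<open>\<mu>\<^sub>j\<close> reaches \<open>c\<^sub>i\<close> exactly at the zeros of a solution of the string equation with parameter \<open>c\<^sub>i\<close>.
  By Sturm comparison the numbers \<open>z\<^sub>j\<close> of oscillations over \<open>m\<close> bounces decrease in \<open>j\<close>, and their parity is
  the sign of \<open>\<alpha>(c\<^sub>i)\<close>. Together with \<open>z\<^sub>0 = m\<close> this forces \<open>(z\<^sub>j)\<close> to be \<open>(n, \<dots>, 1)\<close>, \<open>(n + 1, \<dots>, 2)\<close> and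
  \<open>(2n - 1, 2n - 3, \<dots>, 1)\<close> in the three cases. These are coprime, and the winding numbers are proportional to them.
\<close>

section \<open>Polynomials\<close>

text \<open>One string equation serves every parameter: its coefficients \<open>\<tau>\<close>,
  \<open>\<kappa>\<close> do not depend on \<open>s\<close>, so coordinates
  (\<open>s = a i\<close>), square roots of \<open>U\<close> up to sign (\<open>s\<close> in
  \<open>C\<close>) and test solutions at other \<open>s\<close> are comparable by Sturm's argument.
  The splittings \<open>s^m = F + G\<close> are the hypotheses themselves: by counting degrees, the
  difference whose roots are prescribed is \<open>c Lp\<close>, \<open>c Ap\<close> or
  \<open>k Sp^2\<close>, with \<open>Ap\<close>, \<open>Lp\<close> the monic polynomials of the two
  kinds of parameters and \<open>Sp\<close> that of the double roots. A real \<open>\<beta>\<close>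
  needs \<open>c\<close> or \<open>k\<close> positive: the sign of \<open>c\<close> comes from
  \<open>R(0) < 0\<close>, a consequence of the velocity pointing inwards after an impact, and
  \<open>k\<close> is the sum of all parameters. Comparing growth leaves one ambiguity, a constant
  shear, which would move \<open>q m\<close> along the line of \<open>u 0\<close>. It could only
  reach the other end of the chord, where the velocity points outwards. A sign
  \<open>\<sigma> = - 1\<close> is invisible to elliptic coordinates, so the period may be
  \<open>m\<close> or \<open>2 m\<close>; only the proportionality of the counts over both periods
  enters.\<close>

lemma poly_eq_smult_prod_roots:
  fixes p :: "'a::idom poly"
  assumes "finite S" "degree p \<le> card S" "\<And>r. r \<in> S \<Longrightarrow> poly p r = 0"
  shows "p = smult (coeff p (card S)) (\<Prod>r\<in>S. [:- r, 1:])"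
proof -
  let ?P = "\<Prod>r\<in>S. [:- r, 1:]"
  have dP: "degree ?P = card S"
    by (subst degree_prod_sum_eq) auto
  have lP: "coeff ?P (card S) = 1"
    using lead_coeff_prod[of "\<lambda>r. [:- r, 1:]" S] dP by simp
  show ?thesis
    by (rule poly_eqI_degree_lead_coeff[where A = S and n = "card S"])
      (use assms dP lP in \<open>auto simp: poly_prod prod_zero_iff intro: order.trans[OF degree_smult_le]\<close>)
qed

lemma coeff_mult_top:
  fixes p q :: "'a::comm_semiring_1 poly"
  assumes "degree p \<le> m" "degree q \<le> n"
  shows "coeff (p * q) (m + n) = coeff p m * coeff q n"
proof -
  have "coeff (p * q) (m + n) = (\<Sum>i\<le>m + n. coeff p i * coeff q (m + n - i))"
    by (simp add: coeff_mult)
  also have "\<dots> = (\<Sum>i\<in>{m}. coeff p i * coeff q (m + n - i))"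
  proof (rule sum.mono_neutral_right)
    show "\<forall>i\<in>{..m + n} - {m}. coeff p i * coeff q (m + n - i) = 0"
    proof
      fix i assume "i \<in> {..m + n} - {m}"
      then have "degree p < i \<or> degree q < m + n - i"
        using assms by auto
      then show "coeff p i * coeff q (m + n - i) = 0"
        by (auto simp: coeff_eq_0)
    qed
  qed auto
  finally show ?thesis by simp
qed

lemma coeff_prod_top:
  fixes f :: "'b \<Rightarrow> 'a::comm_semiring_1 poly"
  assumes "finite S" "\<And>i. i \<in> S \<Longrightarrow> degree (f i) \<le> 1"
  shows "degree (prod f S) \<le> card S \<and> coeff (prod f S) (card S) = (\<Prod>i\<in>S. coeff (f i) 1)"
  using assms
proof (induction S rule: finite_induct)
  case (insert i S)
  then show ?case
    using coeff_mult_top[of "f i" 1 "prod f S" "card S"]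
    by (auto intro!: order.trans[OF degree_mult_le] add_mono[of _ 1 _ "card S", simplified])
qed auto

text \<open>Vieta. It supplies the leading coefficient of \<open>t^(2n-1) - R\<close>, which is the
  sum of the parameters and hence positive.\<close>

lemma coeff_prod_linear_second:
  fixes S :: "'a::idom set"
  assumes "finite S" "S \<noteq> {}"
  shows "coeff (\<Prod>r\<in>S. [:- r, 1:]) (card S - 1) = - (\<Sum>r\<in>S. r)"
  using assms
proof (induction S rule: finite_ne_induct)
  case (insert i S)
  let ?P = "\<Prod>r\<in>S. [:- r, 1:]"
  have dP: "degree ?P = card S"
    by (subst degree_prod_sum_eq) auto
  have lP: "coeff ?P (card S) = 1"
    using lead_coeff_prod[of "\<lambda>r. [:- r, 1:]" S] dP by simp
  obtain k where k: "card S = Suc k"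
    using insert by (metis card_eq_0_iff not0_implies_Suc)
  have "(\<Prod>r\<in>insert i S. [:- r, 1:]) = smult (- i) ?P + pCons 0 ?P"
    using insert by simp
  then show ?case
    using insert lP k by (simp add: coeff_pCons)
qed auto

text \<open>Unlike \<^const>\<open>reflect_poly\<close>, this reverses with respect to a prescribed bound on the degree.\<close>

definition reflect_at :: "nat \<Rightarrow> 'a::comm_semiring_1 poly \<Rightarrow> 'a poly" where
  "reflect_at m p = (\<Sum>i\<le>m. monom (coeff p i) (m - i))"

lemma poly_reflect_at:
  fixes p :: "'a::field poly"
  assumes "degree p \<le> m" "s \<noteq> 0"
  shows "poly (reflect_at m p) (1 / s) = poly p s / s ^ m"
proof -
  have "poly p s = (\<Sum>i\<le>m. coeff p i * s ^ i)"
    unfolding poly_altdef using assms(1) by (intro sum.mono_neutral_left) (auto simp: coeff_eq_0)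
  moreover have "(1 / s) ^ (m - i) = s ^ i / s ^ m" if "i \<le> m" for i
    using that assms by (simp add: power_diff field_simps)
  ultimately show ?thesis
    by (simp add: reflect_at_def poly_sum poly_monom sum_divide_distrib)
qed

lemma poly_reflect_at_0: "poly (reflect_at m p) 0 = coeff p m"
proof -
  have "poly (reflect_at m p) 0 = (\<Sum>i\<in>{m}. poly (monom (coeff p i) (m - i)) 0)"
    unfolding reflect_at_def poly_sum
    by (rule sum.mono_neutral_right) (auto simp: poly_monom power_0_left)
  then show ?thesis by (simp add: poly_monom)
qed

lemma poly_tendsto_0_imp_0:
  fixes p :: "real poly"
  assumes "(poly p \<longlongrightarrow> 0) at_top"
  shows "p = 0"
  using assms
proof (induction p)
  case (pCons c p)
  have "((\<lambda>y. (poly (pCons c p) y - c) * inverse y) \<longlongrightarrow> (0 - c) * 0) at_top"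
    by (intro tendsto_intros pCons.prems tendsto_inverse_0_at_top filterlim_ident)
  then have "((\<lambda>y. (poly (pCons c p) y - c) * inverse y) \<longlongrightarrow> 0) at_top"
    by simp
  moreover have "eventually (\<lambda>y. (poly (pCons c p) y - c) * inverse y = poly p y) at_top"
    using eventually_gt_at_top[of 0] by eventually_elim simp
  ultimately have "(poly p \<longlongrightarrow> 0) at_top"
    by (rule Lim_transform_eventually)
  then have "p = 0" by (rule pCons.IH)
  then have "((\<lambda>y::real. c) \<longlongrightarrow> 0) at_top"
    using pCons.prems by simp
  then have "c = 0" by (simp add: tendsto_const_iff)
  with \<open>p = 0\<close> show ?case by simp
qed auto

text \<open>A Liouville argument, to be used in the variable \<open>1 / s\<close>: polynomials in
  \<open>1 / s\<close> that have a limit as \<open>s\<close> decreases to 0 are constant.\<close>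

lemma poly_tendsto_imp_const:
  fixes p :: "real poly"
  assumes "(poly p \<longlongrightarrow> l) at_top"
  shows "poly p y = poly p 0"
proof -
  have "(poly (p - [:l:]) \<longlongrightarrow> 0) at_top"
    using tendsto_diff[OF assms tendsto_const[of l]]
    by (simp add: filterlim_def filtermap_def)
  then have "p = [:l:]"
    using poly_tendsto_0_imp_0 by fastforce
  then show ?thesis by simp
qed

section \<open>Roots\<close>

text \<open>The values before \<open>j\<close> push \<open>f j\<close> up to at least
  \<open>j\<close>; the \<open>n - 1 - j\<close> values after it must still fit below
  \<open>n\<close>. This turns counts of roots into exact indices.\<close>

lemma strict_mono_selfmap_id:
  fixes f :: "nat \<Rightarrow> nat"
  assumes "\<And>i j. i < j \<Longrightarrow> j < n \<Longrightarrow> f i < f j" "\<And>i. i < n \<Longrightarrow> f i < n" "j < n"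
  shows "f j = j"
proof -
  have lower: "i \<le> f i" if "i < n" for i
    using that
  proof (induction i)
    case (Suc i)
    then show ?case using assms(1)[of i "Suc i"] by simp
  qed simp
  have "f j + k \<le> f (j + k)" if "j + k < n" for k
    using that
  proof (induction k)
    case (Suc k)
    then show ?case using assms(1)[of "j + k" "Suc (j + k)"] by simp
  qed simp
  from this[of "n - 1 - j"] show ?thesis
    using lower[OF assms(3)] assms(2)[of "n - 1"] assms(3) by simp
qed

lemma poly_prod_roots: "poly (\<Prod>i<n. [:r i, - 1:]) s = (\<Prod>i<n. r i - s)"
  for r :: "nat \<Rightarrow> 'a::comm_ring_1"
  by (simp add: poly_prod)

text \<open>The sign change of the limit product between \<open>r k - \<delta>\<close> and
  \<open>r k + \<delta>\<close> persists nearby and captures a root. The windows are disjoint, so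
  the order of the roots forces the \<open>j\<close>-th root into the \<open>j\<close>-th window.
  Only pointwise convergence of values is used.\<close>

lemma roots_tendsto:
  fixes r :: "nat \<Rightarrow> real" and \<rho> :: "'b \<Rightarrow> nat \<Rightarrow> real"
  assumes r: "\<And>i j. i < j \<Longrightarrow> j < n \<Longrightarrow> r i < r j"
    and lim: "\<And>s. ((\<lambda>y. \<Prod>i<n. \<rho> y i - s) \<longlongrightarrow> (\<Prod>i<n. r i - s)) F"
    and \<rho>: "eventually (\<lambda>y. \<forall>i j. i < j \<longrightarrow> j < n \<longrightarrow> \<rho> y i < \<rho> y j) F"
    and "j < n"
  shows "((\<lambda>y. \<rho> y j) \<longlongrightarrow> r j) F"
proof (rule tendstoI)
  fix e :: real assume "e > 0"
  \<comment> \<open>\<open>\<delta>\<close> will be at most \<open>e / 2\<close> and a quarter of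
    the smallest gap, so that the windows around the \<open>r k\<close> are disjoint.\<close>
  define G where "G = insert e ((\<lambda>i. (r (Suc i) - r i) / 2) ` {..<n - 1})"
  define \<delta> where "\<delta> = Min G / 2"
  have "finite G" "G \<noteq> {}" by (auto simp: G_def)
  moreover have "\<forall>g\<in>G. g > 0"
    using \<open>e > 0\<close> r by (auto simp: G_def)
  ultimately have MG: "Min G > 0" by (subst Min_gr_iff) auto
  then have \<delta>0: "\<delta> > 0" by (simp add: \<delta>_def)
  have "Min G \<le> e" using \<open>finite G\<close> by (intro Min_le) (auto simp: G_def)
  then have \<delta>e: "\<delta> < e" using MG by (simp add: \<delta>_def)
  have \<delta>r: "2 * \<delta> < r (Suc i) - r i" if "Suc i < n" for i
  proof -
    have "Min G \<le> (r (Suc i) - r i) / 2"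
      using \<open>finite G\<close> that by (intro Min_le) (auto simp: G_def)
    then show ?thesis using MG unfolding \<delta>_def by simp
  qed
  have \<delta>lt: "r i + \<delta> < r k - \<delta>" if "i < k" "k < n" for i k
  proof -
    have "r (Suc i) \<le> r k" using r[of "Suc i" k] that by (cases "Suc i = k") auto
    then show ?thesis using \<delta>r[of i] that by simp
  qed
  have neg: "(\<Prod>i<n. r i - (r k - \<delta>)) * (\<Prod>i<n. r i - (r k + \<delta>)) < 0" if k: "k < n" for k
  proof -
    have "(\<Prod>i<n. r i - (r k - \<delta>)) * (\<Prod>i<n. r i - (r k + \<delta>))
        = (\<Prod>i<n. (r i - r k)\<^sup>2 - \<delta>\<^sup>2)"
      by (simp flip: prod.distrib) (simp add: algebra_simps power2_eq_square)
    also have "\<dots> = - \<delta>\<^sup>2 * (\<Prod>i\<in>{..<n} - {k}. (r i - r k)\<^sup>2 - \<delta>\<^sup>2)"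
      using k by (subst prod.remove[of _ k]) auto
    also have "\<dots> < 0"
    proof -
      have "(\<Prod>i\<in>{..<n} - {k}. (r i - r k)\<^sup>2 - \<delta>\<^sup>2) > 0"
      proof (rule prod_pos)
        fix i assume "i \<in> {..<n} - {k}"
        then have "\<delta> < \<bar>r i - r k\<bar>"
          using \<delta>lt[of i k] \<delta>lt[of k i] k \<delta>0 by (cases i k rule: linorder_cases) auto
        then have "\<delta>\<^sup>2 < (r i - r k)\<^sup>2" using \<delta>0 by (metis abs_of_pos power2_abs power2_strict_mono)
        then show "0 < (r i - r k)\<^sup>2 - \<delta>\<^sup>2" by simp
      qed
      then show ?thesis using \<delta>0 by (simp add: mult_pos_pos)
    qed
    finally show ?thesis .
  qed
  have "eventually (\<lambda>y. \<forall>k\<in>{..<n}.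
      (\<Prod>i<n. \<rho> y i - (r k - \<delta>)) * (\<Prod>i<n. \<rho> y i - (r k + \<delta>)) < 0) F"
  proof (intro eventually_ball_finite ballI)
    fix k assume "k \<in> {..<n}"
    then show "eventually (\<lambda>y. (\<Prod>i<n. \<rho> y i - (r k - \<delta>)) * (\<Prod>i<n. \<rho> y i - (r k + \<delta>)) < 0) F"
      using neg[of k] by (intro order_tendstoD(2)[OF tendsto_mult[OF lim lim]]) auto
  qed auto
  with \<rho> show "eventually (\<lambda>y. dist (\<rho> y j) (r j) < e) F"
  proof eventually_elim
    case (elim y)
    have "\<exists>i<n. r k - \<delta> < \<rho> y i \<and> \<rho> y i < r k + \<delta>" if "k < n" for k
    proof -
      have "\<exists>x>r k - \<delta>. x < r k + \<delta> \<and> poly (\<Prod>i<n. [:\<rho> y i, - 1:]) x = 0"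
        using elim(2) that \<delta>0 by (intro poly_IVT) (auto simp: poly_prod_roots)
      then show ?thesis by (auto simp: poly_prod_roots)
    qed
    then obtain f where f: "\<And>k. k < n \<Longrightarrow> f k < n \<and> r k - \<delta> < \<rho> y (f k) \<and> \<rho> y (f k) < r k + \<delta>"
      by metis
    have "f i < f k" if "i < k" "k < n" for i k
    proof (rule ccontr)
      assume "\<not> f i < f k"
      then have "\<rho> y (f k) \<le> \<rho> y (f i)"
        using elim(1) f[of i] f[of k] that by (cases "f i = f k") (auto intro: less_imp_le)
      then show False using f[of i] f[of k] \<delta>lt[of i k] that by simp
    qed
    then have "f j = j"
      using f \<open>j < n\<close> by (intro strict_mono_selfmap_id[of n]) auto
    then show ?case using f[OF \<open>j < n\<close>] \<delta>e unfolding dist_real_def abs_less_iff by simp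
  qed
qed

lemma finite_set_enum:
  fixes S :: "'a::linorder set"
  assumes "finite S"
  shows "\<exists>e :: nat \<Rightarrow> 'a. (\<forall>i j. i < j \<longrightarrow> j < card S \<longrightarrow> e i < e j) \<and> S = e ` {..<card S}"
proof (intro exI conjI allI impI)
  show "sorted_list_of_set S ! i < sorted_list_of_set S ! j" if "i < j" "j < card S" for i j
    using strict_sorted_list_of_set[of S] that assms by (auto simp: sorted_wrt_iff_nth_less)
  show "S = (!) (sorted_list_of_set S) ` {..<card S}"
    using set_sorted_list_of_set[OF assms]
    by (metis atLeast0LessThan length_sorted_list_of_set list.set_map map_nth set_upt)
qed

section \<open>Periodic discrete sets and round trips\<close>

definition periodic_discrete :: "real \<Rightarrow> real set \<Rightarrow> bool" where
  "periodic_discrete L Z \<longleftrightarrow> L > 0 \<and> (\<forall>t. t + L \<in> Z \<longleftrightarrow> t \<in> Z) \<and> (\<forall>a b. finite (Z \<inter> {a..b}))"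

definition period_count :: "real \<Rightarrow> real set \<Rightarrow> nat" where
  "period_count L Z = card (Z \<inter> {0..<L})"

lemma periodic_discrete_shift:
  assumes "periodic_discrete L Z"
  shows "t + of_int i * L \<in> Z \<longleftrightarrow> t \<in> Z"
proof (induction i arbitrary: t rule: int_induct[where k = 0])
  case (step1 i)
  then show ?case
    using assms step1.IH[of "t + L"] unfolding periodic_discrete_def
    by (metis (no_types, opaque_lifting) add.assoc add.commute distrib_right mult_1 of_int_1 of_int_add)
next
  case (step2 i)
  have "t - L \<in> Z \<longleftrightarrow> t \<in> Z"
    using assms unfolding periodic_discrete_def by (metis diff_add_cancel)
  then show ?case
    using step2.IH[of "t - L"] by (simp add: algebra_simps)
qed simp

lemma periodic_discrete_finite:
  assumes "periodic_discrete L Z"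
  shows "finite (Z \<inter> {a..<b})"
  using assms unfolding periodic_discrete_def
  by (meson Int_mono atLeastLessThan_subseteq_atLeastAtMost_iff finite_subset order_refl)

lemma card_window_le:
  assumes Z: "periodic_discrete L Z"
  shows "card (Z \<inter> {v..<v + L}) \<le> card (Z \<inter> {w..<w + L})"
proof (rule card_inj_on_le)
  have L: "L > 0" using Z by (simp add: periodic_discrete_def)
  define g where "g t = t + of_int (- \<lfloor>(t - w) / L\<rfloor>) * L" for t
  show "finite (Z \<inter> {w..<w + L})" by (rule periodic_discrete_finite[OF Z])
  have "g t \<in> {w..<w + L}" for t
  proof -
    have "of_int \<lfloor>(t - w) / L\<rfloor> \<le> (t - w) / L" "(t - w) / L < of_int \<lfloor>(t - w) / L\<rfloor> + 1"
      by linarith+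
    then have "of_int \<lfloor>(t - w) / L\<rfloor> * L \<le> t - w" "t - w < (of_int \<lfloor>(t - w) / L\<rfloor> + 1) * L"
      using L by (auto simp only: pos_le_divide_eq pos_divide_less_eq)
    then show ?thesis
      unfolding g_def of_int_minus distrib_right by auto
  qed
  moreover have "g t \<in> Z" if "t \<in> Z" for t
    using that unfolding g_def periodic_discrete_shift[OF Z] .
  ultimately show "g ` (Z \<inter> {v..<v + L}) \<subseteq> Z \<inter> {w..<w + L}" by blast
  show "inj_on g (Z \<inter> {v..<v + L})"
  proof (rule inj_onI)
    fix s t assume st: "s \<in> Z \<inter> {v..<v + L}" "t \<in> Z \<inter> {v..<v + L}" "g s = g t"
    define i where "i = \<lfloor>(s - w) / L\<rfloor> - \<lfloor>(t - w) / L\<rfloor>"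
    have eq: "s - t = of_int i * L"
      using st(3) by (simp add: g_def i_def algebra_simps)
    moreover have "\<bar>s - t\<bar> < L" using st by auto
    ultimately have "\<bar>of_int i\<bar> * L < 1 * L" using L by (simp add: abs_mult)
    then have "\<bar>real_of_int i\<bar> < 1" using L mult_less_cancel_right_pos by blast
    then have "i = 0" by linarith
    then show "s = t" using eq by simp
  qed
qed

lemma period_count_window:
  assumes "periodic_discrete L Z"
  shows "card (Z \<inter> {w..<w + L}) = period_count L Z"
  using card_window_le[OF assms, of w 0] card_window_le[OF assms, of 0 w]
  by (simp add: period_count_def)

lemma period_count_mult:
  assumes "periodic_discrete L Z"
  shows "period_count (real k * L) Z = k * period_count L Z"
proof (induction k)
  case (Suc k)
  have L: "L > 0" using assms by (simp add: periodic_discrete_def)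
  then have kL: "real k * L \<ge> 0" by simp
  have "Z \<inter> {0..<real (Suc k) * L}
      = (Z \<inter> {0..<real k * L}) \<union> (Z \<inter> {real k * L..<real k * L + L})"
    using L kL unfolding of_nat_Suc distrib_right mult_1 by (auto intro: order_trans[OF kL])
  moreover have "card ((Z \<inter> {0..<real k * L}) \<union> (Z \<inter> {real k * L..<real k * L + L}))
      = card (Z \<inter> {0..<real k * L}) + card (Z \<inter> {real k * L..<real k * L + L})"
    by (rule card_Un_disjoint) (auto intro: periodic_discrete_finite[OF assms])
  ultimately show ?case
    using Suc period_count_window[OF assms, of "real k * L"] by (simp add: period_count_def)
qed (simp add: period_count_def)

text \<open>Both sides count \<open>Z\<close> over time \<open>k * l\<close>. This converts counts
  over the period of the trajectory into counts over \<open>m\<close> bounces without relating the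
  two periods.\<close>

lemma period_count_commute:
  assumes "periodic_discrete (real k) Z" "periodic_discrete (real l) Z"
  shows "l * period_count (real k) Z = k * period_count (real l) Z"
  using period_count_mult[OF assms(1), of l] period_count_mult[OF assms(2), of k]
  by (simp add: mult.commute)

lemma period_enum:
  assumes Z: "periodic_discrete L Z" and w: "w \<in> Z"
  obtains e :: "nat \<Rightarrow> real" where "e 0 = w" "e (period_count L Z) = w + L"
    "\<And>i. i < period_count L Z \<Longrightarrow> e i < e (Suc i)"
    "\<And>i. i < period_count L Z \<Longrightarrow> Z \<inter> {e i<..<e (Suc i)} = {}"
    "\<And>i. i \<le> period_count L Z \<Longrightarrow> e i \<in> Z"
proof -
  define N where "N = period_count L Z"
  have L: "L > 0" using Z by (simp add: periodic_discrete_def)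
  let ?S = "Z \<inter> {w..w + L}"
  have wL: "w + L \<in> Z" using Z w by (simp add: periodic_discrete_def)
  then have S: "?S = insert (w + L) (Z \<inter> {w..<w + L})" using L by auto
  have cS: "card ?S = Suc N"
    unfolding S N_def using period_count_window[OF Z] by (simp add: periodic_discrete_finite[OF Z])
  have "finite ?S" using Z by (simp add: periodic_discrete_def)
  then obtain e where mono: "\<And>i j. i < j \<Longrightarrow> j < Suc N \<Longrightarrow> e i < e j" and eS: "?S = e ` {..<Suc N}"
    using finite_set_enum[of ?S] unfolding cS by blast
  have mono': "e i \<le> e j" if "i \<le> j" "j \<le> N" for i j
    using mono[of i j] that by (cases "i = j") auto
  have inS: "e i \<in> ?S" if "i \<le> N" for i
    unfolding eS using that by auto
  have "w \<in> ?S" "w + L \<in> ?S" using w wL L by auto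
  then obtain i j where ij: "i \<le> N" "w = e i" "j \<le> N" "w + L = e j"
    unfolding eS by (auto simp: less_Suc_eq_le)
  have e0: "e 0 = w" using mono'[of 0 i] inS[of 0] ij by auto
  have eN: "e N = w + L" using mono'[of j N] inS[of N] ij by auto
  show ?thesis
  proof (rule that[of e])
    fix i assume i: "i < period_count L Z"
    show "Z \<inter> {e i<..<e (Suc i)} = {}"
    proof (rule ccontr)
      assume "Z \<inter> {e i<..<e (Suc i)} \<noteq> {}"
      then obtain t where t: "t \<in> Z" "e i < t" "t < e (Suc i)" by auto
      have "t \<in> ?S" using t inS[of i] inS[of "Suc i"] i by (auto simp: N_def)
      then obtain k where k: "k \<le> N" "t = e k" unfolding eS by (auto simp: less_Suc_eq_le)
      have "i < k" using t(2) k mono'[of k i] i by (auto simp: N_def not_le[symmetric])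
      moreover have "k < Suc i" using t(3) k mono'[of "Suc i" k] i by (auto simp: N_def not_le[symmetric])
      ultimately show False by simp
    qed
  qed (use e0 eN mono inS in \<open>auto simp: N_def\<close>)
qed

lemma period_count_pos:
  assumes "periodic_discrete L Z" "w \<in> Z"
  shows "period_count L Z > 0"
proof -
  have "w \<in> Z \<inter> {w..<w + L}" using assms by (simp add: periodic_discrete_def)
  then show ?thesis
    using period_count_window[OF assms(1), of w] periodic_discrete_finite[OF assms(1)]
    by (metis card_gt_0_iff empty_iff)
qed

text \<open>The arcs between successive points of \<open>Z'\<close> tile one window, and a choice of
  a point of \<open>Z\<close> in each open arc is injective.\<close>

lemma period_count_interlace:
  assumes Z: "periodic_discrete L Z" and Z': "periodic_discrete L Z'"
    and sep: "\<And>s t. s \<in> Z' \<Longrightarrow> t \<in> Z' \<Longrightarrow> s < t \<Longrightarrow> Z' \<inter> {s<..<t} = {} \<Longrightarrow> Z \<inter> {s<..<t} \<noteq> {}"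
  shows "period_count L Z' \<le> period_count L Z"
proof (cases "Z' = {}")
  case True
  then show ?thesis by (simp add: period_count_def)
next
  case False
  then obtain w where w: "w \<in> Z'" by auto
  define N where "N = period_count L Z'"
  obtain e where e: "e 0 = w" "e N = w + L"
    "\<And>i. i < N \<Longrightarrow> e i < e (Suc i)" "\<And>i. i < N \<Longrightarrow> Z' \<inter> {e i<..<e (Suc i)} = {}"
    "\<And>i. i \<le> N \<Longrightarrow> e i \<in> Z'"
    using period_enum[OF Z' w] unfolding N_def by metis
  have "\<forall>i<N. \<exists>t. t \<in> Z \<inter> {e i<..<e (Suc i)}"
  proof (intro allI impI)
    fix i assume "i < N"
    then show "\<exists>t. t \<in> Z \<inter> {e i<..<e (Suc i)}"
      using sep[OF e(5)[of i] e(5)[of "Suc i"] e(3)[of i] e(4)[of i]] by auto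
  qed
  then obtain g where g: "\<And>i. i < N \<Longrightarrow> g i \<in> Z \<inter> {e i<..<e (Suc i)}" by metis
  have mono: "e i \<le> e j" if "i \<le> j" "j \<le> N" for i j
    using that
  proof (induction j rule: dec_induct)
    case (step k)
    then show ?case using e(3)[of k] by auto
  qed simp
  have "inj_on g {..<N}"
  proof (rule linorder_inj_onI')
    fix i j assume ij: "i \<in> {..<N}" "j \<in> {..<N}" "i < j"
    then show "g i \<noteq> g j" using g[of i] g[of j] mono[of "Suc i" j] by auto
  qed
  moreover have "g ` {..<N} \<subseteq> Z \<inter> {w..<w + L}"
  proof safe
    fix i assume "i < N"
    then show "g i \<in> Z" "g i \<in> {w..<w + L}"
      using g[of i] mono[of 0 i] mono[of "Suc i" N] e(1,2) by auto
  qed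
  ultimately have "card {..<N} \<le> card (Z \<inter> {w..<w + L})"
    by (intro card_inj_on_le periodic_discrete_finite[OF Z])
  then show ?thesis by (simp add: N_def period_count_window[OF Z])
qed

lemma partition_interval:
  fixes s :: "nat \<Rightarrow> 'a::linorder"
  assumes "s 0 \<le> t" "t < s k"
  shows "\<exists>i<k. s i \<le> t \<and> t < s (Suc i)"
  using assms
proof (induction k)
  case (Suc k)
  then show ?case by (cases "t < s k") (auto intro: less_SucI)
qed auto

text \<open>Monotonicity leaves the turning times as the only hits of the two levels, so
  \<open>k\<close> counts either kind. This makes the description by \<open>THE\<close> in the
  winding numbers determinate.\<close>

lemma round_trips_unique:
  assumes "round_trips f \<alpha> \<beta> L k" and Z: "periodic_discrete L {t. f t = \<alpha>}"
    and Z': "periodic_discrete L {t. f t = \<beta>}" and "\<alpha> < \<beta>"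
  shows "k = period_count L {t. f t = \<alpha>}" "k = period_count L {t. f t = \<beta>}"
proof -
  from assms(1) obtain s u where sL: "s k = s 0 + L" and
    su: "\<And>i. i < k \<Longrightarrow> s i < u i \<and> u i < s (Suc i) \<and>
               f (s i) = \<alpha> \<and> f (u i) = \<beta> \<and> f (s (Suc i)) = \<alpha> \<and>
               strict_mono_on {s i..u i} f \<and> strict_antimono_on {u i..s (Suc i)} f"
    unfolding round_trips_def by blast
  have up: "f x < f y" if "i < k" "s i \<le> x" "x < y" "y \<le> u i" for i x y
    using su[OF that(1)] that unfolding strict_mono_on_def by auto
  have down: "f y < f x" if "i < k" "u i \<le> x" "x < y" "y \<le> s (Suc i)" for i x y
    using su[OF that(1)] that unfolding monotone_on_def by auto
  have lt: "s i < s (Suc i)" if "i < k" for i using su[OF that] by linarith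
  have mono: "s i \<le> s j" if "i \<le> j" "j \<le> k" for i j
    using that
  proof (induction j rule: dec_induct)
    case (step j)
    then show ?case using lt[of j] by auto
  qed simp
  have only_s: "t = s i" if "i < k" "s i \<le> t" "t < s (Suc i)" "f t = \<alpha>" for i t
  proof (rule ccontr)
    assume "t \<noteq> s i"
    then have st: "s i < t" using that by simp
    show False
      using up[OF that(1) _ st] down[OF that(1) _ that(3)] su[OF that(1)] that(4)
      by (cases "t \<le> u i") auto
  qed
  have only_u: "t = u i" if "i < k" "s i \<le> t" "t < s (Suc i)" "f t = \<beta>" for i t
  proof (rule ccontr)
    assume "t \<noteq> u i"
    then consider "t < u i" | "u i < t" by linarith
    then show False
      using up[OF that(1,2), of "u i"] down[OF that(1), of "u i" t] su[OF that(1)] that(3,4)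
      by cases auto
  qed
  have "{t. f t = \<alpha>} \<inter> {s 0..<s 0 + L} = s ` {..<k}"
  proof (intro equalityI subsetI)
    fix t assume t: "t \<in> {t. f t = \<alpha>} \<inter> {s 0..<s 0 + L}"
    then obtain i where "i < k" "s i \<le> t" "t < s (Suc i)"
      using partition_interval[of s t k] sL by auto
    then show "t \<in> s ` {..<k}" using only_s[of i t] t by auto
  next
    fix t assume "t \<in> s ` {..<k}"
    then obtain i where "i < k" "t = s i" by auto
    then show "t \<in> {t. f t = \<alpha>} \<inter> {s 0..<s 0 + L}"
      using su[of i] mono[of 0 i] mono[of "Suc i" k] sL lt[of i] by auto
  qed
  moreover have "inj_on s {..<k}"
  proof (rule linorder_inj_onI')
    fix i j assume "i \<in> {..<k}" "j \<in> {..<k}" "i < j"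
    then show "s i \<noteq> s j" using lt[of i] mono[of "Suc i" j] by auto
  qed
  ultimately show "k = period_count L {t. f t = \<alpha>}"
    using period_count_window[OF Z, of "s 0"] by (simp add: card_image)
  have "{t. f t = \<beta>} \<inter> {s 0..<s 0 + L} = u ` {..<k}"
  proof (intro equalityI subsetI)
    fix t assume t: "t \<in> {t. f t = \<beta>} \<inter> {s 0..<s 0 + L}"
    then obtain i where "i < k" "s i \<le> t" "t < s (Suc i)"
      using partition_interval[of s t k] sL by auto
    then show "t \<in> u ` {..<k}" using only_u[of i t] t by auto
  next
    fix t assume "t \<in> u ` {..<k}"
    then obtain i where "i < k" "t = u i" by auto
    then show "t \<in> {t. f t = \<beta>} \<inter> {s 0..<s 0 + L}"
      using su[of i] mono[of 0 i] mono[of "Suc i" k] sL by auto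
  qed
  moreover have "inj_on u {..<k}"
  proof (rule linorder_inj_onI')
    fix i j assume "i \<in> {..<k}" "j \<in> {..<k}" "i < j"
    then show "u i \<noteq> u j" using su[of i] su[of j] mono[of "Suc i" j] by auto
  qed
  ultimately show "k = period_count L {t. f t = \<beta>}"
    using period_count_window[OF Z', of "s 0"] by (simp add: card_image)
qed

text \<open>If \<open>f p = f r\<close>, interior extrema on \<open>{p..r}\<close> are excluded, so
  maximum and minimum both equal \<open>f p\<close> and \<open>f\<close> is constant there, which
  \<open>loc\<close> forbids as well.\<close>

lemma no_local_extremum_imp_inj:
  fixes f :: "real \<Rightarrow> real"
  assumes cont: "continuous_on {x..y} f"
    and loc: "\<And>t d. x < t \<Longrightarrow> t < y \<Longrightarrow> d > 0 \<Longrightarrow> \<exists>t1 t2. \<bar>t1 - t\<bar> < d \<and> \<bar>t2 - t\<bar> < d \<and> f t1 < f t \<and> f t < f t2"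
  shows "inj_on f {x..y}"
proof (rule linorder_inj_onI')
  fix p r assume pr: "p \<in> {x..y}" "r \<in> {x..y}" "p < r"
  show "f p \<noteq> f r"
  proof
    assume eq: "f p = f r"
    have c: "continuous_on {p..r} f"
      using pr by (intro continuous_on_subset[OF cont]) auto
    have interior: "\<exists>t1\<in>{p..r}. \<exists>t2\<in>{p..r}. f t1 < f t \<and> f t < f t2" if t: "p < t" "t < r" for t
    proof -
      obtain t1 t2 where "\<bar>t1 - t\<bar> < min (t - p) (r - t)" "\<bar>t2 - t\<bar> < min (t - p) (r - t)"
        "f t1 < f t" "f t < f t2"
        using loc[of t "min (t - p) (r - t)"] t pr by auto
      then show ?thesis by (intro bexI[of _ t1] bexI[of _ t2]) auto
    qed
    obtain M where M: "M \<in> {p..r}" "\<And>t. t \<in> {p..r} \<Longrightarrow> f t \<le> f M"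
      using continuous_attains_sup[OF compact_Icc _ c] pr by auto
    obtain m where m: "m \<in> {p..r}" "\<And>t. t \<in> {p..r} \<Longrightarrow> f m \<le> f t"
      using continuous_attains_inf[OF compact_Icc _ c] pr by auto
    have "f M = f p"
    proof (cases "M = p \<or> M = r")
      case False
      then obtain t where "t \<in> {p..r}" "f M < f t"
        using interior[of M] M(1) by auto
      then show ?thesis using M(2)[of t] by simp
    qed (use eq in auto)
    moreover have "f m = f p"
    proof (cases "m = p \<or> m = r")
      case False
      then obtain t where "t \<in> {p..r}" "f t < f m"
        using interior[of m] m(1) by auto
      then show ?thesis using m(2)[of t] by simp
    qed (use eq in auto)
    ultimately have const: "f t = f p" if "t \<in> {p..r}" for t
      using M(2)[OF that] m(2)[OF that] by simp
    obtain t1 where "t1 \<in> {p..r}" "f t1 < f ((p + r) / 2)"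
      using interior[of "(p + r) / 2"] pr by auto
    then show False using const[of t1] const[of "(p + r) / 2"] pr by simp
  qed
qed

lemma continuous_inj_less_imp_strict_mono:
  fixes f :: "real \<Rightarrow> real"
  assumes "continuous_on {a..b} f" "inj_on f {a..b}" "a < b" "f a < f b"
  shows "strict_mono_on {a..b} f"
proof (rule strict_mono_onI)
  have ends: "f a < f x \<and> f x < f b" if "a < x" "x < b" for x
    using continuous_inj_imp_mono[OF that assms(1,2)] assms(4) by auto
  fix r s assume rs: "r \<in> {a..b}" "s \<in> {a..b}" "r < s"
  show "f r < f s"
  proof (cases "s = b")
    case True
    then show ?thesis using ends[of r] rs assms(4) by (cases "r = a") auto
  next
    case False
    then have "a < s" "s < b" using rs by auto
    show ?thesis
    proof (cases "r = a")
      case True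
      then show ?thesis using ends[of s] \<open>a < s\<close> \<open>s < b\<close> by simp
    next
      case False
      then have "a < r" using rs by auto
      have "continuous_on {a..s} f" "inj_on f {a..s}"
        using \<open>s < b\<close> by (auto intro: continuous_on_subset[OF assms(1)] inj_on_subset[OF assms(2)])
      from continuous_inj_imp_mono[OF \<open>a < r\<close> rs(3) this] show ?thesis
        using ends[of r] \<open>a < r\<close> rs \<open>s < b\<close> by auto
    qed
  qed
qed

text \<open>Between successive hits of the two levels \<open>f\<close> is injective, so successive
  hits are at different levels: they alternate, and two consecutive arcs form one round
  trip.\<close>

lemma round_trips_iff_count:
  fixes f :: "real \<Rightarrow> real"
  assumes L: "L > 0" and cont: "continuous_on UNIV f" and per: "\<And>t. f (t + L) = f t"
    and "\<alpha> < \<beta>" and range: "\<And>t. \<alpha> \<le> f t \<and> f t \<le> \<beta>"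
    and fin: "\<And>a b. finite ({t. f t = \<alpha> \<or> f t = \<beta>} \<inter> {a..b})"
    and loc: "\<And>t d. \<alpha> < f t \<Longrightarrow> f t < \<beta> \<Longrightarrow> d > 0 \<Longrightarrow>
      \<exists>t1 t2. \<bar>t1 - t\<bar> < d \<and> \<bar>t2 - t\<bar> < d \<and> f t1 < f t \<and> f t < f t2"
  shows "round_trips f \<alpha> \<beta> L k \<longleftrightarrow> k = period_count L {t. f t = \<alpha>}"
    and "period_count L {t. f t = \<alpha>} = period_count L {t. f t = \<beta>}"
    and "period_count L {t. f t = \<alpha>} > 0"
proof -
  let ?H = "{t. f t = \<alpha> \<or> f t = \<beta>}"
  have H: "periodic_discrete L ?H"
    unfolding periodic_discrete_def
  proof (intro conjI allI)
    show "finite (?H \<inter> {a..b})" for a b by (rule fin)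
    show "(t + L \<in> ?H) = (t \<in> ?H)" for t by (simp add: per)
  qed (rule L)
  have Z: "periodic_discrete L {t. f t = \<alpha>}"
    unfolding periodic_discrete_def
  proof (intro conjI allI)
    show "finite ({t. f t = \<alpha>} \<inter> {a..b})" for a b
      by (rule finite_subset[OF _ fin[of a b]]) auto
  qed (use L per in \<open>simp_all\<close>)
  have Z': "periodic_discrete L {t. f t = \<beta>}"
    unfolding periodic_discrete_def
  proof (intro conjI allI)
    show "finite ({t. f t = \<beta>} \<inter> {a..b})" for a b
      by (rule finite_subset[OF _ fin[of a b]]) auto
  qed (use L per in \<open>simp_all\<close>)
  have inj: "inj_on f {x..y}" if "?H \<inter> {x<..<y} = {}" for x y
  proof (rule no_local_extremum_imp_inj)
    show "continuous_on {x..y} f" by (rule continuous_on_subset[OF cont]) auto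
    fix t d :: real assume "x < t" "t < y" "d > 0"
    then have "f t \<noteq> \<alpha>" "f t \<noteq> \<beta>" using that by auto
    then have "\<alpha> < f t" "f t < \<beta>" using range[of t] by linarith+
    then show "\<exists>t1 t2. \<bar>t1 - t\<bar> < d \<and> \<bar>t2 - t\<bar> < d \<and> f t1 < f t \<and> f t < f t2"
      using \<open>d > 0\<close> by (rule loc)
  qed
  have "?H \<noteq> {}"
  proof
    assume "?H = {}"
    then have i: "inj_on f {0..L}" by (intro inj) blast
    have "f 0 = f L" using per[of 0] by simp
    then show False using inj_onD[OF i, of 0 L] L by auto
  qed
  then obtain h where h: "h \<in> ?H" by auto
  define N where "N = period_count L ?H"
  have alt: "f x \<noteq> f y" if "x < y" "?H \<inter> {x<..<y} = {}" for x y
  proof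
    assume "f x = f y"
    then show False using inj_onD[OF inj[OF that(2)], of x y] that(1) by auto
  qed
  have "\<exists>w. f w = \<alpha>"
  proof (cases "f h = \<alpha>")
    case False
    obtain e where e: "e 0 = h" "\<And>i. i < N \<Longrightarrow> e i < e (Suc i)" "\<And>i. i < N \<Longrightarrow> ?H \<inter> {e i<..<e (Suc i)} = {}"
      "\<And>i. i \<le> N \<Longrightarrow> e i \<in> ?H"
      using period_enum[OF H h] unfolding N_def by blast
    have N: "0 < N" using period_count_pos[OF H h] by (simp add: N_def)
    have "f h \<noteq> f (e (Suc 0))" using alt[OF e(2,3)[OF N]] e(1) by simp
    moreover have "e (Suc 0) \<in> ?H" using e(4)[of "Suc 0"] N by simp
    ultimately show ?thesis using False h by auto
  qed auto
  then obtain w where w: "f w = \<alpha>" by auto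
  then have wH: "w \<in> ?H" by simp
  obtain e where e: "e 0 = w" "e N = w + L"
    "\<And>i. i < N \<Longrightarrow> e i < e (Suc i)" "\<And>i. i < N \<Longrightarrow> ?H \<inter> {e i<..<e (Suc i)} = {}"
    "\<And>i. i \<le> N \<Longrightarrow> e i \<in> ?H"
    using period_enum[OF H wH] unfolding N_def by blast
  have ev: "f (e i) = (if even i then \<alpha> else \<beta>)" if "i \<le> N" for i
    using that
  proof (induction i)
    case (Suc i)
    then show ?case using alt[OF e(3,4)[of i]] e(5)[of "Suc i"] by (auto split: if_splits)
  qed (simp add: e w)
  have "f (e N) = \<alpha>" using e(2) per[of w] w by simp
  \<comment> \<open>After one period the level is \<open>\<alpha>\<close> again, so alternation
    makes the number of hits even.\<close>
  then obtain M where M: "N = 2 * M" using ev[of N] \<open>\<alpha> < \<beta>\<close> by (auto split: if_splits)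
  have rt: "round_trips f \<alpha> \<beta> L M"
    unfolding round_trips_def
  proof (intro exI conjI allI impI)
    show "e (2 * M) = e (2 * 0) + L" using e M by simp
    fix i assume i: "i < M"
    then have b: "2 * i < N" "2 * i + 1 < N" using M by auto
    show lt: "e (2 * i) < e (2 * i + 1)" "e (2 * i + 1) < e (2 * Suc i)"
      using e(3)[OF b(1)] e(3)[OF b(2)] by auto
    show fs: "f (e (2 * i)) = \<alpha>" "f (e (2 * i + 1)) = \<beta>" "f (e (2 * Suc i)) = \<alpha>"
      using ev[of "2 * i"] ev[of "2 * i + 1"] ev[of "2 * Suc i"] b by auto
    have c: "continuous_on {x..y} f" for x y
      by (rule continuous_on_subset[OF cont]) auto
    have "inj_on f {e (2 * i)..e (2 * i + 1)}"
      using inj[OF e(4)[OF b(1)]] by simp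
    then show "strict_mono_on {e (2 * i)..e (2 * i + 1)} f"
      using lt fs \<open>\<alpha> < \<beta>\<close> by (intro continuous_inj_less_imp_strict_mono c) simp_all
    have "inj_on (\<lambda>t. - f t) {e (2 * i + 1)..e (2 * Suc i)}"
      using inj[OF e(4)[OF b(2)]] by (simp add: inj_on_def)
    then have "strict_mono_on {e (2 * i + 1)..e (2 * Suc i)} (\<lambda>t. - f t)"
      using lt fs \<open>\<alpha> < \<beta>\<close> by (intro continuous_inj_less_imp_strict_mono continuous_on_minus c) simp_all
    then show "strict_antimono_on {e (2 * i + 1)..e (2 * Suc i)} f"
      unfolding strict_mono_on_def monotone_on_def by auto
  qed
  show "period_count L {t. f t = \<alpha>} = period_count L {t. f t = \<beta>}"
    using round_trips_unique[OF rt Z Z' \<open>\<alpha> < \<beta>\<close>] by simp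
  show "round_trips f \<alpha> \<beta> L k \<longleftrightarrow> k = period_count L {t. f t = \<alpha>}"
    using rt round_trips_unique(1)[OF _ Z Z' \<open>\<alpha> < \<beta>\<close>] by metis
  show "period_count L {t. f t = \<alpha>} > 0"
    using w by (intro period_count_pos[OF Z, of w]) simp
qed

section \<open>Piecewise linear interpolation\<close>

text \<open>The formula of \<open>trajectory_path\<close> for values in any vector space: it is
  applied to impact points and to scalar solutions of the string equation alike.\<close>

definition interp :: "(int \<Rightarrow> 'a::real_vector) \<Rightarrow> real \<Rightarrow> 'a" where
  "interp y t = y \<lfloor>t\<rfloor> + frac t *\<^sub>R (y (\<lfloor>t\<rfloor> + 1) - y \<lfloor>t\<rfloor>)"

lemma interp_segment:
  assumes "of_int k \<le> t" "t \<le> of_int k + 1"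
  shows "interp y t = y k + (t - of_int k) *\<^sub>R (y (k + 1) - y k)"
proof (cases "t = of_int k + 1")
  case True
  then have "\<lfloor>t\<rfloor> = k + 1" by linarith
  then show ?thesis using True by (simp add: interp_def frac_def)
next
  case False
  then have "\<lfloor>t\<rfloor> = k" using assms by linarith
  then show ?thesis by (simp add: interp_def frac_def)
qed

lemma interp_of_int [simp]: "interp y (of_int k) = y k"
  using interp_segment[of k "of_int k" y] by simp

lemma continuous_on_interp: "continuous_on A (interp y)"
  for y :: "int \<Rightarrow> 'a::real_normed_vector"
proof -
  let ?g = "\<lambda>k t. y k + (t - of_int k) *\<^sub>R (y (k + 1) - y k)"
  have "isCont (interp y) t" for t
    unfolding continuous_at_split
  proof
    have eq: "((?g k) \<longlongrightarrow> interp y t) (at t within B)" if "of_int k \<le> t" "t \<le> of_int k + 1" for k B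
      unfolding interp_segment[OF that] by (intro tendsto_intros)
    show "continuous (at_left t) (interp y)"
      unfolding continuous_within
    proof (rule Lim_transform_eventually)
      define k where "k = \<lceil>t\<rceil> - 1"
      have k: "of_int k < t" "t \<le> of_int k + 1" unfolding k_def by linarith+
      show "((?g k) \<longlongrightarrow> interp y t) (at_left t)" using k by (intro eq) auto
      show "\<forall>\<^sub>F s in at_left t. ?g k s = interp y s"
        unfolding eventually_at_left_field
        using k by (intro exI[of _ "of_int k"]) (auto simp: interp_segment[of k])
    qed
    show "continuous (at_right t) (interp y)"
      unfolding continuous_within
    proof (rule Lim_transform_eventually)
      define k where "k = \<lfloor>t\<rfloor>"
      have k: "of_int k \<le> t" "t < of_int k + 1" unfolding k_def by linarith+
      show "((?g k) \<longlongrightarrow> interp y t) (at_right t)" using k by (intro eq) auto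
      show "\<forall>\<^sub>F s in at_right t. ?g k s = interp y s"
        unfolding eventually_at_right_field
        using k by (intro exI[of _ "of_int k + 1"]) (auto simp: interp_segment[of k])
    qed
  qed
  then show ?thesis by (simp add: continuous_at_imp_continuous_on)
qed

section \<open>The discrete string equation\<close>

text \<open>Backward iteration uses the right inverse \<open>G\<close>; the index
  \<open>- int n - 1\<close> is that of the step from \<open>- (n + 1)\<close> to
  \<open>- n\<close>, which is undone.\<close>

lemma int_recursion:
  fixes F G :: "int \<Rightarrow> 'a \<Rightarrow> 'a"
  assumes "\<And>k x. F k (G k x) = x"
  shows "\<exists>f. f 0 = x0 \<and> (\<forall>k. f (k + 1) = F k (f k))"
proof -
  define fwd where "fwd = rec_nat x0 (\<lambda>n. F (int n))"
  define bwd where "bwd = rec_nat x0 (\<lambda>n. G (- int n - 1))"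
  define f where "f k = (if k \<ge> 0 then fwd (nat k) else bwd (nat (- k)))" for k
  have "f (k + 1) = F k (f k)" for k
  proof (cases "k \<ge> 0")
    case True
    then have "nat (k + 1) = Suc (nat k)" by simp
    then show ?thesis using True by (simp add: f_def fwd_def)
  next
    case False
    define m where "m = nat (- k - 1)"
    have m: "nat (- k) = Suc m" "- int m - 1 = k" using False by (auto simp: m_def)
    have "f (k + 1) = bwd m"
      using False by (cases "k = -1") (auto simp: f_def fwd_def bwd_def m_def)
    then show ?thesis using False m assms by (simp add: f_def bwd_def)
  qed
  moreover have "f 0 = x0" by (simp add: f_def fwd_def)
  ultimately show ?thesis by blast
qed

text \<open>A weightless string with beads: \<open>\<tau>\<close> are the spacings,
  \<open>\<kappa> / s\<close> the strengths of the beads, and \<open>w\<close> will be the slopes.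
  Raising \<open>s\<close> weakens the beads and slows the oscillation.\<close>

locale string =
  fixes \<tau> \<kappa> :: "int \<Rightarrow> real"
  assumes \<tau>_pos: "\<tau> k > 0" and \<kappa>_pos: "\<kappa> k > 0"
begin

definition solution :: "real \<Rightarrow> (int \<Rightarrow> real) \<Rightarrow> (int \<Rightarrow> real) \<Rightarrow> bool" where
  "solution s y w \<longleftrightarrow> (\<forall>k. y (k + 1) = y k + \<tau> k * w k \<and> w (k + 1) = w k - \<kappa> (k + 1) / s * y (k + 1))"

lemma solution_pos: "solution s y w \<Longrightarrow> y (k + 1) = y k + \<tau> k * w k"
  and solution_vel: "solution s y w \<Longrightarrow> w (k + 1) = w k - \<kappa> (k + 1) / s * y (k + 1)"
  by (auto simp: solution_def)

lemma solution_exists: "\<exists>y w. solution s y w \<and> y 0 = y0 \<and> w 0 = w0"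
proof -
  define F where "F k x = (case x of (y, w) \<Rightarrow>
    (y + \<tau> k * w, w - \<kappa> (k + 1) / s * (y + \<tau> k * w)))" for k x
  define G where "G k x = (case x of (y, w) \<Rightarrow>
    (y - \<tau> k * (w + \<kappa> (k + 1) / s * y), w + \<kappa> (k + 1) / s * y))" for k x
  have "F k (G k x) = x" for k x
    by (cases x) (simp add: F_def G_def)
  from int_recursion[of F G "(y0, w0)", OF this]
  obtain f where f: "f 0 = (y0, w0)" "\<And>k. f (k + 1) = F k (f k)" by auto
  have "solution s (\<lambda>k. fst (f k)) (\<lambda>k. snd (f k))"
    unfolding solution_def f(2) by (auto simp: F_def split: prod.splits)
  then show ?thesis
    using f(1) by (intro exI[of _ "\<lambda>k. fst (f k)"] exI[of _ "\<lambda>k. snd (f k)"]) auto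
qed

lemma solution_unique:
  assumes "solution s y w" "solution s y' w'" "y j = y' j" "w j = w' j"
  shows "y k = y' k \<and> w k = w' k"
proof (induction k rule: int_induct[where k = j])
  case (step1 i)
  then show ?case
    using solution_pos[OF assms(1), of i] solution_pos[OF assms(2), of i]
      solution_vel[OF assms(1), of i] solution_vel[OF assms(2), of i] by simp
next
  case (step2 i)
  have "w (i - 1) = w' (i - 1)"
    using step2 solution_vel[OF assms(1), of "i - 1"] solution_vel[OF assms(2), of "i - 1"] by simp
  then show ?case
    using step2 solution_pos[OF assms(1), of "i - 1"] solution_pos[OF assms(2), of "i - 1"] by simp
qed (use assms in auto)

lemma solution_scale: "solution s y w \<Longrightarrow> solution s (\<lambda>k. c * y k) (\<lambda>k. c * w k)"
  unfolding solution_def by (metis (no_types, lifting) distrib_left mult.left_commute right_diff_distrib)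

lemma solution_nonzero:
  assumes "solution s y w" "y j \<noteq> 0 \<or> w j \<noteq> 0"
  shows "y k \<noteq> 0 \<or> w k \<noteq> 0"
proof -
  have "solution s (\<lambda>_. 0) (\<lambda>_. 0)" by (simp add: solution_def)
  from solution_unique[OF assms(1) this, of k j] show ?thesis using assms(2) by auto
qed

section \<open>Zeros of solutions and Sturm comparison\<close>

lemma solution_segment:
  assumes "solution s y w" "of_int k \<le> t" "t \<le> of_int k + 1"
  shows "interp y t = y k + (t - of_int k) * (\<tau> k * w k)"
  using interp_segment[OF assms(2,3), of y] solution_pos[OF assms(1), of k] by simp

text \<open>On each unit segment a nontrivial solution is affine and not identically zero, so it has
  at most one zero there and \<open>floor\<close> is injective on the zeros.\<close>

lemma finite_zeros:
  assumes sol: "solution s y w" and nz: "y j \<noteq> 0 \<or> w j \<noteq> 0"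
  shows "finite ({t. interp y t = 0} \<inter> {a..b})"
proof (rule finite_imageD)
  show "finite (floor ` ({t. interp y t = 0} \<inter> {a..b}))"
    by (rule finite_subset[of _ "{\<lfloor>a\<rfloor>..\<lfloor>b\<rfloor>}"]) (auto intro: floor_mono)
  show "inj_on floor ({t. interp y t = 0} \<inter> {a..b})"
  proof (rule inj_onI)
    fix t t' assume *: "t \<in> {t. interp y t = 0} \<inter> {a..b}" "t' \<in> {t. interp y t = 0} \<inter> {a..b}" "\<lfloor>t\<rfloor> = \<lfloor>t'\<rfloor>"
    define k where "k = \<lfloor>t\<rfloor>"
    have "of_int k \<le> t" "t \<le> of_int k + 1" "of_int k \<le> t'" "t' \<le> of_int k + 1"
      using *(3) unfolding k_def by linarith+
    then have eq: "y k + (t - of_int k) * (\<tau> k * w k) = 0" "y k + (t' - of_int k) * (\<tau> k * w k) = 0"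
      using * solution_segment[OF sol] by auto
    have "y k \<noteq> 0 \<or> w k \<noteq> 0" by (rule solution_nonzero[OF sol nz])
    then have "w k \<noteq> 0" using eq(1) by (cases "w k = 0") auto
    have "(t - of_int k) * (\<tau> k * w k) = (t' - of_int k) * (\<tau> k * w k)"
      using eq by (metis add_left_cancel)
    then show "t = t'" using \<tau>_pos[of k] \<open>w k \<noteq> 0\<close> by simp
  qed
qed

text \<open>The slope is positive on the segment leaving \<open>t1\<close> and negative on the one
  arriving at \<open>t2\<close>; the index \<open>\<lceil>t2\<rceil> - 1\<close> selects the
  arriving segment even if \<open>t2\<close> is a bead. The two segments differ, so a bead lies
  strictly inside the arc.\<close>

lemma positive_arc:
  assumes sol: "solution s y w" and "t1 < t2" "interp y t1 = 0" "interp y t2 = 0"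
    and pos: "\<And>t. t1 < t \<Longrightarrow> t < t2 \<Longrightarrow> interp y t > 0"
  shows "w \<lfloor>t1\<rfloor> > 0" "w (\<lceil>t2\<rceil> - 1) < 0" "\<lfloor>t1\<rfloor> < \<lceil>t2\<rceil> - 1" "w \<lfloor>t2\<rfloor> < 0"
proof -
  define k where "k = \<lfloor>t1\<rfloor>"
  define l where "l = \<lceil>t2\<rceil> - 1"
  have k: "of_int k \<le> t1" "t1 < of_int k + 1" unfolding k_def by linarith+
  have l: "of_int l < t2" "t2 \<le> of_int l + 1" unfolding l_def by linarith+
  define t where "t = (t1 + min t2 (of_int k + 1)) / 2"
  have t: "t1 < t" "t < t2" "t < of_int k + 1" using \<open>t1 < t2\<close> k by (auto simp: t_def)
  have "interp y t = interp y t1 + (t - t1) * (\<tau> k * w k)"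
    using solution_segment[OF sol, of k t] solution_segment[OF sol, of k t1] t k
    by (simp add: algebra_simps)
  then have "(t - t1) * (\<tau> k * w k) > 0" using pos[OF t(1,2)] assms by simp
  then show wk: "w \<lfloor>t1\<rfloor> > 0" using t(1) \<tau>_pos[of k] by (simp add: k_def zero_less_mult_iff)
  define r where "r = (t2 + max t1 (of_int l)) / 2"
  have r: "t1 < r" "r < t2" "r > of_int l" using \<open>t1 < t2\<close> l by (auto simp: r_def)
  have "interp y r = interp y t2 + (r - t2) * (\<tau> l * w l)"
    using solution_segment[OF sol, of l r] solution_segment[OF sol, of l t2] r l
    by (simp add: algebra_simps)
  then have "(r - t2) * (\<tau> l * w l) > 0" using pos[OF r(1,2)] assms by simp
  then show wl: "w (\<lceil>t2\<rceil> - 1) < 0" using r(2) \<tau>_pos[of l] by (simp add: l_def zero_less_mult_iff mult_less_0_iff)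
  have "k \<le> l" using k l \<open>t1 < t2\<close> unfolding k_def l_def by linarith
  then show "\<lfloor>t1\<rfloor> < \<lceil>t2\<rceil> - 1" using wk wl by (cases "k = l") (auto simp: k_def l_def)
  show "w \<lfloor>t2\<rfloor> < 0"
  proof (cases "t2 = of_int l + 1")
    case True
    then have t2: "t2 = of_int (l + 1)" by simp
    then have "y (l + 1) = 0" using assms(4) interp_of_int[of y "l + 1"] by simp
    \<comment> \<open>A bead at height 0 gives no kick, so the slope passes through
      unchanged.\<close>
    then have "w (l + 1) = w l" using solution_vel[OF sol, of l] by simp
    moreover have "\<lfloor>t2\<rfloor> = l + 1" using t2 by linarith
    ultimately show ?thesis using wl by (simp add: l_def)
  next
    case False
    then have "\<lfloor>t2\<rfloor> = l" using l by linarith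
    then show ?thesis using wl by (simp add: l_def)
  qed
qed

lemma nonzero_arc_sign:
  assumes "\<And>t. t1 < t \<Longrightarrow> t < t2 \<Longrightarrow> interp y t \<noteq> (0::real)"
  shows "(\<forall>t. t1 < t \<longrightarrow> t < t2 \<longrightarrow> interp y t > 0) \<or> (\<forall>t. t1 < t \<longrightarrow> t < t2 \<longrightarrow> interp y t < 0)"
proof (rule ccontr)
  assume "\<not> ?thesis"
  then obtain s t where st: "t1 < s" "s < t2" "interp y s < 0" "t1 < t" "t < t2" "interp y t > 0"
    using assms by (metis linorder_neqE)
  have conn: "connected (interp y ` {t1<..<t2})"
    by (intro connected_continuous_image continuous_on_interp) simp
  have "interp y s \<in> interp y ` {t1<..<t2}" "interp y t \<in> interp y ` {t1<..<t2}"
    using st by auto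
  then have "0 \<in> interp y ` {t1<..<t2}"
    using connectedD_interval[OF conn, of "interp y s" "interp y t" 0] st by simp
  then show False using assms by auto
qed

lemma interp_uminus: "interp (\<lambda>k. - y k) t = - interp y t"
  by (simp add: interp_def algebra_simps)

lemma solution_uminus: "solution s y w \<Longrightarrow> solution s (\<lambda>k. - y k) (\<lambda>k. - w k)"
  using solution_scale[of s y w "-1"] by simp

text \<open>The Wronskian is nonnegative at the start of the arc and nonpositive at its end, yet it
  grows strictly at each interior bead because \<open>\<kappa> / s > \<kappa> / s'\<close>; by
  \<open>positive_arc\<close> there is at least one.\<close>

lemma sturm_pos:
  assumes sol: "solution s y w" and sol': "solution s' y' w'" and s: "0 < s" "s < s'"
    and t12: "t1 < t2" and zero: "interp y' t1 = 0" "interp y' t2 = 0"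
    and pos': "\<And>t. t1 < t \<Longrightarrow> t < t2 \<Longrightarrow> interp y' t > 0"
    and pos: "\<And>t. t1 < t \<Longrightarrow> t < t2 \<Longrightarrow> interp y t > 0"
  shows False
proof -
  define k where "k = \<lfloor>t1\<rfloor>"
  define l where "l = \<lceil>t2\<rceil> - 1"
  have k: "of_int k \<le> t1" "t1 < of_int k + 1" unfolding k_def by linarith+
  have l: "of_int l < t2" "t2 \<le> of_int l + 1" unfolding l_def by linarith+
  have arc: "w' k > 0" "w' l < 0" "k < l"
    using positive_arc[OF sol' t12 zero pos'] by (auto simp: k_def l_def)
  have nonneg: "interp y t \<ge> 0" if "t1 \<le> t" "t \<le> t2" for t
  proof (rule continuous_ge_on_closure[of "{t1<..<t2}" "interp y"])
    show "t \<in> closure {t1<..<t2}" using that t12 by simp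
  qed (use pos in \<open>auto intro: continuous_on_interp less_imp_le\<close>)
  \<comment> \<open>The discrete Wronskian: constant on segments, with positive jumps at the vertices.\<close>
  define D where "D i = w' i * y i - y' i * w i" for i
  have D_seg: "D i = w' i * interp y t - interp y' t * w i" if "of_int i \<le> t" "t \<le> of_int i + 1" for i t
    unfolding D_def solution_segment[OF sol that] solution_segment[OF sol' that]
    by (simp add: algebra_simps)
  have "D k \<ge> 0"
    using D_seg[of k t1] k zero arc nonneg[of t1] t12 by simp
  have "D l \<le> 0"
    using D_seg[of l t2] l zero arc nonneg[of t2] t12 by (simp add: mult_nonpos_nonneg)
  have step: "D i < D (i + 1)" if "k \<le> i" "i < l" for i
  proof -
    have i1: "t1 < of_int (i + 1)" "of_int (i + 1) < t2"
      using that k l by linarith+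
    then have p: "y (i + 1) > 0" "y' (i + 1) > 0"
      using pos[OF i1] pos'[OF i1] unfolding interp_of_int by auto
    have "D i = w' i * y (i + 1) - y' (i + 1) * w i"
      using D_seg[of i "of_int i + 1"] interp_of_int[of y "i + 1"] interp_of_int[of y' "i + 1"] by simp
    moreover have "D (i + 1) = (w' i - \<kappa> (i + 1) / s' * y' (i + 1)) * y (i + 1)
        - y' (i + 1) * (w i - \<kappa> (i + 1) / s * y (i + 1))"
      unfolding D_def solution_vel[OF sol] solution_vel[OF sol'] ..
    ultimately have "D (i + 1) - D i = (\<kappa> (i + 1) / s - \<kappa> (i + 1) / s') * (y (i + 1) * y' (i + 1))"
      by (simp add: algebra_simps)
    also have "\<dots> > 0"
      using p s \<kappa>_pos[of "i + 1"] by (intro mult_pos_pos) (auto simp: divide_strict_left_mono)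
    finally show ?thesis by simp
  qed
  have "D k < D i" if "k < i" "i \<le> l" for i
    using that
  proof (induction i rule: int_gr_induct)
    case base
    then show ?case using step[of k] by simp
  next
    case (step i)
    then show ?case using \<open>\<And>i. k \<le> i \<Longrightarrow> i < l \<Longrightarrow> D i < D (i + 1)\<close>[of i] by simp
  qed
  from this[of l] have "D k < D l" using arc(3) by simp
  then show False using \<open>D k \<ge> 0\<close> \<open>D l \<le> 0\<close> by simp
qed

lemma sturm:
  assumes sol: "solution s y w" and sol': "solution s' y' w'" and s: "0 < s" "s < s'"
    and t12: "t1 < t2" and zero: "interp y' t1 = 0" "interp y' t2 = 0"
    and nz': "\<And>t. t1 < t \<Longrightarrow> t < t2 \<Longrightarrow> interp y' t \<noteq> 0"
  shows "\<exists>t. t1 < t \<and> t < t2 \<and> interp y t = 0"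
proof (rule ccontr)
  assume "\<not> ?thesis"
  then have nz: "\<And>t. t1 < t \<Longrightarrow> t < t2 \<Longrightarrow> interp y t \<noteq> 0" by auto
  have "\<not> ((\<forall>t. t1 < t \<longrightarrow> t < t2 \<longrightarrow> interp y' t > 0) \<and> (\<forall>t. t1 < t \<longrightarrow> t < t2 \<longrightarrow> interp y t > 0))"
    using sturm_pos[OF sol sol' s t12 zero] by blast
  moreover have "\<not> ((\<forall>t. t1 < t \<longrightarrow> t < t2 \<longrightarrow> interp y' t > 0) \<and> (\<forall>t. t1 < t \<longrightarrow> t < t2 \<longrightarrow> interp y t < 0))"
    using sturm_pos[OF solution_uminus[OF sol] sol' s t12 zero] by (auto simp: interp_uminus)
  moreover have "\<not> ((\<forall>t. t1 < t \<longrightarrow> t < t2 \<longrightarrow> interp y' t < 0) \<and> (\<forall>t. t1 < t \<longrightarrow> t < t2 \<longrightarrow> interp y t > 0))"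
    using sturm_pos[OF sol solution_uminus[OF sol'] s t12] zero by (auto simp: interp_uminus)
  moreover have "\<not> ((\<forall>t. t1 < t \<longrightarrow> t < t2 \<longrightarrow> interp y' t < 0) \<and> (\<forall>t. t1 < t \<longrightarrow> t < t2 \<longrightarrow> interp y t < 0))"
    using sturm_pos[OF solution_uminus[OF sol] solution_uminus[OF sol'] s t12] zero by (auto simp: interp_uminus)
  ultimately show False
    using nonzero_arc_sign[OF nz] nonzero_arc_sign[OF nz'] by blast
qed

lemma sturm_count:
  assumes sol: "solution s y w" and sol': "solution s' y' w'" and s: "0 < s" "s < s'"
    and Z: "periodic_discrete L {t. interp y t = 0}" and Z': "periodic_discrete L {t. interp y' t = 0}"
  shows "period_count L {t. interp y' t = 0} \<le> period_count L {t. interp y t = 0}"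
proof (rule period_count_interlace[OF Z Z'])
  fix t1 t2 assume *: "t1 \<in> {t. interp y' t = 0}" "t2 \<in> {t. interp y' t = 0}" "t1 < t2"
    "{t. interp y' t = 0} \<inter> {t1<..<t2} = {}"
  then have "\<exists>t. t1 < t \<and> t < t2 \<and> interp y t = 0"
    by (intro sturm[OF sol sol' s]) auto
  then show "{t. interp y t = 0} \<inter> {t1<..<t2} \<noteq> {}" by auto
qed

text \<open>Slopes at successive zeros alternate in sign, while \<open>m\<close> steps multiply the
  slope by \<open>\<sigma>\<close>; so the parity of the number of zeros is the sign of
  \<open>\<sigma>\<close>.\<close>

lemma zero_count_parity:
  assumes sol: "solution s y w" and nz: "y j \<noteq> 0 \<or> w j \<noteq> 0"
    and per: "\<And>k. w (k + int m) = \<sigma> * w k"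
    and Z: "periodic_discrete (real m) {t. interp y t = 0}" and "interp y t0 = 0"
  shows "\<sigma> * (- 1) ^ period_count (real m) {t. interp y t = 0} > 0"
proof -
  let ?Z = "{t. interp y t = 0}"
  define N where "N = period_count (real m) ?Z"
  have "t0 \<in> ?Z" using assms by simp
  then obtain e where e: "e 0 = t0" "e N = t0 + real m"
    "\<And>i. i < N \<Longrightarrow> e i < e (Suc i)" "\<And>i. i < N \<Longrightarrow> ?Z \<inter> {e i<..<e (Suc i)} = {}"
    "\<And>i. i \<le> N \<Longrightarrow> e i \<in> ?Z"
    using period_enum[OF Z] unfolding N_def by blast
  have w0: "w \<lfloor>e 0\<rfloor> \<noteq> 0"
  proof
    assume w: "w \<lfloor>e 0\<rfloor> = 0"
    have "interp y (e 0) = y \<lfloor>e 0\<rfloor> + (e 0 - of_int \<lfloor>e 0\<rfloor>) * (\<tau> \<lfloor>e 0\<rfloor> * w \<lfloor>e 0\<rfloor>)"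
      by (rule solution_segment[OF sol]) linarith+
    then have "y \<lfloor>e 0\<rfloor> = 0" using w e(1) assms by simp
    then show False using w solution_nonzero[OF sol nz, of "\<lfloor>e 0\<rfloor>"] by simp
  qed
  have "w \<lfloor>e 0\<rfloor> * w \<lfloor>e i\<rfloor> * (- 1) ^ i > 0" if "i \<le> N" for i
    using that
  proof (induction i)
    case 0
    then show ?case using w0 by (cases "w \<lfloor>e 0\<rfloor>" "0::real" rule: linorder_cases) (auto intro: mult_neg_neg)
  next
    case (Suc i)
    then have i: "i < N" by simp
    have nzi: "\<And>t. e i < t \<Longrightarrow> t < e (Suc i) \<Longrightarrow> interp y t \<noteq> 0"
      using e(4)[OF i] by auto
    have z: "interp y (e i) = 0" "interp y (e (Suc i)) = 0"
      using e(5)[of i] e(5)[of "Suc i"] i by auto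
    have "w \<lfloor>e i\<rfloor> * w \<lfloor>e (Suc i)\<rfloor> < 0"
      using nonzero_arc_sign[OF nzi]
    proof
      assume "\<forall>t. e i < t \<longrightarrow> t < e (Suc i) \<longrightarrow> interp y t > 0"
      then show ?thesis
        using positive_arc(1,4)[OF sol e(3)[OF i] z] by (simp add: mult_pos_neg)
    next
      assume "\<forall>t. e i < t \<longrightarrow> t < e (Suc i) \<longrightarrow> interp y t < 0"
      then show ?thesis
        using positive_arc(1,4)[OF solution_uminus[OF sol] e(3)[OF i]] z
        by (simp add: mult_neg_pos interp_uminus)
    qed
    moreover have "w \<lfloor>e 0\<rfloor> * w \<lfloor>e i\<rfloor> * (- 1) ^ i > 0" using Suc by simp
    ultimately have "0 < (w \<lfloor>e 0\<rfloor> * w \<lfloor>e i\<rfloor> * (- 1) ^ i) * (- (w \<lfloor>e i\<rfloor> * w \<lfloor>e (Suc i)\<rfloor>))"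
      by (simp only: mult_pos_pos neg_0_less_iff_less)
    also have "\<dots> = (w \<lfloor>e 0\<rfloor> * w \<lfloor>e (Suc i)\<rfloor> * (- 1) ^ Suc i) * (w \<lfloor>e i\<rfloor> * w \<lfloor>e i\<rfloor>)"
      by (simp add: mult_ac)
    finally show ?case by (metis not_square_less_zero zero_less_mult_iff)
  qed
  from this[of N] have "w \<lfloor>e 0\<rfloor> * w \<lfloor>e N\<rfloor> * (- 1) ^ N > 0" by simp
  moreover have "\<lfloor>e N\<rfloor> = \<lfloor>e 0\<rfloor> + int m" using e(1,2) by linarith
  ultimately have "(w \<lfloor>e 0\<rfloor>)\<^sup>2 * (\<sigma> * (- 1) ^ N) > 0"
    using per by (simp add: power2_eq_square mult_ac)
  then show ?thesis using w0 by (simp add: N_def zero_less_mult_iff)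
qed

end

section \<open>Confocal polynomials\<close>

lemma prod_sign:
  fixes f :: "'b \<Rightarrow> 'a::linordered_idom"
  assumes "finite S" "\<And>c. c \<in> S \<Longrightarrow> f c \<noteq> 0"
  shows "0 < (- 1) ^ card {c \<in> S. f c < 0} * prod f S"
  using assms
proof (induction S rule: finite_induct)
  case (insert c S)
  have pos: "0 < (- 1) ^ card {c \<in> S. f c < 0} * prod f S" using insert by simp
  show ?case
  proof (cases "f c < 0")
    case True
    then have "{d \<in> insert c S. f d < 0} = insert c {d \<in> S. f d < 0}" by auto
    then have "(- 1) ^ card {d \<in> insert c S. f d < 0} * prod f (insert c S)
        = (- f c) * ((- 1) ^ card {c \<in> S. f c < 0} * prod f S)"
      using insert by simp
    moreover have "0 < (- f c) * ((- 1) ^ card {c \<in> S. f c < 0} * prod f S)"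
      by (rule mult_pos_pos[OF _ pos]) (simp add: True)
    ultimately show ?thesis by (simp only:)
  next
    case False
    then have "{d \<in> insert c S. f d < 0} = {d \<in> S. f d < 0}" by auto
    moreover have "f c > 0" using False insert.prems[of c] by auto
    ultimately have "(- 1) ^ card {d \<in> insert c S. f d < 0} * prod f (insert c S)
        = f c * ((- 1) ^ card {c \<in> S. f c < 0} * prod f S)"
      using insert by simp
    then show ?thesis using \<open>f c > 0\<close> pos by simp
  qed
qed simp

definition cofactor_poly :: "('n::finite \<Rightarrow> real) \<Rightarrow> 'n \<Rightarrow> real poly" where
  "cofactor_poly a i = (\<Prod>j\<in>UNIV - {i}. [:a j, - 1:])"

definition ellipsoid_poly :: "('n::finite \<Rightarrow> real) \<Rightarrow> real poly" where
  "ellipsoid_poly a = (\<Prod>j\<in>UNIV. [:a j, - 1:])"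

text \<open>The confocal quadratic forms and the equation of the confocal quadrics, with denominators cleared.\<close>

definition qpoly :: "('n::finite \<Rightarrow> real) \<Rightarrow> real ^ 'n \<Rightarrow> real ^ 'n \<Rightarrow> real poly" where
  "qpoly a x y = (\<Sum>i\<in>UNIV. smult (x $ i * y $ i) (cofactor_poly a i))"

definition upoly :: "('n::finite \<Rightarrow> real) \<Rightarrow> real ^ 'n \<Rightarrow> real poly" where
  "upoly a x = ellipsoid_poly a - qpoly a x x"

text \<open>A quarter of the discriminant in \<open>h\<close> of
  \<open>upoly a (x + h *\<^sub>R v)\<close>, see \<open>upoly_flow\<close>: it vanishes at the
  parameters of the confocal quadrics that the line touches.\<close>

definition disc_poly :: "('n::finite \<Rightarrow> real) \<Rightarrow> real ^ 'n \<Rightarrow> real ^ 'n \<Rightarrow> real poly" where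
  "disc_poly a x v = (qpoly a x v)\<^sup>2 + upoly a x * qpoly a v v"

lemma ellipsoid_poly_cofactor: "ellipsoid_poly a = [:a i, - 1:] * cofactor_poly a i"
  unfolding ellipsoid_poly_def cofactor_poly_def by (rule prod.remove) auto

lemma poly_cofactor: "poly (cofactor_poly a i) s = (\<Prod>j\<in>UNIV - {i}. a j - s)"
  by (simp add: cofactor_poly_def poly_prod)

lemma poly_ellipsoid: "poly (ellipsoid_poly a) s = (\<Prod>j\<in>UNIV. a j - s)"
  by (simp add: ellipsoid_poly_def poly_prod)

lemma poly_qpoly: "poly (qpoly a x y) s = (\<Sum>i\<in>UNIV. x $ i * y $ i * poly (cofactor_poly a i) s)"
  by (simp add: qpoly_def poly_sum)

lemma poly_qpoly_quadric_form:
  assumes "s \<notin> range a"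
  shows "poly (qpoly a x y) s = poly (ellipsoid_poly a) s * quadric_form a s x y"
proof -
  have "poly (cofactor_poly a i) s = poly (ellipsoid_poly a) s / (a i - s)" for i
  proof -
    have "a i - s \<noteq> 0" using assms by auto
    then show ?thesis
      unfolding ellipsoid_poly_cofactor[of a i] by (simp add: field_simps)
  qed
  then show ?thesis
    by (simp add: poly_qpoly quadric_form_def sum_distrib_left mult_ac)
qed

lemma poly_cofactor_other: "i \<noteq> j \<Longrightarrow> poly (cofactor_poly a j) (a i) = 0"
  unfolding poly_cofactor by (rule prod_zero) auto

lemma poly_qpoly_at: "poly (qpoly a x y) (a i) = x $ i * y $ i * poly (cofactor_poly a i) (a i)"
proof -
  have "poly (qpoly a x y) (a i) = (\<Sum>j\<in>{i}. x $ j * y $ j * poly (cofactor_poly a j) (a i))"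
    unfolding poly_qpoly by (rule sum.mono_neutral_right) (auto simp: poly_cofactor_other)
  then show ?thesis by simp
qed

lemma poly_ellipsoid_at [simp]: "poly (ellipsoid_poly a) (a i) = 0"
  unfolding poly_ellipsoid by (rule prod_zero) auto

lemma qpoly_commute: "qpoly a x y = qpoly a y x"
  by (simp add: qpoly_def mult.commute)

lemma qpoly_add: "qpoly a (x + y) z = qpoly a x z + qpoly a y z"
  by (simp add: qpoly_def distrib_right smult_add_left sum.distrib)

lemma qpoly_scaleR: "qpoly a (c *\<^sub>R x) z = smult c (qpoly a x z)"
  by (rule poly_ext) (simp add: poly_qpoly sum_distrib_left mult.assoc)

lemma qpoly_add_right: "qpoly a z (x + y) = qpoly a z x + qpoly a z y"
  using qpoly_add qpoly_commute by metis

lemma qpoly_scaleR_right: "qpoly a z (c *\<^sub>R x) = smult c (qpoly a z x)"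
  using qpoly_scaleR qpoly_commute by metis

lemmas qpoly_linear = qpoly_add qpoly_scaleR qpoly_add_right qpoly_scaleR_right

lemma upoly_flow:
  "upoly a (x + h *\<^sub>R v) = upoly a x - smult (2 * h) (qpoly a x v) - smult (h\<^sup>2) (qpoly a v v)"
  unfolding upoly_def qpoly_linear
  by (rule poly_ext) (simp add: qpoly_commute[of a v x] algebra_simps power2_eq_square)

lemma upoly_minus: "upoly a (- x) = upoly a x"
  by (simp add: upoly_def qpoly_def)

text \<open>A shift of the variable \<open>h\<close> does not change a discriminant: the polynomial
  belongs to the line and not to the point chosen on it.\<close>

lemma disc_poly_flow: "disc_poly a (x + h *\<^sub>R v) v = disc_poly a x v"
  unfolding disc_poly_def upoly_flow qpoly_linear
  by (rule poly_ext) (simp add: algebra_simps power2_eq_square)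

lemma disc_poly_scaleR: "disc_poly a x (c *\<^sub>R v) = smult (c\<^sup>2) (disc_poly a x v)"
  unfolding disc_poly_def qpoly_linear
  by (rule poly_ext) (simp add: algebra_simps power2_eq_square)

text \<open>Termwise this is the partial fraction
  \<open>s / (a (a - s)) = 1 / (a - s) - 1 / a\<close> with denominators cleared. It reduces
  pairings with the normal to pairings with the point.\<close>

lemma qpoly_normal:
  assumes "\<And>i. a i \<noteq> 0"
  shows "s * poly (qpoly a y (ellipsoid_normal a x)) s
    = poly (qpoly a y x) s - quadric_form a 0 y x * poly (ellipsoid_poly a) s"
proof -
  have "s * (y $ i * (x $ i / a i) * poly (cofactor_poly a i) s)
      = y $ i * x $ i * poly (cofactor_poly a i) s - y $ i * x $ i / a i * poly (ellipsoid_poly a) s" for i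
    unfolding ellipsoid_poly_cofactor[of a i] using assms[of i] by (simp add: field_simps)
  then show ?thesis
    by (simp add: poly_qpoly ellipsoid_normal_def quadric_form_def sum_distrib_left
        sum_distrib_right sum_subtractf)
qed

lemma degree_cofactor: "degree (cofactor_poly a i) \<le> CARD('n) - 1"
  and coeff_cofactor: "coeff (cofactor_poly a i) (CARD('n) - 1) = (- 1) ^ (CARD('n) - 1)"
  for a :: "'n::finite \<Rightarrow> real"
  using coeff_prod_top[of "UNIV - {i}" "\<lambda>j. [:a j, - 1:]"]
  by (simp_all add: cofactor_poly_def card_Diff_singleton)

lemma degree_ellipsoid: "degree (ellipsoid_poly a) \<le> CARD('n)"
  and coeff_ellipsoid: "coeff (ellipsoid_poly a) CARD('n) = (- 1) ^ CARD('n)"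
  for a :: "'n::finite \<Rightarrow> real"
  using coeff_prod_top[of UNIV "\<lambda>j. [:a j, - 1:]"]
  by (simp_all add: ellipsoid_poly_def)

lemma degree_qpoly: "degree (qpoly a x y) \<le> CARD('n) - 1"
  for a :: "'n::finite \<Rightarrow> real"
  unfolding qpoly_def
  by (intro degree_sum_le order.trans[OF degree_smult_le degree_cofactor]) auto

lemma coeff_qpoly: "coeff (qpoly a x y) (CARD('n) - 1) = (- 1) ^ (CARD('n) - 1) * (x \<bullet> y)"
  for a :: "'n::finite \<Rightarrow> real"
  unfolding qpoly_def coeff_sum coeff_smult coeff_cofactor
  by (simp add: inner_vec_def sum_distrib_left mult_ac)

lemma degree_upoly: "degree (upoly a x) \<le> CARD('n)"
  for a :: "'n::finite \<Rightarrow> real"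
  unfolding upoly_def
  by (intro degree_diff_le degree_ellipsoid order.trans[OF degree_qpoly]) auto

lemma coeff_upoly: "coeff (upoly a x) CARD('n) = (- 1) ^ CARD('n)"
  for a :: "'n::finite \<Rightarrow> real"
proof -
  have "coeff (qpoly a x x) CARD('n) = 0"
    using degree_qpoly[of a x x] zero_less_card_finite[where 'a = 'n]
    by (intro coeff_eq_0) linarith
  then show ?thesis by (simp add: upoly_def coeff_ellipsoid)
qed

lemma upoly_eq_prod_roots:
  fixes a :: "'n::finite \<Rightarrow> real"
  assumes "\<And>i j. i < j \<Longrightarrow> j < CARD('n) \<Longrightarrow> r i < r j"
    and "\<And>i. i < CARD('n) \<Longrightarrow> poly (upoly a x) (r i) = 0"
  shows "upoly a x = (\<Prod>i<CARD('n). [:r i, - 1:])"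
proof -
  have inj: "inj_on r {..<CARD('n)}"
    by (rule linorder_inj_onI') (use assms(1) in fastforce)
  then have c: "card (r ` {..<CARD('n)}) = CARD('n)" by (simp add: card_image)
  have "upoly a x = smult (coeff (upoly a x) (card (r ` {..<CARD('n)}))) (\<Prod>z\<in>r ` {..<CARD('n)}. [:- z, 1:])"
    by (rule poly_eq_smult_prod_roots) (use c degree_upoly[of a x] assms(2) in auto)
  also have "\<dots> = smult ((- 1) ^ CARD('n)) (\<Prod>i<CARD('n). [:- r i, 1:])"
    unfolding c coeff_upoly by (simp add: prod.reindex[OF inj])
  also have "\<dots> = (\<Prod>i<CARD('n). smult (- 1) [:- r i, 1:])"
    by (subst prod_smult) (simp add: prod_constant)
  finally show ?thesis by simp
qed

text \<open>The degree is at most \<open>2n - 1\<close>, and the top coefficient comes from the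
  product of \<open>upoly\<close> and \<open>qpoly a v v\<close> alone; so \<open>2n - 1\<close>
  zeros determine the polynomial.\<close>

lemma disc_poly_eq:
  fixes a :: "'n::finite \<Rightarrow> real"
  assumes "finite C" "card C = 2 * CARD('n) - 1" "\<And>c. c \<in> C \<Longrightarrow> poly (disc_poly a x v) c = 0"
  shows "disc_poly a x v = smult (- (v \<bullet> v)) (\<Prod>c\<in>C. [:- c, 1:])"
proof -
  let ?n = "CARD('n)"
  have n: "?n \<ge> 1" by (simp add: Suc_leI)
  have eqn: "2 * ?n - 1 = ?n + (?n - 1)" using n by simp
  have d1: "degree ((qpoly a x v)\<^sup>2) < ?n + (?n - 1)"
    unfolding power2_eq_square
    using degree_mult_le[of "qpoly a x v" "qpoly a x v"] degree_qpoly[of a x v] n by linarith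
  have d2: "degree (upoly a x * qpoly a v v) \<le> ?n + (?n - 1)"
    using degree_mult_le[of "upoly a x" "qpoly a v v"] degree_qpoly[of a v v] degree_upoly[of a x] by linarith
  have d: "degree (disc_poly a x v) \<le> ?n + (?n - 1)"
    unfolding disc_poly_def by (intro degree_add_le d2 less_imp_le[OF d1])
  have "coeff (disc_poly a x v) (?n + (?n - 1)) = - (v \<bullet> v)"
  proof -
    have "coeff ((qpoly a x v)\<^sup>2) (?n + (?n - 1)) = 0"
      using d1 by (rule coeff_eq_0)
    moreover have "coeff (upoly a x * qpoly a v v) (?n + (?n - 1)) = (- 1) ^ (?n + (?n - 1)) * (v \<bullet> v)"
      unfolding coeff_mult_top[OF degree_upoly degree_qpoly] coeff_upoly coeff_qpoly power_add by simp
    moreover have "(- 1) ^ (?n + (?n - 1)) = (- 1 :: real)" using n by (intro neg_one_odd_power) presburger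
    ultimately show ?thesis by (simp only: disc_poly_def coeff_add)
  qed
  then show ?thesis
    using poly_eq_smult_prod_roots[OF assms(1), of "disc_poly a x v"] assms d eqn by simp
qed

lemma disc_poly_at: "poly (disc_poly a x v) (a i) = 0"
  by (simp add: disc_poly_def upoly_def poly_qpoly_at power2_eq_square)

text \<open>For a finite contact the base point is slid to it, where \<open>upoly a x\<close> and
  \<open>qpoly a x v\<close> both vanish; for an asymptote \<open>qpoly a x v\<close> and
  \<open>qpoly a v v\<close> vanish already at \<open>p\<close>.\<close>

lemma tangent_line_disc:
  assumes "tangent_line a l p v" "l \<notin> range a"
  shows "poly (disc_poly a p v) l = 0"
proof -
  have q: "poly (upoly a x) l = poly (ellipsoid_poly a) l * (1 - quadric_form a l x x)" for x
    by (simp add: upoly_def poly_qpoly_quadric_form[OF assms(2)] algebra_simps)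
  from assms(1) consider (pt) t where "p + t *\<^sub>R v \<in> confocal_quadric a l" "quadric_form a l (p + t *\<^sub>R v) v = 0"
    | (inf) "quadric_form a l v v = 0" "quadric_form a l p v = 0"
    unfolding tangent_line_def by blast
  then show ?thesis
  proof cases
    case pt
    have "quadric_form a l (p + t *\<^sub>R v) (p + t *\<^sub>R v) = 1"
      using pt(1) unfolding confocal_quadric_def quadric_form_def by (simp add: power2_eq_square)
    then have "poly (disc_poly a (p + t *\<^sub>R v) v) l = 0"
      using pt(2) by (simp add: disc_poly_def q poly_qpoly_quadric_form[OF assms(2)])
    then show ?thesis unfolding disc_poly_flow .
  next
    case inf
    then show ?thesis by (simp add: disc_poly_def q poly_qpoly_quadric_form[OF assms(2)])
  qed
qed

section \<open>Elliptic coordinates\<close>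

lemma sign_cofactor:
  fixes a :: "'n::{finite,linorder} \<Rightarrow> real"
  assumes "strict_mono a"
  shows "0 < (- 1) ^ card {j. j < i} * poly (cofactor_poly a i) (a i)"
proof -
  have "{j \<in> UNIV - {i}. a j - a i < 0} = {j. j < i}"
    using assms by (auto simp: strict_mono_less)
  moreover have "a j - a i \<noteq> 0" if "j \<in> UNIV - {i}" for j
    using that assms by (simp add: strict_mono_eq)
  ultimately show ?thesis
    using prod_sign[of "UNIV - {i}" "\<lambda>j. a j - a i"] by (simp add: poly_cofactor)
qed

lemma sign_upoly_at:
  fixes a :: "'n::{finite,linorder} \<Rightarrow> real"
  assumes "strict_mono a" "x $ i \<noteq> 0"
  shows "(- 1) ^ card {j. j < i} * poly (upoly a x) (a i) < 0"
proof -
  have "(- 1) ^ card {j. j < i} * poly (upoly a x) (a i)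
      = - ((x $ i)\<^sup>2 * ((- 1) ^ card {j. j < i} * poly (cofactor_poly a i) (a i)))"
    by (simp add: upoly_def poly_qpoly_at power2_eq_square mult_ac)
  also have "\<dots> < 0"
    using sign_cofactor[OF assms(1), of i] assms(2) by simp
  finally show ?thesis .
qed

lemma upoly_pos_below:
  fixes a :: "'n::finite \<Rightarrow> real"
  assumes "\<And>j. a j - s \<ge> 1 + x \<bullet> x"
  shows "poly (upoly a x) s > 0"
proof -
  have p: "0 \<le> x \<bullet> x" by simp
  then have pos: "a j - s > 0" for j using assms[of j] by linarith
  then have "s \<notin> range a" by (metis diff_self less_irrefl rangeE)
  then have "poly (upoly a x) s = poly (ellipsoid_poly a) s * (1 - quadric_form a s x x)"
    by (simp add: upoly_def poly_qpoly_quadric_form algebra_simps)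
  moreover have "poly (ellipsoid_poly a) s > 0"
    unfolding poly_ellipsoid using pos by (intro prod_pos) auto
  moreover have "quadric_form a s x x < 1"
  proof -
    have "quadric_form a s x x \<le> (\<Sum>i\<in>UNIV. x $ i * x $ i / (1 + x \<bullet> x))"
      unfolding quadric_form_def using assms p pos
      by (intro sum_mono divide_left_mono mult_pos_pos) (auto intro: add_pos_nonneg)
    also have "\<dots> = (x \<bullet> x) / (1 + x \<bullet> x)"
      by (simp add: inner_vec_def sum_divide_distrib)
    also have "\<dots> < 1"
      using add_pos_nonneg[OF zero_less_one p] by (simp add: pos_divide_less_eq)
    finally show ?thesis .
  qed
  ultimately show ?thesis by simp
qed

text \<open>The values of \<open>upoly\<close> at the \<open>a i\<close> alternate in sign, starting
  with a negative one, and far to the left \<open>upoly\<close> is positive; the intermediate value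
  theorem does the rest.\<close>

lemma interlacing_roots:
  fixes a :: "'n::{finite,linorder} \<Rightarrow> real"
  assumes mono: "strict_mono a" and nz: "\<And>i. x $ i \<noteq> 0"
  shows "\<exists>\<rho>. \<forall>i. poly (upoly a x) (\<rho> i) = 0 \<and> \<rho> i < a i \<and> (\<forall>j<i. a j < \<rho> i)"
proof (rule choice, rule allI)
  fix i
  show "\<exists>r. poly (upoly a x) r = 0 \<and> r < a i \<and> (\<forall>j<i. a j < r)"
  proof (cases "{j. j < i} = {}")
    case True
    define s where "s = a i - 1 - x \<bullet> x"
    have "a i \<le> a j" for j
      using True mono by (metis empty_Collect_eq not_less strict_mono_less_eq)
    then have "poly (upoly a x) s > 0"
      by (intro upoly_pos_below) (simp add: s_def)
    moreover have "poly (upoly a x) (a i) < 0"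
      using sign_upoly_at[of a x i] mono nz True by simp
    moreover have "s < a i" unfolding s_def using inner_ge_zero[of x] by linarith
    ultimately obtain r where "r < a i" "poly (upoly a x) r = 0"
      using poly_IVT_neg[of s "a i" "upoly a x"] by blast
    then show ?thesis using True by auto
  next
    case False
    define p where "p = Max {j. j < i}"
    have p: "p < i" "\<And>j. j < i \<Longrightarrow> j \<le> p"
      using Max_in[of "{j. j < i}"] False by (auto simp: p_def)
    have "{j. j < i} = insert p {j. j < p}"
      using p(1) by (auto simp: order.order_iff_strict dest: p(2) intro: less_trans)
    then have c: "card {j. j < i} = Suc (card {j. j < p})" by simp
    have "((- 1) ^ card {j. j < p} * poly (upoly a x) (a p)) * ((- 1) ^ card {j. j < i} * poly (upoly a x) (a i)) > 0"
      using mono nz by (intro mult_neg_neg sign_upoly_at) auto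
    also have "((- 1) ^ card {j. j < p} * poly (upoly a x) (a p)) * ((- 1) ^ card {j. j < i} * poly (upoly a x) (a i))
       = - (poly (upoly a x) (a p) * poly (upoly a x) (a i)) * ((- 1) ^ card {j. j < p})\<^sup>2"
      by (simp add: c power2_eq_square mult_ac)
    finally have "poly (upoly a x) (a p) * poly (upoly a x) (a i) < 0"
      by (simp flip: power_mult)
    moreover have "a p < a i" using p mono by (simp add: strict_mono_less)
    ultimately obtain r where r: "a p < r" "r < a i" "poly (upoly a x) r = 0"
      using poly_IVT[of "a p" "a i" "upoly a x"] by blast
    have "a j < r" if "j < i" for j
      using p(2)[OF that] r(1) mono by (metis le_less_trans strict_mono_less_eq)
    then show ?thesis using r by auto
  qed
qed

lemma confocal_params_root:
  assumes "m \<in> confocal_params a x"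
  shows "poly (upoly a x) m = 0"
proof -
  have m: "m \<notin> range a" and "quadric_form a m x x = 1"
    using assms by (auto simp: confocal_params_def confocal_quadric_def quadric_form_def power2_eq_square)
  then show ?thesis by (simp add: upoly_def poly_qpoly_quadric_form[OF m])
qed

lemma generic_if_nonzero:
  fixes a :: "'n::{finite,linorder} \<Rightarrow> real"
  assumes mono: "strict_mono a" and nz: "\<And>i. x $ i \<noteq> 0"
  shows "x \<in> generic_points a"
proof -
  have root: "m \<in> confocal_params a x" if "poly (upoly a x) m = 0" for m
  proof -
    have m: "m \<notin> range a"
      using sign_upoly_at[OF mono nz] that by (metis less_irrefl mult_zero_right rangeE)
    then have "poly (ellipsoid_poly a) m \<noteq> 0" by (auto simp: poly_ellipsoid)
    then have "quadric_form a m x x = 1"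
      using that by (simp add: upoly_def poly_qpoly_quadric_form[OF m])
    then show ?thesis
      using m by (simp add: confocal_params_def confocal_quadric_def quadric_form_def power2_eq_square)
  qed
  have eq: "confocal_params a x = {m. poly (upoly a x) m = 0}"
    using root confocal_params_root by blast
  have "coeff (upoly a x) CARD('n) \<noteq> 0" by (simp add: coeff_upoly)
  then have U0: "upoly a x \<noteq> 0" by auto
  have fin: "finite (confocal_params a x)"
    unfolding eq by (rule poly_roots_finite[OF U0])
  obtain \<rho> where \<rho>: "\<And>i. poly (upoly a x) (\<rho> i) = 0 \<and> \<rho> i < a i \<and> (\<forall>j<i. a j < \<rho> i)"
    using interlacing_roots[OF mono nz] by blast
  have "inj \<rho>"
    by (rule linorder_injI) (metis \<rho> less_asym less_irrefl)
  then have "CARD('n) \<le> card (confocal_params a x)"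
    using \<rho> fin by (intro card_inj_on_le[of \<rho>]) (auto simp: eq)
  moreover have "card (confocal_params a x) \<le> CARD('n)"
    unfolding eq using card_poly_roots_bound[OF U0] degree_upoly[of a x] by linarith
  ultimately show ?thesis using fin by (simp add: generic_points_def)
qed

text \<open>Moving along the all-ones vector, only finitely many step lengths meet a coordinate
  hyperplane. Hence the filter in \<open>elliptic_coordinate\<close> is nontrivial and limits along
  it are unique.\<close>

lemma islimpt_generic:
  fixes a :: "'n::{finite,linorder} \<Rightarrow> real"
  assumes mono: "strict_mono a"
  shows "x islimpt generic_points a"
  unfolding islimpt_approachable
proof (intro allI impI)
  fix e :: real assume "e > 0"
  define one :: "real ^ 'n::{finite,linorder}" where "one = (\<chi> i. 1)"
  have "infinite ({0<..<e / (norm one + 1)} - range (\<lambda>i. - (x $ i)))"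
    using \<open>e > 0\<close> by (intro Diff_infinite_finite infinite_Ioo) (auto intro!: divide_pos_pos add_nonneg_pos)
  then obtain d where d: "0 < d" "d < e / (norm one + 1)" "d \<notin> range (\<lambda>i. - (x $ i))"
    by (metis Diff_iff ex_in_conv finite.emptyI greaterThanLessThan_iff)
  have "(x + d *\<^sub>R one) $ i \<noteq> 0" for i
    using d(3) by (auto simp: one_def eq_neg_iff_add_eq_0 add.commute)
  then have "x + d *\<^sub>R one \<in> generic_points a"
    by (rule generic_if_nonzero[OF mono])
  moreover have "one \<noteq> 0" by (auto simp: one_def vec_eq_iff)
  moreover have "dist (x + d *\<^sub>R one) x < e"
  proof -
    have "d * (norm one + 1) < e" using d(2) by (simp add: pos_less_divide_eq add_nonneg_pos)
    moreover have "d * norm one \<le> d * (norm one + 1)" using d(1) by simp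
    ultimately have "d * norm one < e" by linarith
    then show ?thesis using d(1) by (simp add: dist_norm)
  qed
  ultimately show "\<exists>y\<in>generic_points a. y \<noteq> x \<and> dist y x < e"
    using d(1) by (intro bexI[of _ "x + d *\<^sub>R one"]) auto
qed

lemma tendsto_poly_upoly:
  assumes "(f \<longlongrightarrow> x) F"
  shows "((\<lambda>y. poly (upoly a (f y)) s) \<longlongrightarrow> poly (upoly a x) s) F"
  unfolding upoly_def poly_diff poly_qpoly by (intro tendsto_intros assms)

text \<open>This removes \<open>Lim\<close>: at generic points the ordered parameters are the roots
  of \<open>upoly\<close>, which depends continuously on the point, so they tend to the distinct
  roots at \<open>x\<close>. The point \<open>x\<close> itself may lie on coordinate
  hyperplanes.\<close>

lemma elliptic_coordinate_eq:
  fixes a :: "'n::{finite,linorder} \<Rightarrow> real"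
  assumes mono: "strict_mono a" and r: "\<And>i j. i < j \<Longrightarrow> j < CARD('n) \<Longrightarrow> r i < r j"
    and root: "\<And>i. i < CARD('n) \<Longrightarrow> poly (upoly a x) (r i) = 0" and j: "j < CARD('n)"
  shows "elliptic_coordinate a j x = r j"
  unfolding elliptic_coordinate_def
proof (rule tendsto_Lim)
  show "\<not> trivial_limit (at x within generic_points a)"
    using islimpt_generic[OF mono] by (simp add: trivial_limit_within)
  let ?\<rho> = "\<lambda>y i. sorted_list_of_set (confocal_params a y) ! i"
  have gen: "(\<forall>i j. i < j \<longrightarrow> j < CARD('n) \<longrightarrow> ?\<rho> y i < ?\<rho> y j)
      \<and> upoly a y = (\<Prod>i<CARD('n). [:?\<rho> y i, - 1:])" if "y \<in> generic_points a" for y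
  proof -
    have fin: "finite (confocal_params a y)" and c: "card (confocal_params a y) = CARD('n)"
      using that by (auto simp: generic_points_def)
    have ord: "?\<rho> y i < ?\<rho> y j" if "i < j" "j < CARD('n)" for i j
      using strict_sorted_list_of_set[of "confocal_params a y"] that c by (auto simp: sorted_wrt_iff_nth_less)
    have "?\<rho> y i \<in> confocal_params a y" if "i < CARD('n)" for i
      using nth_mem[of i "sorted_list_of_set (confocal_params a y)"] that c fin by simp
    then show ?thesis
      using ord by (intro conjI upoly_eq_prod_roots) (auto intro: confocal_params_root)
  qed
  show "((\<lambda>y. ?\<rho> y j) \<longlongrightarrow> r j) (at x within generic_points a)"
  proof (rule roots_tendsto[of "CARD('n)", OF r _ _ j])
    show "\<forall>\<^sub>F y in at x within generic_points a. \<forall>i j. i < j \<longrightarrow> j < CARD('n) \<longrightarrow> ?\<rho> y i < ?\<rho> y j"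
      using gen by (auto simp: eventually_at_filter)
    fix s
    have t: "((\<lambda>y. poly (upoly a y) s) \<longlongrightarrow> poly (upoly a x) s) (at x within generic_points a)"
      by (intro tendsto_poly_upoly tendsto_ident_at)
    have u: "poly (upoly a x) s = (\<Prod>i<CARD('n). r i - s)"
      using upoly_eq_prod_roots[OF r root] by (simp add: poly_prod_roots)
    have e: "\<forall>\<^sub>F y in at x within generic_points a. poly (upoly a y) s = (\<Prod>i<CARD('n). ?\<rho> y i - s)"
      using gen by (auto simp: eventually_at_filter poly_prod_roots)
    show "((\<lambda>y. \<Prod>i<CARD('n). ?\<rho> y i - s) \<longlongrightarrow> (\<Prod>i<CARD('n). r i - s)) (at x within generic_points a)"
      using Lim_transform_eventually[OF t e] unfolding u .
  qed auto
qed

section \<open>Billiard trajectories and their elliptic coordinates\<close>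

text \<open>A rank-one Lax matrix is \<open>\<epsilon>\<close> times the column
  \<open>(y, w)\<close> times the row \<open>(w, - y)\<close>. Free flight conjugates the matrix
  while \<open>(y, w)\<close> moves by the string equation; \<open>square_form_kick_iff\<close> does
  the same for a reflection.\<close>

lemma square_form_flow_iff:
  fixes \<epsilon> y w h :: real
  assumes "X1 = X0 - 2 * h * V0 - h\<^sup>2 * W" "V1 = V0 + h * W" "y1 = y0 + h * w"
  shows "X0 = - \<epsilon> * y0\<^sup>2 \<and> V0 = \<epsilon> * y0 * w \<and> W = \<epsilon> * w\<^sup>2
    \<longleftrightarrow> X1 = - \<epsilon> * y1\<^sup>2 \<and> V1 = \<epsilon> * y1 * w \<and> W = \<epsilon> * w\<^sup>2"
  unfolding assms by (auto simp: algebra_simps power2_eq_square)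

lemma square_form_kick_iff:
  fixes \<epsilon> y w g :: real
  assumes "V1 = V0 + g * X" "W1 = W0 - 2 * g * V0 - g\<^sup>2 * X" "w1 = w0 - g * y"
  shows "X = - \<epsilon> * y\<^sup>2 \<and> V0 = \<epsilon> * y * w0 \<and> W0 = \<epsilon> * w0\<^sup>2
    \<longleftrightarrow> X = - \<epsilon> * y\<^sup>2 \<and> V1 = \<epsilon> * y * w1 \<and> W1 = \<epsilon> * w1\<^sup>2"
  unfolding assms by (auto simp: algebra_simps power2_eq_square)

text \<open>Over the reals a nonzero nilpotent matrix has this form only up to a sign, which is read
  off from \<open>- X\<close> or, if \<open>X = 0\<close>, from \<open>W\<close>.\<close>

lemma square_form_exists:
  fixes X V W :: real
  assumes "V\<^sup>2 + X * W = 0" "X \<noteq> 0 \<or> V \<noteq> 0 \<or> W \<noteq> 0"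
  obtains \<epsilon> y w where "\<epsilon> = 1 \<or> \<epsilon> = -1" "y \<noteq> 0 \<or> w \<noteq> 0"
    "X = - \<epsilon> * y\<^sup>2" "V = \<epsilon> * y * w" "W = \<epsilon> * w\<^sup>2"
proof (cases "X = 0")
  case True
  then have "V = 0" "W \<noteq> 0" using assms by auto
  then show ?thesis
    using True by (intro that[of "sgn W" 0 "sqrt \<bar>W\<bar>"]) (auto simp: sgn_if)
next
  case False
  define y where "y = sqrt \<bar>X\<bar>"
  define e where "e = - sgn X"
  have y: "y\<^sup>2 = \<bar>X\<bar>" "y \<noteq> 0" using False by (auto simp: y_def)
  have e: "e = 1 \<or> e = -1" using False by (auto simp: e_def sgn_if)
  have ee: "e * e = 1" using e by auto
  have X: "X = - e * y\<^sup>2" unfolding y e_def using False by (auto simp: sgn_if)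
  show ?thesis
  proof (rule that[OF e, of y "e * V / y"])
    show "y \<noteq> 0 \<or> e * V / y \<noteq> 0" using y by simp
    show "X = - e * y\<^sup>2" by (rule X)
    show "V = e * y * (e * V / y)" using y ee by (simp add: mult.assoc[symmetric])
    have "X * W = - V\<^sup>2" using assms(1) by simp
    then have "e * y\<^sup>2 * W = V\<^sup>2" using X by simp
    then have "e * e * y\<^sup>2 * W = e * V\<^sup>2" by (simp add: mult.assoc)
    then have "y\<^sup>2 * W = e * V\<^sup>2" using ee by simp
    then have "W = e * V\<^sup>2 / y\<^sup>2" using y(2) by (simp add: field_simps)
    then show "W = e * (e * V / y)\<^sup>2"
      using ee by (simp add: power_divide power_mult_distrib power2_eq_square)
  qed
qed

lemma quadric_form_linear:
  "quadric_form a s (x + y) z = quadric_form a s x z + quadric_form a s y z"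
  "quadric_form a s z (x + y) = quadric_form a s z x + quadric_form a s z y"
  "quadric_form a s (c *\<^sub>R x) z = c * quadric_form a s x z"
  "quadric_form a s z (c *\<^sub>R x) = c * quadric_form a s z x"
  by (simp_all add: quadric_form_def algebra_simps add_divide_distrib sum.distrib sum_distrib_left)

lemma quadric_form_commute: "quadric_form a s x y = quadric_form a s y x"
  by (simp add: quadric_form_def mult.commute)

lemma inner_ellipsoid_normal: "y \<bullet> ellipsoid_normal a x = quadric_form a 0 x y"
  by (simp add: inner_vec_def ellipsoid_normal_def quadric_form_def mult.commute)

lemma quadric_form_pos:
  assumes "\<And>i. 0 < a i" "s \<le> 0" "x \<noteq> 0"
  shows "quadric_form a s x x > 0"
proof -
  have p: "a i - s > 0" for i using assms(1)[of i] assms(2) by linarith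
  obtain i where "x $ i \<noteq> 0" using assms(3) by (auto simp: vec_eq_iff)
  then have "x $ i * x $ i / (a i - s) > 0" using p[of i] by (simp add: not_square_less_zero less_le)
  moreover have "x $ j * x $ j / (a j - s) \<ge> 0" for j using p[of j] by simp
  ultimately show ?thesis
    unfolding quadric_form_def by (intro sum_pos2[of UNIV i]) auto
qed

lemma quadric_form_mono:
  assumes "\<And>i. 0 < a i" "s \<le> 0"
  shows "quadric_form a s x x \<le> quadric_form a 0 x x"
  unfolding quadric_form_def
proof (rule sum_mono)
  fix i
  show "x $ i * x $ i / (a i - s) \<le> x $ i * x $ i / (a i - 0)"
    using assms(1)[of i] assms(2) by (intro divide_left_mono) auto
qed

lemma poly_ellipsoid_pos:
  assumes "\<And>i. 0 < a i" "s \<le> 0"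
  shows "poly (ellipsoid_poly a) s > 0"
  unfolding poly_ellipsoid
proof (rule prod_pos)
  fix i show "0 < a i - s" using assms(1)[of i] assms(2) by linarith
qed

section \<open>Conserved quantities and the dynamics of one bounce\<close>

locale billiard =
  fixes a :: "'n::{finite,linorder} \<Rightarrow> real" and lam :: "nat \<Rightarrow> real" and q :: "int \<Rightarrow> (real, 'n) vec"
  assumes a_pos: "0 < a i" and a_mono: "strict_mono a"
    and lam_inj: "inj_on lam {1..CARD('n) - 1}"
    and lam_a: "lam ` {1..CARD('n) - 1} \<inter> range a = {}"
    and traj: "billiard_trajectory a q" and caustics: "has_caustics a lam q"
begin

definition C :: "real set" where "C = range a \<union> lam ` {1..CARD('n) - 1}"
definition R :: "real poly" where "R = (\<Prod>c\<in>C. [:- c, 1:])"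
definition \<tau> :: "int \<Rightarrow> real" where "\<tau> k = norm (q (k + 1) - q k)"
definition u :: "int \<Rightarrow> (real, 'n) vec" where "u k = sgn (q (k + 1) - q k)"
definition \<nu> :: "int \<Rightarrow> (real, 'n) vec" where "\<nu> k = ellipsoid_normal a (q k)"
definition \<kappa> :: "int \<Rightarrow> real" where "\<kappa> k = 2 * (u (k - 1) \<bullet> \<nu> k) / (\<nu> k \<bullet> \<nu> k)"

lemma n_pos: "CARD('n) > 0" by simp

lemma a_nz: "a i \<noteq> 0" using a_pos[of i] by simp

lemma finite_C: "finite C" by (simp add: C_def)

lemma card_C: "card C = 2 * CARD('n) - 1"
proof -
  have "card C = card (range a) + card (lam ` {1..CARD('n) - 1})"
    unfolding C_def using lam_a by (intro card_Un_disjoint) auto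
  also have "\<dots> = CARD('n) + (CARD('n) - 1)"
    using strict_mono_imp_inj_on[OF a_mono] lam_inj by (simp add: card_image)
  finally show ?thesis using n_pos by linarith
qed

lemma poly_R: "poly R s = (\<Prod>c\<in>C. s - c)"
  by (simp add: R_def poly_prod)

lemma q_on: "quadric_form a 0 (q k) (q k) = 1"
  using traj unfolding billiard_trajectory_def confocal_quadric_def quadric_form_def
  by (simp add: power2_eq_square)

lemma \<tau>_pos: "\<tau> k > 0"
  using traj by (simp add: billiard_trajectory_def \<tau>_def)

lemma q_next: "q (k + 1) = q k + \<tau> k *\<^sub>R u k"
  using \<tau>_pos[of k] by (simp add: \<tau>_def u_def sgn_div_norm)

lemma norm_u: "u k \<bullet> u k = 1"
  using \<tau>_pos[of k] by (simp add: \<tau>_def u_def norm_sgn dot_square_norm)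

lemma u_nz: "u k \<noteq> 0"
  using norm_u[of k] by auto

lemma u_next: "u (k + 1) = u k - \<kappa> (k + 1) *\<^sub>R \<nu> (k + 1)"
proof -
  have "u (k + 1) = reflect (\<nu> (k + 1)) (sgn (q (k + 1) - q (k + 1 - 1)))"
    using traj unfolding billiard_trajectory_def u_def \<nu>_def by blast
  then show ?thesis by (simp add: reflect_def \<kappa>_def u_def)
qed

lemma quu_pos: "quadric_form a 0 (u k) (u k) > 0"
  by (rule quadric_form_pos) (auto simp: a_pos u_nz)

text \<open>Both ends of the chord lie on the ellipsoid; the difference of the two equations is
  divisible by \<open>\<tau> k\<close>.\<close>

lemma qqu: "2 * quadric_form a 0 (q k) (u k) = - \<tau> k * quadric_form a 0 (u k) (u k)"
proof -
  have "1 = quadric_form a 0 (q k + \<tau> k *\<^sub>R u k) (q k + \<tau> k *\<^sub>R u k)"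
    using q_on[of "k + 1"] by (simp add: q_next)
  also have "\<dots> = 1 + \<tau> k * (2 * quadric_form a 0 (q k) (u k) + \<tau> k * quadric_form a 0 (u k) (u k))"
    using q_on[of k] quadric_form_commute[of a 0 "u k" "q k"]
    by (simp add: quadric_form_linear algebra_simps)
  finally show ?thesis using \<tau>_pos[of k] by simp
qed

lemma inward: "quadric_form a 0 (q k) (u k) < 0"
  using qqu[of k] mult_pos_pos[OF \<tau>_pos[of k] quu_pos[of k]] by linarith

lemma outward: "quadric_form a 0 (q (k + 1)) (u k) > 0"
proof -
  have "quadric_form a 0 (q (k + 1)) (u k) = quadric_form a 0 (q k) (u k) + \<tau> k * quadric_form a 0 (u k) (u k)"
    by (simp add: q_next quadric_form_linear)
  then show ?thesis using qqu[of k] mult_pos_pos[OF \<tau>_pos[of k] quu_pos[of k]] by linarith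
qed

lemma \<nu>_nz: "\<nu> k \<noteq> 0"
  using outward[of "k - 1"] inner_ellipsoid_normal[of "u (k - 1)" a "q k"] by (auto simp: \<nu>_def)

lemma \<kappa>_pos: "\<kappa> k > 0"
  using outward[of "k - 1"] \<nu>_nz[of k] inner_ellipsoid_normal[of "u (k - 1)" a "q k"]
  by (simp add: \<kappa>_def \<nu>_def)

sublocale string \<tau> \<kappa>
  by unfold_locales (rule \<tau>_pos, rule \<kappa>_pos)

text \<open>The \<open>i\<close>-th component of the normal is \<open>q $ i / a i\<close>, which is
  how \<open>a i\<close> becomes the parameter, while \<open>\<tau>\<close> and
  \<open>\<kappa>\<close> are common to all coordinates.\<close>

lemma coordinate_solution: "solution (a i) (\<lambda>k. q k $ i) (\<lambda>k. u k $ i)"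
  unfolding solution_def
proof (intro allI conjI)
  fix k
  show "q (k + 1) $ i = q k $ i + \<tau> k * u k $ i"
    by (simp add: q_next)
  show "u (k + 1) $ i = u k $ i - \<kappa> (k + 1) / a i * q (k + 1) $ i"
    unfolding u_next by (simp add: \<nu>_def ellipsoid_normal_def)
qed

text \<open>
  The entries of the Lax matrix \<open>L k s\<close> with rows \<open>(V, U)\<close> and \<open>(W, - V)\<close>, whose square is
  \<open>- R s\<close> times the identity.
\<close>

abbreviation "U k s \<equiv> poly (upoly a (q k)) s"
abbreviation "V k s \<equiv> poly (qpoly a (q k) (u k)) s"
abbreviation "W k s \<equiv> poly (qpoly a (u k) (u k)) s"

text \<open>Zeros at the \<open>a i\<close> are automatic, and those at the caustic parameters
  express tangency; these \<open>2n - 1\<close> zeros fix the polynomial, whatever the segment and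
  the point on it.\<close>

lemma disc_eq: "disc_poly a (q k + h *\<^sub>R u k) (u k) = - R"
proof -
  have "disc_poly a (q k) (u k) = smult (- (u k \<bullet> u k)) (\<Prod>c\<in>C. [:- c, 1:])"
  proof (rule disc_poly_eq[OF finite_C card_C])
    fix c assume "c \<in> C"
    then consider i where "c = a i" | j where "j \<in> {1..CARD('n) - 1}" "c = lam j"
      by (auto simp: C_def)
    then show "poly (disc_poly a (q k) (u k)) c = 0"
    proof cases
      case 2
      have "tangent_line a c (q k) (q (k + 1) - q k)"
        using caustics 2 by (simp add: has_caustics_def)
      moreover have "c \<notin> range a" using 2 lam_a by (metis IntI empty_iff imageI)
      ultimately have "poly (disc_poly a (q k) (\<tau> k *\<^sub>R u k)) c = 0"
        using tangent_line_disc by (simp add: q_next)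
      then show ?thesis using \<tau>_pos[of k] by (simp add: disc_poly_scaleR)
    qed (simp add: disc_poly_at)
  qed
  then show ?thesis by (simp add: disc_poly_flow norm_u R_def)
qed

lemma mumford: "(V k s)\<^sup>2 + U k s * W k s = - poly R s"
proof -
  have "poly (disc_poly a (q k) (u k)) s = - poly R s" using disc_eq[of k 0] by simp
  then show ?thesis by (simp add: disc_poly_def)
qed

lemma U_next: "U (k + 1) s = U k s - 2 * \<tau> k * V k s - (\<tau> k)\<^sup>2 * W k s"
  unfolding q_next upoly_flow by simp

lemma V_before: "poly (qpoly a (q (k + 1)) (u k)) s = V k s + \<tau> k * W k s"
  unfolding q_next qpoly_linear by simp

lemma normal_pairing:
  assumes "s \<noteq> 0"
  shows "poly (qpoly a (q k) (\<nu> k)) s = - U k s / s"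
    and "poly (qpoly a y (\<nu> k)) s = (poly (qpoly a y (q k)) s - (y \<bullet> \<nu> k) * poly (ellipsoid_poly a) s) / s"
proof -
  show *: "poly (qpoly a y (\<nu> k)) s = (poly (qpoly a y (q k)) s - (y \<bullet> \<nu> k) * poly (ellipsoid_poly a) s) / s" for y
    using qpoly_normal[of a s y "q k", OF a_nz] assms
      inner_ellipsoid_normal[of y a "q k"] quadric_form_commute[of a 0 y "q k"]
    by (simp add: \<nu>_def field_simps)
  have "q k \<bullet> \<nu> k = 1" using inner_ellipsoid_normal[of "q k" a "q k"] q_on[of k] by (simp add: \<nu>_def)
  then show "poly (qpoly a (q k) (\<nu> k)) s = - U k s / s"
    unfolding * by (simp add: upoly_def)
qed

lemma V_kick:
  assumes "s \<noteq> 0"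
  shows "V (k + 1) s = poly (qpoly a (q (k + 1)) (u k)) s + \<kappa> (k + 1) / s * U (k + 1) s"
proof -
  have u: "u (k + 1) = u k + (- \<kappa> (k + 1)) *\<^sub>R \<nu> (k + 1)" by (simp add: u_next)
  show ?thesis
    unfolding u qpoly_linear poly_add poly_smult normal_pairing(1)[OF assms] by simp
qed

lemma W_kick:
  assumes "s \<noteq> 0"
  shows "W (k + 1) s = W k s - 2 * (\<kappa> (k + 1) / s) * poly (qpoly a (q (k + 1)) (u k)) s
    - (\<kappa> (k + 1) / s)\<^sup>2 * U (k + 1) s"
proof -
  let ?A = "poly (ellipsoid_poly a) s" and ?\<nu> = "\<nu> (k + 1)" and ?\<kappa> = "\<kappa> (k + 1)"
  let ?V = "poly (qpoly a (q (k + 1)) (u k)) s"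
  have u: "u (k + 1) = u k + (- ?\<kappa>) *\<^sub>R ?\<nu>" by (simp add: u_next)
  have "W (k + 1) s = W k s - 2 * ?\<kappa> * poly (qpoly a (u k) ?\<nu>) s + ?\<kappa>\<^sup>2 * poly (qpoly a ?\<nu> ?\<nu>) s"
    unfolding u qpoly_linear qpoly_commute[of a ?\<nu> "u k"] by (simp add: algebra_simps power2_eq_square)
  also have "poly (qpoly a (u k) ?\<nu>) s = (?V - (u k \<bullet> ?\<nu>) * ?A) / s"
    by (simp only: normal_pairing(2)[OF assms] qpoly_commute[of a "u k" "q (k + 1)"])
  also have "poly (qpoly a ?\<nu> ?\<nu>) s = (- U (k + 1) s / s - (?\<nu> \<bullet> ?\<nu>) * ?A) / s"
    by (simp only: normal_pairing(2)[OF assms, of ?\<nu>] qpoly_commute[of a ?\<nu> "q (k + 1)"] normal_pairing(1)[OF assms])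
  \<comment> \<open>This value of \<open>\<kappa>\<close> is that of a reflection; it makes the
    terms with \<open>ellipsoid_poly\<close> cancel.\<close>
  also have "u k \<bullet> ?\<nu> = ?\<kappa> * (?\<nu> \<bullet> ?\<nu>) / 2"
    using \<nu>_nz[of "k + 1"] by (simp add: \<kappa>_def)
  finally have eq: "W (k + 1) s = W k s - 2 * ?\<kappa> * ((?V - ?\<kappa> * (?\<nu> \<bullet> ?\<nu>) / 2 * ?A) / s)
    + ?\<kappa>\<^sup>2 * ((- U (k + 1) s / s - (?\<nu> \<bullet> ?\<nu>) * ?A) / s)" .
  show ?thesis
    unfolding eq using assms by (simp add: field_simps power2_eq_square)
qed

lemma path_eq: "trajectory_path q = interp q"
  by (simp add: fun_eq_iff trajectory_path_def interp_def)

lemma path_segment: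
  assumes "of_int k \<le> t" "t \<le> of_int k + 1"
  shows "trajectory_path q t = q k + ((t - of_int k) * \<tau> k) *\<^sub>R u k"
  using interp_segment[OF assms, of q] by (simp add: path_eq q_next)

lemma path_quadric_form:
  assumes "of_int k \<le> t" "t \<le> of_int k + 1"
  shows "quadric_form a 0 (trajectory_path q t) (trajectory_path q t)
    = 1 - (t - of_int k) * (of_int k + 1 - t) * (\<tau> k)\<^sup>2 * quadric_form a 0 (u k) (u k)"
proof -
  define h where "h = (t - of_int k) * \<tau> k"
  have "quadric_form a 0 (q k + h *\<^sub>R u k) (q k + h *\<^sub>R u k)
    = 1 + h * (2 * quadric_form a 0 (q k) (u k)) + h\<^sup>2 * quadric_form a 0 (u k) (u k)"
    using q_on[of k] quadric_form_commute[of a 0 "u k" "q k"]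
    by (simp add: quadric_form_linear algebra_simps power2_eq_square)
  then show ?thesis
    unfolding path_segment[OF assms] qqu h_def by (simp add: algebra_simps power2_eq_square)
qed

abbreviation "Ut t s \<equiv> poly (upoly a (trajectory_path q t)) s"

lemma Ut_quadric_form:
  assumes "s \<le> 0"
  shows "Ut t s = poly (ellipsoid_poly a) s * (1 - quadric_form a s (trajectory_path q t) (trajectory_path q t))"
proof -
  have "s \<notin> range a" using assms a_pos by (metis not_less rangeE)
  then show ?thesis by (simp add: upoly_def poly_qpoly_quadric_form algebra_simps)
qed

lemma Ut_pos:
  assumes "of_int k < t" "t < of_int k + 1" "s \<le> 0"
  shows "Ut t s > 0"
proof -
  have "(t - of_int k) * (of_int k + 1 - t) * (\<tau> k)\<^sup>2 * quadric_form a 0 (u k) (u k) > 0"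
    using assms \<tau>_pos[of k] quu_pos[of k] by (intro mult_pos_pos) auto
  then have "quadric_form a 0 (trajectory_path q t) (trajectory_path q t) < 1"
    using path_quadric_form[of k t] assms by simp
  then have "quadric_form a s (trajectory_path q t) (trajectory_path q t) < 1"
    using quadric_form_mono[of a s "trajectory_path q t"] a_pos assms(3) by (meson order_le_less_trans)
  then show ?thesis
    unfolding Ut_quadric_form[OF assms(3)] using poly_ellipsoid_pos[of a s] a_pos assms(3) by simp
qed

lemma Ut_0_integer: "Ut (of_int k) 0 = 0"
  using path_quadric_form[of k "of_int k"] by (simp add: Ut_quadric_form)

lemma Ut_0_nonneg: "Ut t 0 \<ge> 0"
proof (cases "t = of_int \<lfloor>t\<rfloor>")
  case True
  then show ?thesis using Ut_0_integer[of "\<lfloor>t\<rfloor>"] by simp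
next
  case False
  then have "of_int \<lfloor>t\<rfloor> < t" "t < of_int \<lfloor>t\<rfloor> + 1" by linarith+
  from Ut_pos[OF this, of 0] show ?thesis by simp
qed

lemma Ut_0_iff: "Ut t 0 = 0 \<longleftrightarrow> t \<in> \<int>"
proof
  assume U: "Ut t 0 = 0"
  show "t \<in> \<int>"
  proof (rule ccontr)
    assume "t \<notin> \<int>"
    then have "of_int \<lfloor>t\<rfloor> \<noteq> t" by (metis Ints_of_int)
    then have "of_int \<lfloor>t\<rfloor> < t" "t < of_int \<lfloor>t\<rfloor> + 1" by linarith+
    from Ut_pos[OF this, of 0] U show False by simp
  qed
qed (auto elim!: Ints_cases simp: Ut_0_integer)

text \<open>A confocal quadric with \<open>c \<le> 0\<close> is an ellipsoid enclosing the interior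
  of the table, and no line through an interior point touches it: at the midpoint of a chord
  \<open>upoly a x\<close> and \<open>qpoly a (u 0) (u 0)\<close> are positive at \<open>c\<close>,
  hence so is the discriminant.\<close>

lemma C_pos:
  assumes "c \<in> C"
  shows "c > 0"
proof (rule ccontr)
  assume c: "\<not> c > 0"
  define x where "x = trajectory_path q (1/2)"
  have x: "x = q 0 + (\<tau> 0 / 2) *\<^sub>R u 0"
    unfolding x_def using path_segment[of 0 "1/2"] by simp
  have "c \<notin> range a" using c a_pos by auto
  then have "poly (qpoly a (u 0) (u 0)) c = poly (ellipsoid_poly a) c * quadric_form a c (u 0) (u 0)"
    by (rule poly_qpoly_quadric_form)
  moreover have "\<dots> > 0"
    using c by (intro mult_pos_pos poly_ellipsoid_pos quadric_form_pos) (auto simp: a_pos u_nz)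
  moreover have "poly (upoly a x) c > 0"
    unfolding x_def using Ut_pos[of 0 "1/2" c] c by simp
  ultimately have "0 < poly (qpoly a x (u 0)) c ^ 2 + poly (upoly a x) c * poly (qpoly a (u 0) (u 0)) c"
    by (simp add: add_nonneg_pos)
  also have "\<dots> = poly (disc_poly a x (u 0)) c" by (simp add: disc_poly_def)
  also have "\<dots> = 0" unfolding x disc_eq using assms finite_C by (simp add: poly_R)
  finally show False by simp
qed

lemma square_form_iff:
  assumes sol: "solution s y w" and s: "s \<noteq> 0"
  shows "(U k s = - \<epsilon> * (y k)\<^sup>2 \<and> V k s = \<epsilon> * y k * w k \<and> W k s = \<epsilon> * (w k)\<^sup>2)
    \<longleftrightarrow> (U (k + 1) s = - \<epsilon> * (y (k + 1))\<^sup>2 \<and> V (k + 1) s = \<epsilon> * y (k + 1) * w (k + 1)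
        \<and> W (k + 1) s = \<epsilon> * (w (k + 1))\<^sup>2)"
  using square_form_flow_iff[OF U_next V_before solution_pos[OF sol]]
    square_form_kick_iff[OF V_kick[OF s] W_kick[OF s] solution_vel[OF sol]] by blast

lemma square_form:
  assumes sol: "solution s y w" and s: "s \<noteq> 0"
    and "U 0 s = - \<epsilon> * (y 0)\<^sup>2" "V 0 s = \<epsilon> * y 0 * w 0" "W 0 s = \<epsilon> * (w 0)\<^sup>2"
  shows "U k s = - \<epsilon> * (y k)\<^sup>2 \<and> V k s = \<epsilon> * y k * w k \<and> W k s = \<epsilon> * (w k)\<^sup>2"
proof (induction k rule: int_induct[where k = 0])
  case (step1 i)
  then show ?case using square_form_iff[OF sol s, of i] by blast
next
  case (step2 i)
  then show ?case using square_form_iff[OF sol s, of "i - 1"] by simp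
qed (use assms in blast)

text \<open>If the Lax matrix vanished at \<open>c\<close>, all its entries would be divisible by
  \<open>s - c\<close>, and \<open>c\<close> would be a double zero of \<open>R\<close>, whose zeros
  are distinct.\<close>

lemma R_simple:
  assumes "c \<in> C"
  shows "U k c \<noteq> 0 \<or> V k c \<noteq> 0 \<or> W k c \<noteq> 0"
proof (rule ccontr)
  assume "\<not> ?thesis"
  then have d: "[:- c, 1:] dvd upoly a (q k)" "[:- c, 1:] dvd qpoly a (q k) (u k)"
    "[:- c, 1:] dvd qpoly a (u k) (u k)" by (auto simp: poly_eq_0_iff_dvd)
  then have "[:- c, 1:] * [:- c, 1:] dvd disc_poly a (q k) (u k)"
    unfolding disc_poly_def power2_eq_square by (intro dvd_add mult_dvd_mono)
  also have "disc_poly a (q k) (u k) = - ([:- c, 1:] * (\<Prod>d\<in>C - {c}. [:- d, 1:]))"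
    using disc_eq[of k 0] prod.remove[OF finite_C assms, of "\<lambda>d. [:- d, 1:]"] by (simp add: R_def)
  finally have "[:- c, 1:] dvd (\<Prod>d\<in>C - {c}. [:- d, 1:])"
    unfolding dvd_minus_iff by (subst (asm) dvd_mult_cancel_left) auto
  then have "(\<Prod>d\<in>C - {c}. c - d) = 0"
    unfolding poly_eq_0_iff_dvd[symmetric] by (simp add: poly_prod)
  then show False using finite_C by auto
qed

lemma C_solution_exists:
  assumes c: "c \<in> C"
  shows "\<exists>\<epsilon> y w. (\<epsilon> = 1 \<or> \<epsilon> = -1) \<and> solution c y w \<and> (y 0 \<noteq> 0 \<or> w 0 \<noteq> 0)
    \<and> (\<forall>k. U k c = - \<epsilon> * (y k)\<^sup>2 \<and> V k c = \<epsilon> * y k * w k \<and> W k c = \<epsilon> * (w k)\<^sup>2)"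
proof -
  have "(V 0 c)\<^sup>2 + U 0 c * W 0 c = 0"
    using mumford[of 0 c] c finite_C by (auto simp: poly_R)
  then obtain \<epsilon> y0 w0 where *: "\<epsilon> = 1 \<or> \<epsilon> = -1" "y0 \<noteq> 0 \<or> w0 \<noteq> 0"
    "U 0 c = - \<epsilon> * y0\<^sup>2" "V 0 c = \<epsilon> * y0 * w0" "W 0 c = \<epsilon> * w0\<^sup>2"
    using R_simple[OF c, of 0] by (rule square_form_exists)
  obtain y w where "solution c y w" "y 0 = y0" "w 0 = w0"
    using solution_exists by blast
  then show ?thesis
    using * square_form[of c y w \<epsilon>] C_pos[OF c] by (intro exI[of _ \<epsilon>] exI[of _ y] exI[of _ w]) auto
qed

text \<open>At \<open>c \<in> C\<close> the Lax matrix has rank one, so that \<open>U\<close> is, up to a sign \<open>\<epsilon>C c\<close>, the square of a solution.\<close>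

definition Csol :: "real \<Rightarrow> real \<times> (int \<Rightarrow> real) \<times> (int \<Rightarrow> real)" where
  "Csol c = (SOME (\<epsilon>, y, w). (\<epsilon> = 1 \<or> \<epsilon> = -1) \<and> solution c y w \<and> (y 0 \<noteq> 0 \<or> w 0 \<noteq> 0)
    \<and> (\<forall>k. U k c = - \<epsilon> * (y k)\<^sup>2 \<and> V k c = \<epsilon> * y k * w k \<and> W k c = \<epsilon> * (w k)\<^sup>2))"

definition "\<epsilon>C c = fst (Csol c)"
definition "yC c = fst (snd (Csol c))"
definition "wC c = snd (snd (Csol c))"

lemma Csol:
  assumes "c \<in> C"
  shows "\<epsilon>C c = 1 \<or> \<epsilon>C c = -1" "solution c (yC c) (wC c)" "yC c 0 \<noteq> 0 \<or> wC c 0 \<noteq> 0"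
    "U k c = - \<epsilon>C c * (yC c k)\<^sup>2" "V k c = \<epsilon>C c * yC c k * wC c k" "W k c = \<epsilon>C c * (wC c k)\<^sup>2"
proof -
  have "\<exists>p. case p of (\<epsilon>, y, w) \<Rightarrow> (\<epsilon> = 1 \<or> \<epsilon> = -1) \<and> solution c y w \<and> (y 0 \<noteq> 0 \<or> w 0 \<noteq> 0)
    \<and> (\<forall>k. U k c = - \<epsilon> * (y k)\<^sup>2 \<and> V k c = \<epsilon> * y k * w k \<and> W k c = \<epsilon> * (w k)\<^sup>2)"
    using C_solution_exists[OF assms] by auto
  from someI_ex[OF this, folded Csol_def]
  show "\<epsilon>C c = 1 \<or> \<epsilon>C c = -1" "solution c (yC c) (wC c)" "yC c 0 \<noteq> 0 \<or> wC c 0 \<noteq> 0"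
    "U k c = - \<epsilon>C c * (yC c k)\<^sup>2" "V k c = \<epsilon>C c * yC c k * wC c k" "W k c = \<epsilon>C c * (wC c k)\<^sup>2"
    by (simp_all add: \<epsilon>C_def yC_def wC_def split: prod.splits)
qed

lemma Ut_C:
  assumes "c \<in> C"
  shows "Ut t c = - \<epsilon>C c * (interp (yC c) t)\<^sup>2"
proof -
  define k where "k = \<lfloor>t\<rfloor>"
  have k: "of_int k \<le> t" "t \<le> of_int k + 1" unfolding k_def by linarith+
  show ?thesis
    unfolding path_segment[OF k] upoly_flow solution_segment[OF Csol(2)[OF assms] k]
    by (simp add: Csol(4-6)[OF assms] algebra_simps power2_eq_square)
qed

lemma Ut_C_iff: "c \<in> C \<Longrightarrow> Ut t c = 0 \<longleftrightarrow> interp (yC c) t = 0"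
  using Ut_C[of c t] Csol(1)[of c] by auto

abbreviation cs :: "nat \<Rightarrow> real" where "cs \<equiv> sorted_param a lam"

lemma sorted_cs: "sorted_wrt (<) (0 # sorted_list_of_set C)"
  using strict_sorted_list_of_set[of C] C_pos finite_C by simp

lemma length_cs: "length (0 # sorted_list_of_set C) = 2 * CARD('n)"
  using card_C n_pos by simp

lemma cs_less:
  assumes "i < j" "j < 2 * CARD('n)"
  shows "cs i < cs j"
  using sorted_cs assms length_cs unfolding sorted_wrt_iff_nth_less sorted_param_def C_def by simp

lemma cs_le: "i \<le> j \<Longrightarrow> j < 2 * CARD('n) \<Longrightarrow> cs i \<le> cs j"
  using cs_less[of i j] by (cases "i = j") auto

lemma cs_less_iff: "i < 2 * CARD('n) \<Longrightarrow> j < 2 * CARD('n) \<Longrightarrow> cs i < cs j \<longleftrightarrow> i < j"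
  using cs_less[of i j] cs_le[of j i] by (auto simp: not_less[symmetric])

lemma cs_0 [simp]: "cs 0 = 0"
  by (simp add: sorted_param_def)

lemma cs_Suc: "cs (Suc j) = sorted_list_of_set C ! j"
  by (simp add: sorted_param_def C_def)

lemma cs_C:
  assumes "0 < i" "i < 2 * CARD('n)"
  shows "cs i \<in> C"
proof -
  obtain j where j: "i = Suc j" using assms by (cases i) auto
  then have "j < length (sorted_list_of_set C)" using assms card_C by simp
  then have "sorted_list_of_set C ! j \<in> set (sorted_list_of_set C)" by (rule nth_mem)
  then show ?thesis using finite_C j by (simp add: cs_Suc)
qed

lemma C_cs:
  assumes "c \<in> C"
  shows "\<exists>i>0. i < 2 * CARD('n) \<and> c = cs i"
proof -
  have "c \<in> set (sorted_list_of_set C)" using assms finite_C by simp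
  then obtain j where "j < card C" "c = sorted_list_of_set C ! j"
    by (auto simp: in_set_conv_nth)
  then show ?thesis
    using card_C by (intro exI[of _ "Suc j"]) (simp add: cs_Suc)
qed

lemma cs_pos: "0 < i \<Longrightarrow> i < 2 * CARD('n) \<Longrightarrow> cs i > 0"
  using cs_less[of 0 i] by simp

end

section \<open>Position of the parameters and of the coordinates\<close>

context billiard begin

lemma generic_time: "\<exists>t. 0 < t \<and> t < 1 \<and> (\<forall>c\<in>C. interp (yC c) t \<noteq> 0)"
proof -
  have "finite (\<Union>c\<in>C. {t. interp (yC c) t = 0} \<inter> {0..1})"
    using finite_C by (intro finite_UN_I finite_zeros[OF Csol(2,3)]) auto
  then have "infinite ({0<..<1} - (\<Union>c\<in>C. {t. interp (yC c) t = 0} \<inter> {0..1}))"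
    by (intro Diff_infinite_finite infinite_Ioo) auto
  then obtain t where "t \<in> {0<..<1} - (\<Union>c\<in>C. {t. interp (yC c) t = 0} \<inter> {0..1})"
    by (metis ex_in_conv finite.emptyI)
  then show ?thesis by (intro exI[of _ t]) auto
qed

lemma disc_Ut:
  assumes "of_int k \<le> t" "t \<le> of_int k + 1"
  shows "(poly (qpoly a (trajectory_path q t) (u k)) s)\<^sup>2 + Ut t s * W k s = - poly R s"
proof -
  have "poly (disc_poly a (trajectory_path q t) (u k)) s = - poly R s"
    unfolding path_segment[OF assms] disc_eq by simp
  then show ?thesis by (simp add: disc_poly_def)
qed

lemma odd_card_C: "odd (card C)"
proof -
  obtain m where "CARD('n) = Suc m" using n_pos by (metis gr0_conv_Suc)
  then show ?thesis using card_C by simp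
qed

lemma sign_R:
  assumes "s \<notin> C"
  shows "0 < poly R s \<longleftrightarrow> odd (card {c \<in> C. c < s})"
proof -
  have "C = {c \<in> C. c < s} \<union> {c \<in> C. s - c < 0}"
    using assms by auto (metis linorder_neqE)
  moreover have "card ({c \<in> C. c < s} \<union> {c \<in> C. s - c < 0}) = card {c \<in> C. c < s} + card {c \<in> C. s - c < 0}"
    using finite_C by (intro card_Un_disjoint) auto
  ultimately have "even (card {c \<in> C. s - c < 0}) \<longleftrightarrow> odd (card {c \<in> C. c < s})"
    using odd_card_C by simp
  moreover have "0 < (- 1) ^ card {c \<in> C. s - c < 0} * poly R s"
    unfolding poly_R using finite_C assms by (intro prod_sign) auto
  ultimately show ?thesis
    by (cases "even (card {c \<in> C. s - c < 0})") auto
qed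

lemma cs_between_iff:
  assumes "s > 0" "s \<notin> C" "card {c \<in> C. c < s} = m" "i < 2 * CARD('n)"
  shows "cs i < s \<longleftrightarrow> i \<le> m"
proof -
  have sub: "{c \<in> C. c < s} \<subseteq> cs ` {1..<i}" if "s \<le> cs i"
  proof
    fix c assume "c \<in> {c \<in> C. c < s}"
    then obtain j where j: "j > 0" "j < 2 * CARD('n)" "c = cs j" "cs j < s" using C_cs by auto
    then have "cs j < cs i" using that by linarith
    then show "c \<in> cs ` {1..<i}" using j assms(4) by (auto simp: cs_less_iff)
  qed
  have sup: "cs ` {1..i} \<subseteq> {c \<in> C. c < s}" if "cs i < s"
  proof
    fix c assume "c \<in> cs ` {1..i}"
    then obtain j where "1 \<le> j" "j \<le> i" "c = cs j" by auto
    then show "c \<in> {c \<in> C. c < s}"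
      using cs_le[of j i] cs_C[of j] that assms(4) by auto
  qed
  have inj: "inj_on cs {1..i}"
    by (rule linorder_inj_onI') (use cs_less assms(4) in fastforce)
  show ?thesis
  proof (cases "cs i < s")
    case True
    have "card (cs ` {1..i}) \<le> m"
      unfolding assms(3)[symmetric] using sup[OF True] finite_C by (intro card_mono) auto
    then show ?thesis using True inj by (simp add: card_image)
  next
    case False
    then have i: "i \<noteq> 0" using assms(1) by (metis cs_0)
    have "m \<le> card (cs ` {1..<i})"
      unfolding assms(3)[symmetric] using sub False by (intro card_mono) auto
    also have "\<dots> \<le> i - 1" using card_image_le[of "{1..<i}" cs] by simp
    finally show ?thesis using False i by simp
  qed
qed

text \<open>
  At a generic moment the roots of \<open>Ut\<close> are separated by the \<open>a i\<close> and avoid the intervals where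
  \<open>R > 0\<close>; counting then forces exactly one root between \<open>cs (2j)\<close> and \<open>cs (2j+1)\<close>.
\<close>

lemma generic_roots:
  obtains t \<rho> e where "0 < t" "t < 1" "\<forall>c\<in>C. interp (yC c) t \<noteq> 0"
    "\<And>i j. i < j \<Longrightarrow> j < CARD('n) \<Longrightarrow> \<rho> i < \<rho> j"
    "\<And>j. j < CARD('n) \<Longrightarrow> poly (upoly a (trajectory_path q t)) (\<rho> j) = 0"
    "\<And>j. j < CARD('n) \<Longrightarrow> cs (2 * j) < \<rho> j \<and> \<rho> j < cs (2 * j + 1)"
    "\<And>j. j < CARD('n) \<Longrightarrow> \<rho> j < a (e j)"
    "\<And>i j. i < j \<Longrightarrow> j < CARD('n) \<Longrightarrow> a (e i) < \<rho> j"
    "e ` {..<CARD('n)} = UNIV"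
proof -
  obtain t where t: "0 < t" "t < 1" and nz: "\<forall>c\<in>C. interp (yC c) t \<noteq> 0"
    using generic_time by blast
  let ?x = "trajectory_path q t"
  have UC: "Ut t c \<noteq> 0" if "c \<in> C" for c using nz Ut_C_iff that by blast
  have "?x $ i \<noteq> 0" for i
    using UC[of "a i"] by (auto simp: C_def upoly_def poly_qpoly_at)
  then obtain \<rho>0 where \<rho>0: "\<And>i. Ut t (\<rho>0 i) = 0 \<and> \<rho>0 i < a i \<and> (\<forall>j<i. a j < \<rho>0 i)"
    using interlacing_roots[OF a_mono] by blast
  obtain e :: "nat \<Rightarrow> 'n" where e: "\<And>i j. i < j \<Longrightarrow> j < CARD('n) \<Longrightarrow> e i < e j" "UNIV = e ` {..<CARD('n)}"
    using finite_set_enum[OF finite[of "UNIV :: 'n set"]] by blast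
  define \<rho> where "\<rho> j = \<rho>0 (e j)" for j
  have \<rho>a: "\<rho> j < a (e j)" for j by (simp add: \<rho>_def \<rho>0)
  have a\<rho>: "a (e i) < \<rho> j" if "i < j" "j < CARD('n)" for i j
    using \<rho>0 e(1)[OF that] by (simp add: \<rho>_def)
  have root: "Ut t (\<rho> j) = 0" for j by (simp add: \<rho>_def \<rho>0)
  have \<rho>_pos: "\<rho> j > 0" for j
  proof (rule ccontr)
    assume "\<not> \<rho> j > 0"
    then show False using Ut_pos[of 0 t "\<rho> j"] t root[of j] by simp
  qed
  have \<rho>C: "\<rho> j \<notin> C" for j using UC root by blast
  define \<nu>C where "\<nu>C j = card {c \<in> C. c < \<rho> j}" for j
  have even: "even (\<nu>C j)" for j
  proof -
    \<comment> \<open>At a root of \<open>Ut\<close> the discriminant identity says that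
      \<open>- R\<close> is a square.\<close>
    have "- poly R (\<rho> j) \<ge> 0"
      using disc_Ut[of 0 t "\<rho> j"] t root[of j] by (metis add_0_right less_imp_le mult_zero_left of_int_0 add_0 zero_le_power2)
    then show ?thesis using sign_R[OF \<rho>C[of j]] by (auto simp: \<nu>C_def)
  qed
  \<comment> \<open>The counts are even, at most \<open>2n - 1\<close>, and strictly increasing
    because \<open>a (e i)\<close> separates the roots; so their halves are \<open>n\<close>
    increasing numbers below \<open>n\<close>.\<close>
  have "\<nu>C j div 2 = j" if "j < CARD('n)" for j
  proof (rule strict_mono_selfmap_id[OF _ _ that])
    fix i j assume ij: "i < j" "j < CARD('n)"
    have "{c \<in> C. c < \<rho> i} \<subset> {c \<in> C. c < \<rho> j}"
    proof
      show "{c \<in> C. c < \<rho> i} \<subseteq> {c \<in> C. c < \<rho> j}" using \<rho>a[of i] a\<rho>[OF ij] by auto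
      have "a (e i) \<in> {c \<in> C. c < \<rho> j} - {c \<in> C. c < \<rho> i}"
        using \<rho>a[of i] a\<rho>[OF ij] by (auto simp: C_def)
      then show "{c \<in> C. c < \<rho> i} \<noteq> {c \<in> C. c < \<rho> j}" by blast
    qed
    then have "\<nu>C i < \<nu>C j" unfolding \<nu>C_def using finite_C by (intro psubset_card_mono) auto
    then show "\<nu>C i div 2 < \<nu>C j div 2" using even[of i] even[of j] by presburger
  next
    fix i
    have "\<nu>C i \<le> card C" unfolding \<nu>C_def using finite_C by (intro card_mono) auto
    then show "\<nu>C i div 2 < CARD('n)" using card_C n_pos by linarith
  qed
  then have \<nu>: "\<nu>C j = 2 * j" if "j < CARD('n)" for j using even[of j] that by (metis dvd_mult_div_cancel)
  have cs: "cs (2 * j) < \<rho> j \<and> \<rho> j < cs (2 * j + 1)" if "j < CARD('n)" for j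
  proof -
    have iff: "cs i < \<rho> j \<longleftrightarrow> i \<le> 2 * j" if "i < 2 * CARD('n)" for i
      using cs_between_iff[OF \<rho>_pos \<rho>C \<nu>[unfolded \<nu>C_def, OF \<open>j < CARD('n)\<close>] that] .
    moreover have "cs (2 * j + 1) \<noteq> \<rho> j" using \<rho>C[of j] cs_C[of "2 * j + 1"] that by auto
    moreover have b: "2 * j < 2 * CARD('n)" "2 * j + 1 < 2 * CARD('n)" using that by linarith+
    moreover have "cs (2 * j) < \<rho> j" using iff[OF b(1)] by simp
    moreover have "\<not> cs (2 * j + 1) < \<rho> j" using iff[OF b(2)] by simp
    ultimately show ?thesis by linarith
  qed
  show ?thesis
    by (rule that[OF t nz _ root cs \<rho>a a\<rho> e(2)[symmetric]]) (use \<rho>a a\<rho> in \<open>force intro: less_trans\<close>)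
qed

text \<open>Exactly \<open>(i + 1) div 2\<close> roots of \<open>Ut\<close> lie below
  \<open>cs i\<close>, which gives the sign of \<open>Ut\<close> there at one generic moment. As
  \<open>\<epsilon>C\<close> does not depend on time, one moment suffices.\<close>

lemma \<epsilon>C_cs:
  assumes i: "0 < i" "i < 2 * CARD('n)"
  shows "\<epsilon>C (cs i) = - ((- 1) ^ ((i + 1) div 2))"
proof -
  obtain t \<rho> e where t: "0 < t" "t < 1" "\<forall>c\<in>C. interp (yC c) t \<noteq> 0"
    and ord: "\<And>i j. i < j \<Longrightarrow> j < CARD('n) \<Longrightarrow> \<rho> i < \<rho> j"
    and root: "\<And>j. j < CARD('n) \<Longrightarrow> Ut t (\<rho> j) = 0"
    and cs: "\<And>j. j < CARD('n) \<Longrightarrow> cs (2 * j) < \<rho> j \<and> \<rho> j < cs (2 * j + 1)"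
    using generic_roots by metis
  have iff: "\<rho> j < cs i \<longleftrightarrow> j < (i + 1) div 2" if "j < CARD('n)" for j
  proof (cases "2 * j + 1 \<le> i")
    case True
    then have "\<rho> j < cs i" using cs[OF that] cs_le[of "2 * j + 1" i] i by linarith
    then show ?thesis using True by auto
  next
    case False
    then have "cs i \<le> cs (2 * j)" using that by (intro cs_le) auto
    then have "\<not> \<rho> j < cs i" using cs[OF that] by linarith
    then show ?thesis using False by auto
  qed
  have "{j \<in> {..<CARD('n)}. \<rho> j - cs i < 0} = {..<(i + 1) div 2}"
    using iff i by auto
  moreover have "Ut t (cs i) = (\<Prod>j<CARD('n). \<rho> j - cs i)"
    using upoly_eq_prod_roots[OF ord root] by (simp add: poly_prod_roots)
  moreover have "Ut t (cs i) \<noteq> 0"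
    using Ut_C_iff[OF cs_C[OF i]] t(3) cs_C[OF i] by blast
  ultimately have "0 < (- 1) ^ ((i + 1) div 2) * Ut t (cs i)"
    using prod_sign[of "{..<CARD('n)}" "\<lambda>j. \<rho> j - cs i"] by simp
  also have "\<dots> = (- ((- 1) ^ ((i + 1) div 2) * \<epsilon>C (cs i))) * (interp (yC (cs i)) t)\<^sup>2"
    unfolding Ut_C[OF cs_C[OF i]] by simp
  finally have "0 < - ((- 1) ^ ((i + 1) div 2) * \<epsilon>C (cs i))"
    by (metis not_less zero_le_power2 zero_less_mult_iff)
  then show ?thesis
    using Csol(1)[OF cs_C[OF i]] by (cases "even ((i + 1) div 2)") auto
qed

lemma sign_Ut_cs:
  assumes "i < 2 * CARD('n)"
  shows "(- 1) ^ ((i + 1) div 2) * Ut t (cs i) \<ge> 0"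
proof (cases "i = 0")
  case False
  then have i: "0 < i" by simp
  show ?thesis
    unfolding Ut_C[OF cs_C[OF i assms]] \<epsilon>C_cs[OF i assms]
    by (simp flip: power_mult_distrib)
qed (simp add: Ut_0_nonneg)

text \<open>\<open>a (e j)\<close> separates the \<open>j\<close>-th root from the next, so its
  index among the \<open>cs\<close> lies strictly between \<open>2j\<close> and
  \<open>2j + 3\<close>; for the last one only \<open>2n - 1\<close> remains.\<close>

lemma index_a:
  "\<exists>e. (\<forall>j<CARD('n). a (e j) = cs (2 * j + 1) \<or> a (e j) = cs (2 * j + 2) \<and> j + 1 < CARD('n))
    \<and> e ` {..<CARD('n)} = UNIV"
proof -
  obtain t \<rho> and e :: "nat \<Rightarrow> 'n" where
    cs: "\<And>j. j < CARD('n) \<Longrightarrow> cs (2 * j) < \<rho> j \<and> \<rho> j < cs (2 * j + 1)"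
    and \<rho>a: "\<And>j. j < CARD('n) \<Longrightarrow> \<rho> j < a (e j)"
    and a\<rho>: "\<And>i j. i < j \<Longrightarrow> j < CARD('n) \<Longrightarrow> a (e i) < \<rho> j"
    and e: "e ` {..<CARD('n)} = UNIV"
    using generic_roots by metis
  have "a (e j) = cs (2 * j + 1) \<or> a (e j) = cs (2 * j + 2) \<and> j + 1 < CARD('n)" if j: "j < CARD('n)" for j
  proof -
    have "a (e j) \<in> C" by (simp add: C_def)
    then obtain i where i: "0 < i" "i < 2 * CARD('n)" "a (e j) = cs i" using C_cs by blast
    have "cs (2 * j) < cs i" using cs[OF j] \<rho>a[OF j] i by linarith
    then have l: "2 * j < i" using i j by (simp add: cs_less_iff)
    have r: "i < 2 * j + 3" if "j + 1 < CARD('n)"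
    proof -
      have "cs i < cs (2 * (j + 1) + 1)" using cs[OF that] a\<rho>[of j "j + 1"] that i by simp
      then show ?thesis using i that by (subst (asm) cs_less_iff) auto
    qed
    consider "i = 2 * j + 1" | "i = 2 * j + 2" "j + 1 < CARD('n)"
      using l r i j by (cases "j + 1 < CARD('n)") linarith+
    then show ?thesis using i by cases auto
  qed
  then show ?thesis using e by blast
qed

lemma cs_eq_iff: "i < 2 * CARD('n) \<Longrightarrow> j < 2 * CARD('n) \<Longrightarrow> cs i = cs j \<longleftrightarrow> i = j"
  using cs_less[of i j] cs_less[of j i] by (cases i j rule: linorder_cases) auto

text \<open>The index pairs \<open>2j + 1\<close>, \<open>2j + 2\<close> are disjoint and, by
  \<open>index_a\<close>, each receives exactly one \<open>a i\<close>; the other end of the gap is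
  a caustic parameter. Hence a sign difference of \<open>\<alpha>\<close> between the two kinds acts
  on every gap.\<close>

lemma gap_types:
  assumes j: "j + 1 < CARD('n)"
  shows "cs (2 * j + 1) \<in> range a \<longleftrightarrow> cs (2 * j + 2) \<notin> range a"
proof -
  obtain e :: "nat \<Rightarrow> 'n" where e: "\<And>j. j < CARD('n) \<Longrightarrow> a (e j) = cs (2 * j + 1) \<or> a (e j) = cs (2 * j + 2) \<and> j + 1 < CARD('n)"
    "e ` {..<CARD('n)} = (UNIV :: 'n set)" using index_a by blast
  have only: "cs i = a (e j)" if r: "cs i \<in> range a" and i: "i = 2 * j + 1 \<or> i = 2 * j + 2" for i
  proof -
    obtain x where x: "cs i = a x" using r by blast
    have "x \<in> e ` {..<CARD('n)}" using e(2) by simp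
    then obtain k where k: "k < CARD('n)" "cs i = a (e k)" using x by blast
    have iN: "i < 2 * CARD('n)" using i j by auto
    have "i = 2 * k + 1 \<or> i = 2 * k + 2"
      using e(1)[OF k(1)]
    proof
      assume "a (e k) = cs (2 * k + 1)"
      then show ?thesis using cs_eq_iff[OF iN, of "2 * k + 1"] k by simp
    next
      assume "a (e k) = cs (2 * k + 2) \<and> k + 1 < CARD('n)"
      then show ?thesis using cs_eq_iff[OF iN, of "2 * k + 2"] k by simp
    qed
    then have "k = j" using i by presburger
    then show ?thesis using k by simp
  qed
  have ne: "cs (2 * j + 1) \<noteq> cs (2 * j + 2)" using j by (simp add: cs_eq_iff)
  have "j < CARD('n)" using j by simp
  from e(1)[OF this] show ?thesis
  proof
    assume "a (e j) = cs (2 * j + 1)"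
    then show ?thesis using only[of "2 * j + 2"] ne by (metis rangeI)
  next
    assume "a (e j) = cs (2 * j + 2) \<and> j + 1 < CARD('n)"
    then show ?thesis using only[of "2 * j + 1"] ne by (metis rangeI)
  qed
qed

lemma cs_last: "cs (2 * CARD('n) - 1) \<in> range a"
proof -
  obtain e :: "nat \<Rightarrow> 'n" where e: "\<And>j. j < CARD('n) \<Longrightarrow> a (e j) = cs (2 * j + 1) \<or> a (e j) = cs (2 * j + 2) \<and> j + 1 < CARD('n)"
    "e ` {..<CARD('n)} = (UNIV :: 'n set)" using index_a by blast
  have "a (e (CARD('n) - 1)) = cs (2 * (CARD('n) - 1) + 1)" using e(1)[of "CARD('n) - 1"] n_pos by auto
  moreover have "2 * (CARD('n) - 1) + 1 = 2 * CARD('n) - 1" using n_pos by linarith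
  ultimately show ?thesis by (metis rangeI)
qed

section \<open>Motion of the coordinates within their intervals\<close>

definition mu :: "nat \<Rightarrow> real \<Rightarrow> real" where
  "mu j t = elliptic_coordinate a j (trajectory_path q t)"

text \<open>The signs of \<open>Ut\<close> at the \<open>cs i\<close> hold at all times, so the
  intermediate value theorem finds a root in each of the disjoint intervals, and these are the
  ordered roots, also at times when the point is not generic.\<close>

lemma mu_root:
  assumes j: "j < CARD('n)"
  shows "cs (2 * j) \<le> mu j t" "mu j t \<le> cs (2 * j + 1)" "Ut t (mu j t) = 0"
proof -
  have ex: "\<exists>r. cs (2 * j) \<le> r \<and> r \<le> cs (2 * j + 1) \<and> Ut t r = 0" if j: "j < CARD('n)" for j
  proof -
    have s: "(- 1) ^ j * Ut t (cs (2 * j)) \<ge> 0" "- ((- 1) ^ j * Ut t (cs (2 * j + 1))) \<ge> 0"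
      using sign_Ut_cs[of "2 * j" t] sign_Ut_cs[of "2 * j + 1" t] j by auto
    have "\<exists>r\<ge>cs (2 * j). r \<le> cs (2 * j + 1) \<and> (- 1) ^ j * Ut t r = 0"
      using s j by (intro IVT2' continuous_intros) (auto intro!: cs_le)
    then show ?thesis by auto
  qed
  then obtain r where r: "\<And>j. j < CARD('n) \<Longrightarrow> cs (2 * j) \<le> r j \<and> r j \<le> cs (2 * j + 1) \<and> Ut t (r j) = 0"
    by metis
  have "r i < r j" if "i < j" "j < CARD('n)" for i j
    using r[of i] r[of j] cs_less[of "2 * i + 1" "2 * j"] that by auto
  then have "mu j t = r j"
    unfolding mu_def using r j by (intro elliptic_coordinate_eq[OF a_mono]) auto
  then show "cs (2 * j) \<le> mu j t" "mu j t \<le> cs (2 * j + 1)" "Ut t (mu j t) = 0"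
    using r[OF j] by auto
qed

lemma mu_less: "i < j \<Longrightarrow> j < CARD('n) \<Longrightarrow> mu i t < mu j t"
  using mu_root(2)[of i t] mu_root(1)[of j t] cs_less[of "2 * i + 1" "2 * j"] by auto

lemma Ut_prod: "Ut t s = (\<Prod>j<CARD('n). mu j t - s)"
  using upoly_eq_prod_roots[of "\<lambda>j. mu j t", OF mu_less mu_root(3)] by (simp add: poly_prod_roots)

lemma continuous_on_mu:
  assumes "j < CARD('n)"
  shows "continuous_on S (mu j)"
proof -
  have "(mu j \<longlongrightarrow> mu j t) (at t)" for t
  proof (rule roots_tendsto[of "CARD('n)" "\<lambda>j. mu j t" "\<lambda>t j. mu j t" "at t", OF mu_less _ _ assms])
    fix s
    have "(trajectory_path q \<longlongrightarrow> trajectory_path q t) (at t)"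
      using continuous_on_interp[of UNIV q] unfolding path_eq by (simp add: continuous_on_def)
    from tendsto_poly_upoly[OF this, of a s]
    show "((\<lambda>t. \<Prod>j<CARD('n). mu j t - s) \<longlongrightarrow> (\<Prod>j<CARD('n). mu j t - s)) (at t)"
      unfolding Ut_prod .
    show "\<forall>\<^sub>F t in at t. \<forall>i j. i < j \<longrightarrow> j < CARD('n) \<longrightarrow> mu i t < mu j t"
      by (rule always_eventually) (blast intro: mu_less)
  qed
  then have "continuous_on UNIV (mu j)" by (simp add: continuous_on_def)
  then show ?thesis by (rule continuous_on_subset) simp
qed

lemma mu_eq_iff:
  assumes j: "j < CARD('n)" and c: "cs (2 * j) \<le> c" "c \<le> cs (2 * j + 1)"
  shows "mu j t = c \<longleftrightarrow> Ut t c = 0"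
proof
  assume "Ut t c = 0"
  then obtain i where i: "i < CARD('n)" "mu i t = c" by (auto simp: Ut_prod)
  have "\<not> i < j" using mu_root(2)[OF i(1), of t] cs_less[of "2 * i + 1" "2 * j"] i c j by auto
  moreover have "\<not> j < i" using mu_root(1)[OF i(1), of t] cs_less[of "2 * j + 1" "2 * i"] i c j by auto
  ultimately show "mu j t = c" using i by (metis linorder_neqE_nat)
qed (use mu_root(3)[OF j, of t] in auto)

lemma mu_eq_cs_iff:
  assumes "j < CARD('n)" "i = 2 * j \<or> i = 2 * j + 1" "0 < i"
  shows "mu j t = cs i \<longleftrightarrow> interp (yC (cs i)) t = 0"
  using mu_eq_iff[OF assms(1), of "cs i" t] Ut_C_iff[of "cs i" t] cs_C[of i] cs_le[of "2 * j" "2 * j + 1"] assms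
  by auto

lemma mu_0_eq_iff: "mu 0 t = 0 \<longleftrightarrow> t \<in> \<int>"
  using mu_eq_iff[of 0 0 t] Ut_0_iff[of t] cs_pos[of 1] n_pos by simp

lemma finite_mu_hits:
  assumes j: "j < CARD('n)"
  shows "finite ({t. mu j t = cs (2 * j) \<or> mu j t = cs (2 * j + 1)} \<inter> {x..y})"
proof -
  have f: "finite ({t. mu j t = cs i} \<inter> {x..y})" if i: "i = 2 * j \<or> i = 2 * j + 1" for i
  proof (cases "i = 0")
    case True
    then have "{t. mu j t = cs i} = \<int>" using i mu_0_eq_iff by auto
    then show ?thesis using finite_int_segment[of x y] by (simp add: Collect_conj_eq[symmetric] Int_def)
  next
    case False
    have iC: "cs i \<in> C" using False i j by (intro cs_C) auto
    show ?thesis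
      using finite_zeros[OF Csol(2,3)[OF iC]] mu_eq_cs_iff[OF j i] False by simp
  qed
  have "{t. mu j t = cs (2 * j) \<or> mu j t = cs (2 * j + 1)} \<inter> {x..y}
    = ({t. mu j t = cs (2 * j)} \<inter> {x..y}) \<union> ({t. mu j t = cs (2 * j + 1)} \<inter> {x..y})" by auto
  then show ?thesis using f by simp
qed

text \<open>The other factors of \<open>Ut\<close> keep their signs on this interval,
  \<open>j\<close> of them being negative. So the passage of \<open>mu j\<close> through a level is
  read off from \<open>Ut\<close> at a fixed parameter.\<close>

lemma sign_Ut_mu:
  assumes j: "j < CARD('n)" and s: "cs (2 * j) < s" "s < cs (2 * j + 1)"
  shows "s < mu j t \<longleftrightarrow> (- 1) ^ j * Ut t s > 0" "mu j t < s \<longleftrightarrow> (- 1) ^ j * Ut t s < 0"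
proof -
  have lo: "mu i t < s" if "i < j" for i
    using mu_root(2)[of i t] cs_less[of "2 * i + 1" "2 * j"] that s j by auto
  have hi: "s < mu i t" if "j < i" "i < CARD('n)" for i
    using mu_root(1)[of i t] cs_less[of "2 * j + 1" "2 * i"] that s j by auto
  define P where "P = (\<Prod>i\<in>{..<CARD('n)} - {j}. mu i t - s)"
  have set: "{i \<in> {..<CARD('n)} - {j}. mu i t - s < 0} = {..<j}"
    using lo hi j by (auto, metis less_asym linorder_neqE_nat)
  have ne: "mu i t - s \<noteq> 0" if "i \<in> {..<CARD('n)} - {j}" for i
    using that lo[of i] hi[of i] by (cases i j rule: linorder_cases) auto
  define E where "E = (- 1) ^ j * P"
  have E: "E > 0"
    unfolding E_def P_def using prod_sign[of "{..<CARD('n)} - {j}" "\<lambda>i. mu i t - s", OF _ ne] unfolding set by simp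
  have eq: "(- 1) ^ j * Ut t s = (mu j t - s) * E"
    unfolding Ut_prod P_def E_def using j by (subst prod.remove[of _ j]) auto
  show "s < mu j t \<longleftrightarrow> (- 1) ^ j * Ut t s > 0" "mu j t < s \<longleftrightarrow> (- 1) ^ j * Ut t s < 0"
    unfolding eq using E by (auto simp: zero_less_mult_iff mult_less_0_iff)
qed

lemma quadratic_crossing:
  fixes V W :: real
  assumes "V \<noteq> 0"
  obtains \<delta> where "\<delta> > 0" "\<And>h. \<bar>h\<bar> < \<delta> \<Longrightarrow> h \<noteq> 0 \<Longrightarrow> h * V * (- 2 * h * V - h\<^sup>2 * W) < 0"
proof
  \<comment> \<open>Within this radius the linear term dominates; the summand 1 covers
    \<open>W = 0\<close>.\<close>
  show "2 * \<bar>V\<bar> / (\<bar>W\<bar> + 1) > 0" using assms by simp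
  fix h :: real assume h: "\<bar>h\<bar> < 2 * \<bar>V\<bar> / (\<bar>W\<bar> + 1)" "h \<noteq> 0"
  have "\<bar>h * W\<bar> \<le> \<bar>h\<bar> * (\<bar>W\<bar> + 1)" by (simp add: abs_mult mult_left_mono)
  also have "\<dots> < 2 * \<bar>V\<bar>" using h(1) by (simp add: pos_less_divide_eq add_nonneg_pos)
  finally have "\<bar>V * (h * W)\<bar> < \<bar>V\<bar> * (2 * \<bar>V\<bar>)"
    using assms unfolding abs_mult[of V] by (intro mult_strict_left_mono) auto
  moreover have "\<bar>V\<bar> * (2 * \<bar>V\<bar>) = 2 * V\<^sup>2" by (simp add: power2_eq_square)
  ultimately have "2 * V\<^sup>2 + V * (h * W) > 0" by linarith
  then have "h\<^sup>2 * (2 * V\<^sup>2 + V * (h * W)) > 0" using h(2) by simp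
  then show "h * V * (- 2 * h * V - h\<^sup>2 * W) < 0" by (simp add: algebra_simps power2_eq_square)
qed

text \<open>At an impact the kick changes this value by a multiple of \<open>Ut\<close>, which
  vanishes at \<open>s\<close>.\<close>

lemma V_path_sides:
  assumes s: "s \<noteq> 0" and U: "Ut t s = 0"
  shows "poly (qpoly a (trajectory_path q t) (u (\<lceil>t\<rceil> - 1))) s = poly (qpoly a (trajectory_path q t) (u \<lfloor>t\<rfloor>)) s"
proof (cases "t \<in> \<int>")
  case True
  then obtain k where k: "t = of_int (k + 1)" by (metis Ints_cases diff_add_cancel)
  have "trajectory_path q t = q (k + 1)" unfolding path_eq k by (rule interp_of_int)
  moreover have "\<lceil>t\<rceil> - 1 = k" "\<lfloor>t\<rfloor> = k + 1" unfolding k by simp_all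
  ultimately show ?thesis using V_kick[OF s, of k] U by simp
next
  case False
  then have "\<lceil>t\<rceil> - 1 = \<lfloor>t\<rfloor>" by (metis Ints_of_int add_diff_cancel_right' ceiling_altdef)
  then show ?thesis by simp
qed

lemma Ut_near:
  assumes t: "of_int k \<le> t" "t \<le> of_int k + 1" and r: "of_int k \<le> r" "r \<le> of_int k + 1"
  shows "Ut r s = Ut t s - 2 * ((r - t) * \<tau> k) * poly (qpoly a (trajectory_path q t) (u k)) s - ((r - t) * \<tau> k)\<^sup>2 * W k s"
proof -
  have "trajectory_path q r = trajectory_path q t + ((r - t) * \<tau> k) *\<^sub>R u k"
    unfolding path_segment[OF t] path_segment[OF r] by (simp add: algebra_simps)
  then show ?thesis by (simp add: upoly_flow)
qed

text \<open>At an interior level \<open>s = mu j t\<close> one has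
  \<open>V^2 = - R \<noteq> 0\<close>, so \<open>Ut\<close> at \<open>s\<close> changes sign at time
  \<open>t\<close> by its linear term, even across an impact; the coordinate therefore passes
  through the level.\<close>

lemma mu_no_extremum:
  assumes j: "j < CARD('n)" and s: "cs (2 * j) < mu j t" "mu j t < cs (2 * j + 1)" and d: "d > 0"
  shows "\<exists>t1 t2. \<bar>t1 - t\<bar> < d \<and> \<bar>t2 - t\<bar> < d \<and> mu j t1 < mu j t \<and> mu j t < mu j t2"
proof -
  define s where "s = mu j t"
  have cs0: "cs (2 * j) \<ge> 0" using cs_le[of 0 "2 * j"] j by simp
  then have s0: "s \<noteq> 0" using s by (simp add: s_def)
  have U: "Ut t s = 0" unfolding s_def by (rule mu_root(3)[OF j])
  have sC: "s \<notin> C"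
  proof
    assume "s \<in> C"
    then obtain i where i: "i < 2 * CARD('n)" "s = cs i" using C_cs by blast
    then have "2 * j < i \<and> i < 2 * j + 1"
      using s j cs_less_iff[of "2 * j" i] cs_less_iff[of i "2 * j + 1"] by (simp add: s_def)
    then show False by linarith
  qed
  define V where "V = poly (qpoly a (trajectory_path q t) (u \<lfloor>t\<rfloor>)) s"
  have "V\<^sup>2 = - poly R s"
  proof -
    have "of_int \<lfloor>t\<rfloor> \<le> t" "t \<le> of_int \<lfloor>t\<rfloor> + 1" by linarith+
    from disc_Ut[OF this, of s] show ?thesis by (simp add: V_def U)
  qed
  moreover have "poly R s \<noteq> 0" using sC finite_C by (auto simp: poly_R)
  ultimately have V: "V \<noteq> 0" by auto
  have side: "\<exists>r. \<bar>r - t\<bar> < d \<and> sgn (r - t) = \<sigma> \<and> \<sigma> * V * Ut r s < 0"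
    if k: "of_int k \<le> t" "t \<le> of_int k + 1" and Vk: "poly (qpoly a (trajectory_path q t) (u k)) s = V"
      and \<sigma>: "\<sigma> = 1 \<and> t < of_int k + 1 \<or> \<sigma> = -1 \<and> of_int k < t" for k \<sigma>
  proof -
    obtain \<delta> where \<delta>: "\<delta> > 0" "\<And>h. \<bar>h\<bar> < \<delta> \<Longrightarrow> h \<noteq> 0 \<Longrightarrow> h * V * (- 2 * h * V - h\<^sup>2 * W k s) < 0"
      using quadratic_crossing[OF V, of "W k s"] by blast
    define m where "m = (if \<sigma> = 1 then of_int k + 1 - t else t - of_int k)"
    have m: "m > 0" using \<sigma> by (auto simp: m_def)
    define D where "D = \<delta> / \<tau> k"
    have D: "D > 0" unfolding D_def using \<delta>(1) \<tau>_pos[of k] by simp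
    define g where "g = min (min d D) m / 2"
    have "g > 0" "g < d" "g < D" "g < m"
      using d m D by (auto simp: g_def min_def)
    then have g: "g > 0" "g < d" "g < \<delta> / \<tau> k" "g < m"
      unfolding D_def by auto
    define r where "r = t + \<sigma> * g"
    have r: "of_int k \<le> r" "r \<le> of_int k + 1" using k g \<sigma> by (auto simp: r_def m_def)
    have \<sigma>1: "\<bar>\<sigma>\<bar> = 1" "\<sigma> \<noteq> 0" using \<sigma> by auto
    define h where "h = (r - t) * \<tau> k"
    have "\<bar>h\<bar> < \<delta>" using g(1,3) \<sigma>1 \<tau>_pos[of k] by (simp add: h_def r_def abs_mult pos_less_divide_eq)
    moreover have "h \<noteq> 0" using g(1) \<sigma>1 \<tau>_pos[of k] by (simp add: h_def r_def)
    ultimately have "h * V * (- 2 * h * V - h\<^sup>2 * W k s) < 0" by (rule \<delta>(2))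
    moreover have "Ut r s = - 2 * h * V - h\<^sup>2 * W k s"
      using Ut_near[OF k r, of s] by (simp add: U Vk h_def)
    ultimately have "h * (V * Ut r s) < 0" by (simp add: mult.assoc)
    then have "(g * \<tau> k) * (\<sigma> * V * Ut r s) < 0" by (simp add: h_def r_def mult_ac)
    then have "\<sigma> * V * Ut r s < 0" using g(1) \<tau>_pos[of k] by (simp add: mult_less_0_iff)
    moreover have "\<bar>r - t\<bar> < d" using g(1,2) \<sigma>1 by (simp add: r_def abs_mult)
    moreover have "sgn (r - t) = \<sigma>" using g(1) \<sigma> by (auto simp: r_def sgn_mult)
    ultimately show ?thesis by blast
  qed
  obtain r where r: "\<bar>r - t\<bar> < d" "V * Ut r s < 0"
  proof -
    have "of_int \<lfloor>t\<rfloor> \<le> t" "t \<le> of_int \<lfloor>t\<rfloor> + 1" "t < of_int \<lfloor>t\<rfloor> + 1" by linarith+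
    then show ?thesis using side[of "\<lfloor>t\<rfloor>" 1] that by (auto simp: V_def)
  qed
  obtain l where l: "\<bar>l - t\<bar> < d" "V * Ut l s > 0"
  proof -
    have "of_int (\<lceil>t\<rceil> - 1) \<le> t" "t \<le> of_int (\<lceil>t\<rceil> - 1) + 1" "of_int (\<lceil>t\<rceil> - 1) < t" by linarith+
    then show ?thesis using side[of "\<lceil>t\<rceil> - 1" "-1"] that V_path_sides[OF s0 U] by (auto simp: V_def)
  qed
  have "cs (2 * j) < s" "s < cs (2 * j + 1)" using s by (auto simp: s_def)
  note sign = sign_Ut_mu[OF j this]
  have "mu j r < s \<and> s < mu j l \<or> mu j l < s \<and> s < mu j r"
    using r(2) l(2) unfolding sign by (cases "even j") (auto simp: mult_less_0_iff zero_less_mult_iff)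
  then show ?thesis
    unfolding s_def using r(1) l(1) by blast
qed

lemma mu_round_trips:
  assumes j: "j < CARD('n)" and L: "L > 0" and per: "\<And>t. mu j (t + L) = mu j t"
  shows "round_trips (mu j) (cs (2 * j)) (cs (2 * j + 1)) L k \<longleftrightarrow> k = period_count L {t. mu j t = cs (2 * j)}"
    and "period_count L {t. mu j t = cs (2 * j)} = period_count L {t. mu j t = cs (2 * j + 1)}"
    and "period_count L {t. mu j t = cs (2 * j)} > 0"
  using round_trips_iff_count[of L "mu j" "cs (2 * j)" "cs (2 * j + 1)", OF L continuous_on_mu[OF j] per
      _ _ finite_mu_hits[OF j] mu_no_extremum[OF j]] cs_less[of "2 * j" "2 * j + 1"] mu_root[OF j] j
  by auto

end

section \<open>The transfer matrix over several bounces\<close>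

context string begin

text \<open>
  The matrix \<open>b\<close> maps \<open>(y 0, w 0)\<close> to \<open>(y k, w k)\<close> for solutions at parameter \<open>s\<close>. Its entries are
  polynomials in \<open>1 / s\<close>.
\<close>

primrec fund :: "real \<Rightarrow> real \<Rightarrow> nat \<Rightarrow> real poly \<times> real poly" where
  "fund y0 w0 0 = ([:y0:], [:w0:])"
| "fund y0 w0 (Suc k) = (let y = fst (fund y0 w0 k) + smult (\<tau> (int k)) (snd (fund y0 w0 k))
     in (y, snd (fund y0 w0 k) - smult (\<kappa> (int k + 1)) (pCons 0 y)))"

definition "b11 k = fst (fund 1 0 k)"
definition "b21 k = snd (fund 1 0 k)"
definition "b12 k = fst (fund 0 1 k)"
definition "b22 k = snd (fund 0 1 k)"

lemmas b_defs = b11_def b21_def b12_def b22_def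

lemma b_0: "poly (b11 0) z = 1" "poly (b21 0) z = 0" "poly (b12 0) z = 0" "poly (b22 0) z = 1"
  by (simp_all add: b_defs)

lemma b_Suc:
  "poly (b11 (Suc k)) z = poly (b11 k) z + \<tau> (int k) * poly (b21 k) z"
  "poly (b12 (Suc k)) z = poly (b12 k) z + \<tau> (int k) * poly (b22 k) z"
  "poly (b21 (Suc k)) z = poly (b21 k) z - \<kappa> (int k + 1) * z * poly (b11 (Suc k)) z"
  "poly (b22 (Suc k)) z = poly (b22 k) z - \<kappa> (int k + 1) * z * poly (b12 (Suc k)) z"
  by (simp_all add: b_defs Let_def)

lemma b_det: "poly (b11 k) z * poly (b22 k) z - poly (b12 k) z * poly (b21 k) z = 1"
proof (induction k)
  case (Suc k)
  then show ?case unfolding b_Suc by (simp add: algebra_simps)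
qed (simp add: b_0)

text \<open>At \<open>1 / s = 0\<close> the beads have no strength and only free flight remains, so
  the matrix is upper unipotent.\<close>

lemma b_at_0: "poly (b11 k) 0 = 1 \<and> poly (b21 k) 0 = 0 \<and> poly (b22 k) 0 = 1"
  by (induction k) (simp_all add: b_0 b_Suc)

lemma solution_fund:
  assumes "solution s y w"
  shows "y (int k) = poly (b11 k) (1 / s) * y 0 + poly (b12 k) (1 / s) * w 0
    \<and> w (int k) = poly (b21 k) (1 / s) * y 0 + poly (b22 k) (1 / s) * w 0"
proof (induction k)
  case (Suc k)
  have "y (int (Suc k)) = y (int k) + \<tau> (int k) * w (int k)"
    using solution_pos[OF assms, of "int k"] by (simp add: add.commute)
  moreover have "w (int (Suc k)) = w (int k) - \<kappa> (int k + 1) / s * y (int (Suc k))"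
    using solution_vel[OF assms, of "int k"] by (simp add: add.commute)
  ultimately show ?case using Suc by (simp add: b_Suc algebra_simps)
qed (simp add: b_0)

end

lemma tendsto_poly_at_right: "(poly p \<longlongrightarrow> poly p z) (at_right z)"
  for p :: "real poly"
proof -
  have "isCont (poly p) z" by simp
  then show ?thesis unfolding isCont_def by (rule tendsto_within_subset) simp
qed

text \<open>A flight followed by a kick conjugates the Lax matrix by the transfer matrix, which
  therefore carries eigenvectors to eigenvectors with the same eigenvalue.\<close>

lemma eigenvector_step:
  fixes U0 U1 V0 V1 Vm W0 W1 y y1 w w1 g h l :: real
  assumes "V0 * y + U0 * w = l * y" "W0 * y - V0 * w = l * w"
    and "U1 = U0 - 2 * h * V0 - h\<^sup>2 * W0" "Vm = V0 + h * W0"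
    and "V1 = Vm + g * U1" "W1 = W0 - 2 * g * Vm - g\<^sup>2 * U1"
    and "y1 = y + h * w" "w1 = w - g * y1"
  shows "V1 * y1 + U1 * w1 = l * y1" "W1 * y1 - V1 * w1 = l * w1"
proof -
  have "V1 * y1 + U1 * w1 = (V0 * y + U0 * w) + h * (W0 * y - V0 * w)"
    unfolding assms(3-) by (simp add: algebra_simps power2_eq_square)
  then show "V1 * y1 + U1 * w1 = l * y1"
    unfolding assms(1,2) assms(7) by (simp add: algebra_simps)
  have "W1 * y1 - V1 * w1 = (W0 * y - V0 * w) - g * ((V0 * y + U0 * w) + h * (W0 * y - V0 * w))"
    unfolding assms(3-) by (simp add: algebra_simps power2_eq_square)
  then show "W1 * y1 - V1 * w1 = l * w1"
    unfolding assms(1,2) assms(7,8) by (simp add: algebra_simps)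
qed

context billiard begin

section \<open>Eigenvectors of the Lax matrix as \<open>s\<close> decreases to 0\<close>

lemma V_0_neg: "V k 0 < 0"
proof -
  have "0 \<notin> range a" using a_nz by auto
  then have "V k 0 = poly (ellipsoid_poly a) 0 * quadric_form a 0 (q k) (u k)"
    by (rule poly_qpoly_quadric_form)
  then show ?thesis
    using poly_ellipsoid_pos[of a 0] a_pos inward[of k] by (simp add: mult_pos_neg)
qed

lemma U_0: "U k 0 = 0"
  using Ut_0_integer[of k] by (simp add: path_eq)

lemma V_0_eq: "V k 0 = - sqrt (- poly R 0)"
proof -
  have "sqrt (- poly R 0) = \<bar>V k 0\<bar>"
    using mumford[of k 0] by (simp add: U_0 flip: real_sqrt_abs)
  then show ?thesis using V_0_neg[of k] by simp
qed

text \<open>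
  \<open>(ep, 1)\<close> and \<open>(1, em)\<close> are eigenvectors of the Lax matrix for the eigenvalues \<open>wr\<close> and \<open>- wr\<close>,
  normalised so that they remain finite and independent as \<open>s \<rightarrow> 0\<close>.
\<close>

definition wr :: "real \<Rightarrow> real" where "wr s = sqrt (- poly R s)"
definition ep :: "int \<Rightarrow> real \<Rightarrow> real" where "ep k s = U k s / (wr s - V k s)"
definition em :: "int \<Rightarrow> real \<Rightarrow> real" where "em k s = W k s / (V k s - wr s)"

lemma wr_0: "wr 0 = - V k 0" "wr 0 > 0"
  using V_0_eq[of k] V_0_eq[of 0] V_0_neg[of 0] by (simp_all add: wr_def)

lemma tendsto_wr: "(wr \<longlongrightarrow> wr 0) (at_right 0)"
  unfolding wr_def by (intro tendsto_intros tendsto_poly_at_right)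

lemma tendsto_ep: "(ep k \<longlongrightarrow> 0) (at_right 0)"
proof -
  have "((\<lambda>s. U k s / (wr s - V k s)) \<longlongrightarrow> U k 0 / (wr 0 - V k 0)) (at_right 0)"
    using wr_0(1)[of k] wr_0(2) by (intro tendsto_intros tendsto_poly_at_right tendsto_wr) auto
  then show ?thesis by (simp add: ep_def[abs_def] U_0)
qed

lemma tendsto_em: "\<exists>l. (em k \<longlongrightarrow> l) (at_right 0)"
proof -
  have "((\<lambda>s. W k s / (V k s - wr s)) \<longlongrightarrow> W k 0 / (V k 0 - wr 0)) (at_right 0)"
    using wr_0(1)[of k] wr_0(2) by (intro tendsto_intros tendsto_poly_at_right tendsto_wr) auto
  then show ?thesis by (auto simp: em_def[abs_def])
qed

text \<open>Here \<open>wr\<close> is a true square root of \<open>- R\<close>, the denominators of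
  \<open>ep\<close> and \<open>em\<close> do not vanish, and the eigenvectors are independent,
  \<open>ep * em - 1\<close> being their determinant.\<close>

definition good :: "int \<Rightarrow> real \<Rightarrow> bool" where
  "good k s \<longleftrightarrow> s > 0 \<and> poly R s < 0 \<and> wr s - V k s \<noteq> 0 \<and> ep k s * em k s - 1 \<noteq> 0"

lemma eventually_good: "eventually (good k) (at_right 0)"
proof -
  obtain l where "(em k \<longlongrightarrow> l) (at_right 0)" using tendsto_em by blast
  then have "((\<lambda>s. ep k s * em k s - 1) \<longlongrightarrow> 0 * l - 1) (at_right 0)"
    by (intro tendsto_intros tendsto_ep)
  then have "eventually (\<lambda>s. ep k s * em k s - 1 < 0) (at_right 0)"
    by (rule order_tendstoD) simp
  moreover have "poly R 0 < 0"
  proof -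
    have "(V k 0)\<^sup>2 > 0" using V_0_neg[of k] by simp
    moreover have "(V k 0)\<^sup>2 = - poly R 0" using mumford[of k 0] by (simp add: U_0)
    ultimately show ?thesis by linarith
  qed
  then have "eventually (\<lambda>s. poly R s < 0) (at_right 0)"
    by (rule order_tendstoD(2)[OF tendsto_poly_at_right])
  moreover have "((\<lambda>s. wr s - V k s) \<longlongrightarrow> wr 0 - V k 0) (at_right 0)"
    by (intro tendsto_intros tendsto_wr tendsto_poly_at_right)
  then have "eventually (\<lambda>s. wr s - V k s > 0) (at_right 0)"
    by (rule order_tendstoD) (use wr_0(2) V_0_neg[of k] in linarith)
  moreover have "eventually (\<lambda>s::real. s > 0) (at_right 0)"
    by (simp add: eventually_at_right_less)
  ultimately show ?thesis
    by eventually_elim (auto simp: good_def)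
qed

lemma wr_sq: "good k s \<Longrightarrow> (wr s)\<^sup>2 = (V j s)\<^sup>2 + U j s * W j s"
  unfolding mumford by (simp add: wr_def good_def)

lemma ep_eigen:
  assumes "good k s"
  shows "V k s * ep k s + U k s * 1 = wr s * ep k s" "W k s * ep k s - V k s * 1 = wr s * 1"
proof -
  have d: "wr s - V k s \<noteq> 0" using assms by (simp add: good_def)
  show "V k s * ep k s + U k s * 1 = wr s * ep k s"
    using d by (simp add: ep_def field_simps)
  show "W k s * ep k s - V k s * 1 = wr s * 1"
    using d wr_sq[OF assms, of k] by (simp add: ep_def field_simps power2_eq_square)
qed

lemma em_eigen:
  assumes "good k s"
  shows "V k s * 1 + U k s * em k s = - wr s * 1" "W k s * 1 - V k s * em k s = - wr s * em k s"
proof -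
  have d: "V k s - wr s \<noteq> 0" using assms by (simp add: good_def)
  show "V k s * 1 + U k s * em k s = - wr s * 1"
    using d wr_sq[OF assms, of k] by (simp add: em_def field_simps power2_eq_square)
  show "W k s * 1 - V k s * em k s = - wr s * em k s"
    using d by (simp add: em_def field_simps)
qed

text \<open>\<open>(yp, wp)\<close> and \<open>(ym, wm)\<close> are the images after
  \<open>k\<close> bounces of the eigenvectors \<open>(ep, 1)\<close> and \<open>(1, em)\<close> at
  bounce 0.\<close>

definition "yp k s = poly (b11 k) (1 / s) * ep 0 s + poly (b12 k) (1 / s)"
definition "wp k s = poly (b21 k) (1 / s) * ep 0 s + poly (b22 k) (1 / s)"
definition "ym k s = poly (b11 k) (1 / s) + poly (b12 k) (1 / s) * em 0 s"
definition "wm k s = poly (b21 k) (1 / s) + poly (b22 k) (1 / s) * em 0 s"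

lemma ypm_0: "yp 0 s = ep 0 s" "wp 0 s = 1" "ym 0 s = 1" "wm 0 s = em 0 s"
  by (simp_all add: yp_def wp_def ym_def wm_def b_0)

lemma ypm_Suc:
  "yp (Suc k) s = yp k s + \<tau> (int k) * wp k s"
  "wp (Suc k) s = wp k s - \<kappa> (int k + 1) / s * yp (Suc k) s"
  "ym (Suc k) s = ym k s + \<tau> (int k) * wm k s"
  "wm (Suc k) s = wm k s - \<kappa> (int k + 1) / s * ym (Suc k) s"
  by (simp_all add: yp_def wp_def ym_def wm_def b_Suc algebra_simps)

lemma ypm_eigen:
  assumes "good 0 s"
  shows "V (int k) s * yp k s + U (int k) s * wp k s = wr s * yp k s
    \<and> W (int k) s * yp k s - V (int k) s * wp k s = wr s * wp k s
    \<and> V (int k) s * ym k s + U (int k) s * wm k s = - wr s * ym k s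
    \<and> W (int k) s * ym k s - V (int k) s * wm k s = - wr s * wm k s"
proof (induction k)
  case 0
  then show ?case using ep_eigen[OF assms] em_eigen[OF assms] by (simp add: ypm_0)
next
  case (Suc k)
  have s: "s \<noteq> 0" using assms by (simp add: good_def)
  have i: "int (Suc k) = int k + 1" by simp
  show ?case
    unfolding i
    using eigenvector_step[OF _ _ U_next V_before V_kick[OF s] W_kick[OF s] ypm_Suc(1,2)]
      eigenvector_step[OF _ _ U_next V_before V_kick[OF s] W_kick[OF s] ypm_Suc(3,4)] Suc by blast
qed

lemma ypm_eq:
  assumes "good 0 s" "good (int k) s"
  shows "yp k s = wp k s * ep (int k) s" "wm k s = ym k s * em (int k) s"
proof -
  have d: "wr s - V (int k) s \<noteq> 0" using assms by (simp add: good_def)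
  have "U (int k) s * wp k s = (wr s - V (int k) s) * yp k s"
    using ypm_eigen[OF assms(1), of k] by (simp add: algebra_simps)
  then show "yp k s = wp k s * ep (int k) s" using d by (simp add: ep_def field_simps)
  have "W (int k) s * ym k s = (V (int k) s - wr s) * wm k s"
    using ypm_eigen[OF assms(1), of k] by (simp add: algebra_simps)
  then show "wm k s = ym k s * em (int k) s" using d by (simp add: em_def field_simps)
qed

text \<open>The next bounce multiplies \<open>s^k * wp k\<close> by
  \<open>s - \<kappa> (ep + \<tau>)\<close>, whose limit \<open>- \<kappa> \<tau>\<close> is
  nonzero: each bounce contributes exactly one factor \<open>1 / s\<close>.\<close>

lemma wp_growth: "\<exists>l. l \<noteq> 0 \<and> ((\<lambda>s. s ^ k * wp k s) \<longlongrightarrow> l) (at_right 0)"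
proof (induction k)
  case 0
  then show ?case by (intro exI[of _ 1]) (simp add: ypm_0)
next
  case (Suc k)
  then obtain l where l: "l \<noteq> 0" "((\<lambda>s. s ^ k * wp k s) \<longlongrightarrow> l) (at_right 0)" by blast
  let ?\<tau> = "\<tau> (int k)" and ?\<kappa> = "\<kappa> (int k + 1)"
  have "((\<lambda>s. (s ^ k * wp k s) * (s - ?\<kappa> * (ep (int k) s + ?\<tau>))) \<longlongrightarrow> l * (0 - ?\<kappa> * (0 + ?\<tau>))) (at_right 0)"
    by (intro tendsto_intros l tendsto_ep)
  moreover have "eventually (\<lambda>s. (s ^ k * wp k s) * (s - ?\<kappa> * (ep (int k) s + ?\<tau>)) = s ^ Suc k * wp (Suc k) s) (at_right 0)"
    using eventually_good[of 0] eventually_good[of "int k"]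
  proof eventually_elim
    case (elim s)
    have eq: "wp (Suc k) s = wp k s - ?\<kappa> / s * (wp k s * ep (int k) s + ?\<tau> * wp k s)"
      unfolding ypm_Suc ypm_eq(1)[OF elim] ..
    have "s \<noteq> 0" using elim(1) by (simp add: good_def)
    then show ?case unfolding eq by (simp add: field_simps)
  qed
  ultimately have "((\<lambda>s. s ^ Suc k * wp (Suc k) s) \<longlongrightarrow> l * (0 - ?\<kappa> * (0 + ?\<tau>))) (at_right 0)"
    by (rule Lim_transform_eventually)
  moreover have "l * (0 - ?\<kappa> * (0 + ?\<tau>)) \<noteq> 0"
    using l(1) \<tau>_pos[of "int k"] \<kappa>_pos[of "int k + 1"] by simp
  ultimately show ?case by blast
qed

text \<open>The transfer matrix has determinant 1, so the second eigenvector shrinks as fast as the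
  first one grows.\<close>

lemma ym_decay: "\<exists>l. ((\<lambda>s. ym k s / s ^ k) \<longlongrightarrow> l) (at_right 0)"
proof -
  obtain l where l: "l \<noteq> 0" "((\<lambda>s. s ^ k * wp k s) \<longlongrightarrow> l) (at_right 0)" using wp_growth by blast
  obtain m0 where m0: "(em 0 \<longlongrightarrow> m0) (at_right 0)" using tendsto_em by blast
  obtain mk where mk: "(em (int k) \<longlongrightarrow> mk) (at_right 0)" using tendsto_em by blast
  have "((\<lambda>s. (ep 0 s * em 0 s - 1) / ((ep (int k) s * em (int k) s - 1) * (s ^ k * wp k s)))
      \<longlongrightarrow> (0 * m0 - 1) / ((0 * mk - 1) * l)) (at_right 0)"
    using l(1) by (intro tendsto_intros tendsto_ep m0 mk l(2)) auto
  moreover have "eventually (\<lambda>s. (ep 0 s * em 0 s - 1) / ((ep (int k) s * em (int k) s - 1) * (s ^ k * wp k s)) = ym k s / s ^ k) (at_right 0)"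
    using eventually_good[of 0] eventually_good[of "int k"]
  proof eventually_elim
    case (elim s)
    have s: "s \<noteq> 0" and e: "ep (int k) s * em (int k) s - 1 \<noteq> 0" "ep 0 s * em 0 s - 1 \<noteq> 0"
      using elim by (auto simp: good_def)
    have "yp k s * wm k s - ym k s * wp k s
      = (poly (b11 k) (1 / s) * poly (b22 k) (1 / s) - poly (b12 k) (1 / s) * poly (b21 k) (1 / s)) * (ep 0 s * em 0 s - 1)"
      by (simp add: yp_def wm_def ym_def wp_def algebra_simps)
    then have eq: "(wp k s * ym k s) * (ep (int k) s * em (int k) s - 1) = ep 0 s * em 0 s - 1"
      unfolding b_det ypm_eq[OF elim] by (simp add: algebra_simps)
    then have "wp k s \<noteq> 0" using e by auto
    then show ?case unfolding eq[symmetric] using s e by simp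
  qed
  ultimately have "((\<lambda>s. ym k s / s ^ k) \<longlongrightarrow> (0 * m0 - 1) / ((0 * mk - 1) * l)) (at_right 0)"
    by (rule Lim_transform_eventually)
  then show ?thesis by blast
qed

text \<open>The eigenvectors converge to independent vectors, so a row with limits on both converges
  itself; being polynomial in \<open>1 / s\<close>, it is constant.\<close>

lemma row_limit:
  assumes "\<And>s. good 0 s \<Longrightarrow> good k s \<Longrightarrow> poly Y1 (1 / s) * ep 0 s + poly Y2 (1 / s) = A s"
    and "\<And>s. good 0 s \<Longrightarrow> good k s \<Longrightarrow> poly Y1 (1 / s) + poly Y2 (1 / s) * em 0 s = B s"
    and A: "(A \<longlongrightarrow> lA) (at_right 0)" and B: "(B \<longlongrightarrow> lB) (at_right 0)"
  shows "poly Y1 z = poly Y1 0" "poly Y2 z = poly Y2 0"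
proof -
  obtain m0 where m0: "(em 0 \<longlongrightarrow> m0) (at_right 0)" using tendsto_em by blast
  have inv: "filterlim (\<lambda>y::real. 1 / y) (at_right 0) at_top"
    using filterlim_inverse_at_right_top by (simp add: inverse_eq_divide)
  have trans: "(poly Y \<longlongrightarrow> l) at_top" if lim: "((\<lambda>s. poly Y (1 / s)) \<longlongrightarrow> l) (at_right 0)" for Y :: "real poly" and l :: real
  proof -
    have "((\<lambda>y. poly Y (1 / (1 / y))) \<longlongrightarrow> l) at_top"
      by (rule filterlim_compose[OF lim inv])
    then show ?thesis by simp
  qed
  have "((\<lambda>s. (B s - em 0 s * A s) / (1 - ep 0 s * em 0 s)) \<longlongrightarrow> (lB - m0 * lA) / (1 - 0 * m0)) (at_right 0)"
    by (intro tendsto_intros A B m0 tendsto_ep) simp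
  moreover have "eventually (\<lambda>s. (B s - em 0 s * A s) / (1 - ep 0 s * em 0 s) = poly Y1 (1 / s)) (at_right 0)"
    using eventually_good[of 0] eventually_good[of k]
  proof eventually_elim
    case (elim s)
    have "1 - ep 0 s * em 0 s \<noteq> 0" using elim by (auto simp: good_def)
    then show ?case
      unfolding assms(1)[OF elim, symmetric] assms(2)[OF elim, symmetric] by (simp add: field_simps)
  qed
  ultimately have Y1: "((\<lambda>s. poly Y1 (1 / s)) \<longlongrightarrow> (lB - m0 * lA) / (1 - 0 * m0)) (at_right 0)"
    by (rule Lim_transform_eventually)
  have "((\<lambda>s. A s - poly Y1 (1 / s) * ep 0 s) \<longlongrightarrow> lA - ((lB - m0 * lA) / (1 - 0 * m0)) * 0) (at_right 0)"
    by (intro tendsto_intros A Y1 tendsto_ep)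
  moreover have "eventually (\<lambda>s. A s - poly Y1 (1 / s) * ep 0 s = poly Y2 (1 / s)) (at_right 0)"
    using eventually_good[of 0] eventually_good[of k]
  proof eventually_elim
    case (elim s)
    then show ?case unfolding assms(1)[OF elim, symmetric] by simp
  qed
  ultimately have Y2: "((\<lambda>s. poly Y2 (1 / s)) \<longlongrightarrow> lA - ((lB - m0 * lA) / (1 - 0 * m0)) * 0) (at_right 0)"
    by (rule Lim_transform_eventually)
  show "poly Y1 z = poly Y1 0" by (rule poly_tendsto_imp_const[OF trans[OF Y1]])
  show "poly Y2 z = poly Y2 0" by (rule poly_tendsto_imp_const[OF trans[OF Y2]])
qed

text \<open>The matrix \<open>b\<close> over \<open>m\<close> bounces is \<open>(p + r L) / s\<^sup>m\<close>, up to a shear by \<open>c\<close>.\<close>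

definition transfer :: "nat \<Rightarrow> real \<Rightarrow> real \<Rightarrow> real \<Rightarrow> real \<Rightarrow> bool" where
  "transfer m s p r c \<longleftrightarrow>
    poly (b11 m) (1 / s) = (p + r * V 0 s + c * (r * W 0 s)) / s ^ m \<and>
    poly (b12 m) (1 / s) = (r * U 0 s + c * (p - r * V 0 s)) / s ^ m \<and>
    poly (b21 m) (1 / s) = r * W 0 s / s ^ m \<and>
    poly (b22 m) (1 / s) = (p - r * V 0 s) / s ^ m"

text \<open>Let \<open>P = (\<alpha> + \<beta> L) / s^m\<close>, of determinant 1 by
  \<open>pell\<close>, and \<open>Y = b P^(-1)\<close>. By \<open>branch\<close> the value
  \<open>\<alpha> + \<beta> wr\<close> tends to twice \<open>\<alpha>\<close> at 0, so
  \<open>P\<close> grows like \<open>s^(-m)\<close> on \<open>(ep, 1)\<close> and decays like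
  \<open>s^m\<close> on \<open>(1, em)\<close>, as \<open>b\<close> does. Hence \<open>Y\<close> has
  a limit, is constant, and its value at \<open>1 / s = 0\<close> is a shear.\<close>

lemma transfer_form:
  assumes pell: "\<And>s. (poly \<alpha> s)\<^sup>2 + (poly \<beta> s)\<^sup>2 * poly R s = s ^ (2 * m)"
    and deg: "degree \<alpha> \<le> m" "degree \<beta> + CARD('n) \<le> m" and lead: "coeff \<alpha> m = 1"
    and nz: "poly \<alpha> 0 \<noteq> 0" and branch: "poly \<alpha> 0 = poly \<beta> 0 * wr 0"
  shows "\<exists>c. \<forall>s. s \<noteq> 0 \<longrightarrow> transfer m s (poly \<alpha> s) (poly \<beta> s) c"
proof -
  let ?V = "qpoly a (q 0) (u 0)" and ?U = "upoly a (q 0)" and ?W = "qpoly a (u 0) (u 0)"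
  define P11 P12 P21 P22 :: "real poly" where P_def: "P11 = \<alpha> + \<beta> * ?V" "P12 = \<beta> * ?U" "P21 = \<beta> * ?W" "P22 = \<alpha> - \<beta> * ?V"
  have bV: "degree (\<beta> * qpoly a x y) < m" for x y
    using degree_mult_le[of \<beta> "qpoly a x y"] degree_qpoly[of a x y] deg(2) n_pos by linarith
  have degP: "degree P11 \<le> m" "degree P12 \<le> m" "degree P21 \<le> m" "degree P22 \<le> m"
    unfolding P_def using deg bV degree_mult_le[of \<beta> ?U] degree_upoly[of a "q 0"]
    by (auto intro!: degree_add_le degree_diff_le simp: less_imp_le)
  \<comment> \<open>\<open>\<beta>\<close> times an entry of degree below \<open>n\<close> has
    degree below \<open>m\<close>; so at \<open>1 / s = 0\<close> the matrix \<open>P\<close> is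
    upper unipotent, like \<open>b\<close>.\<close>
  have leadP: "coeff P11 m = 1" "coeff P21 m = 0" "coeff P22 m = 1"
    unfolding P_def using bV lead by (simp_all add: coeff_eq_0)
  define r :: "real poly \<Rightarrow> real poly" where "r = reflect_at m"
  have r: "poly (r P11) (1 / s) = poly P11 s / s ^ m" "poly (r P12) (1 / s) = poly P12 s / s ^ m"
    "poly (r P21) (1 / s) = poly P21 s / s ^ m" "poly (r P22) (1 / s) = poly P22 s / s ^ m" if "s \<noteq> 0" for s
    unfolding r_def using poly_reflect_at degP that by blast+
  have r0: "poly (r P11) 0 = 1" "poly (r P21) 0 = 0" "poly (r P22) 0 = 1"
    unfolding r_def poly_reflect_at_0 by (rule leadP)+
  have detP: "poly P11 s * poly P22 s - poly P12 s * poly P21 s = s ^ (2 * m)" for s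
  proof -
    have "poly P11 s * poly P22 s - poly P12 s * poly P21 s
        = (poly \<alpha> s)\<^sup>2 - (poly \<beta> s)\<^sup>2 * ((V 0 s)\<^sup>2 + U 0 s * W 0 s)"
      by (simp add: P_def algebra_simps power2_eq_square)
    then show ?thesis unfolding mumford pell[symmetric] by simp
  qed
  \<comment> \<open>\<open>b\<close> times the adjugate of \<open>P\<close>, which is its
    inverse.\<close>
  define Y11 Y12 Y21 Y22 where Y_def:
    "Y11 = b11 m * r P22 - b12 m * r P21" "Y12 = b12 m * r P11 - b11 m * r P12"
    "Y21 = b21 m * r P22 - b22 m * r P21" "Y22 = b22 m * r P11 - b21 m * r P12"
  define A B where AB_def: "A s = s ^ m * wp m s / (poly \<alpha> s + poly \<beta> s * wr s)"
    "B s = (poly \<alpha> s + poly \<beta> s * wr s) * (ym m s / s ^ m)" for s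
  \<comment> \<open>The adjugate of \<open>P\<close> acts on the eigenvectors of the Lax matrix by \<open>\<alpha> - \<beta> wr\<close> and \<open>\<alpha> + \<beta> wr\<close>.\<close>
  have adj_p: "poly P22 s * ep 0 s - poly P12 s = (poly \<alpha> s - poly \<beta> s * wr s) * ep 0 s"
    "poly P11 s - poly P21 s * ep 0 s = poly \<alpha> s - poly \<beta> s * wr s" if "good 0 s" for s
  proof -
    have "poly P22 s * ep 0 s - poly P12 s = poly \<alpha> s * ep 0 s - poly \<beta> s * (V 0 s * ep 0 s + U 0 s * 1)"
      by (simp add: P_def algebra_simps)
    then show "poly P22 s * ep 0 s - poly P12 s = (poly \<alpha> s - poly \<beta> s * wr s) * ep 0 s"
      unfolding ep_eigen[OF that] by (simp add: algebra_simps)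
    have "poly P11 s - poly P21 s * ep 0 s = poly \<alpha> s - poly \<beta> s * (W 0 s * ep 0 s - V 0 s * 1)"
      by (simp add: P_def algebra_simps)
    then show "poly P11 s - poly P21 s * ep 0 s = poly \<alpha> s - poly \<beta> s * wr s"
      unfolding ep_eigen[OF that] by simp
  qed
  have adj_m: "poly P22 s - poly P12 s * em 0 s = poly \<alpha> s + poly \<beta> s * wr s"
    "poly P11 s * em 0 s - poly P21 s = (poly \<alpha> s + poly \<beta> s * wr s) * em 0 s" if "good 0 s" for s
  proof -
    have "poly P22 s - poly P12 s * em 0 s = poly \<alpha> s - poly \<beta> s * (V 0 s * 1 + U 0 s * em 0 s)"
      by (simp add: P_def algebra_simps)
    then show "poly P22 s - poly P12 s * em 0 s = poly \<alpha> s + poly \<beta> s * wr s"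
      unfolding em_eigen[OF that] by simp
    have "poly P11 s * em 0 s - poly P21 s = poly \<alpha> s * em 0 s - poly \<beta> s * (W 0 s * 1 - V 0 s * em 0 s)"
      by (simp add: P_def algebra_simps)
    then show "poly P11 s * em 0 s - poly P21 s = (poly \<alpha> s + poly \<beta> s * wr s) * em 0 s"
      unfolding em_eigen[OF that] by (simp add: algebra_simps)
  qed
  have norm: "(poly \<alpha> s - poly \<beta> s * wr s) * (poly \<alpha> s + poly \<beta> s * wr s) = s ^ m * s ^ m" if "good 0 s" for s
  proof -
    have "(poly \<alpha> s - poly \<beta> s * wr s) * (poly \<alpha> s + poly \<beta> s * wr s) = (poly \<alpha> s)\<^sup>2 - (poly \<beta> s)\<^sup>2 * (wr s)\<^sup>2"
      by (simp add: algebra_simps power2_eq_square)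
    also have "(wr s)\<^sup>2 = - poly R s" using that by (simp add: wr_def good_def)
    finally show ?thesis using pell[of s] by (simp add: mult_2 power_add)
  qed
  have quot: "(poly \<alpha> s - poly \<beta> s * wr s) / s ^ m = s ^ m / (poly \<alpha> s + poly \<beta> s * wr s)" if "good 0 s" for s
  proof -
    have s: "s \<noteq> 0" using that by (simp add: good_def)
    then have "poly \<alpha> s + poly \<beta> s * wr s \<noteq> 0" using norm[OF that] by auto
    then show ?thesis using norm[OF that] s by (simp add: frac_eq_eq)
  qed
  have row_p: "poly (b * r P22 - b' * r P21) (1 / s) * ep 0 s + poly (b' * r P11 - b * r P12) (1 / s)
      = s ^ m / (poly \<alpha> s + poly \<beta> s * wr s) * (poly b (1 / s) * ep 0 s + poly b' (1 / s))"
    if g: "good 0 s" for b b' s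
  proof -
    have s: "s \<noteq> 0" using g by (simp add: good_def)
    let ?l = "(poly \<alpha> s - poly \<beta> s * wr s) / s ^ m"
    have 1: "poly (r P22) (1 / s) * ep 0 s - poly (r P12) (1 / s) = ?l * ep 0 s"
      using adj_p(1)[OF g] unfolding r[OF s] by (simp add: diff_divide_distrib[symmetric])
    have 2: "poly (r P11) (1 / s) - poly (r P21) (1 / s) * ep 0 s = ?l"
      using adj_p(2)[OF g] unfolding r[OF s] by (simp add: diff_divide_distrib[symmetric])
    have "poly (b * r P22 - b' * r P21) (1 / s) * ep 0 s + poly (b' * r P11 - b * r P12) (1 / s)
        = poly b (1 / s) * (poly (r P22) (1 / s) * ep 0 s - poly (r P12) (1 / s))
          + poly b' (1 / s) * (poly (r P11) (1 / s) - poly (r P21) (1 / s) * ep 0 s)"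
      by (simp add: algebra_simps)
    then show ?thesis unfolding 1 2 quot[OF g] by (simp add: algebra_simps)
  qed
  have row_m: "poly (b * r P22 - b' * r P21) (1 / s) + poly (b' * r P11 - b * r P12) (1 / s) * em 0 s
      = (poly \<alpha> s + poly \<beta> s * wr s) / s ^ m * (poly b (1 / s) + poly b' (1 / s) * em 0 s)"
    if g: "good 0 s" for b b' s
  proof -
    have s: "s \<noteq> 0" using g by (simp add: good_def)
    let ?l = "(poly \<alpha> s + poly \<beta> s * wr s) / s ^ m"
    have 1: "poly (r P22) (1 / s) - poly (r P12) (1 / s) * em 0 s = ?l"
      using adj_m(1)[OF g] unfolding r[OF s] by (simp add: diff_divide_distrib[symmetric])
    have 2: "poly (r P11) (1 / s) * em 0 s - poly (r P21) (1 / s) = ?l * em 0 s"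
      using adj_m(2)[OF g] unfolding r[OF s] by (simp add: diff_divide_distrib[symmetric])
    have "poly (b * r P22 - b' * r P21) (1 / s) + poly (b' * r P11 - b * r P12) (1 / s) * em 0 s
        = poly b (1 / s) * (poly (r P22) (1 / s) - poly (r P12) (1 / s) * em 0 s)
          + poly b' (1 / s) * (poly (r P11) (1 / s) * em 0 s - poly (r P21) (1 / s))"
      by (simp add: algebra_simps)
    then show ?thesis unfolding 1 2 by (simp add: algebra_simps)
  qed
  have Yp: "poly Y11 (1 / s) * ep 0 s + poly Y12 (1 / s) = A s * ep (int m) s"
    "poly Y21 (1 / s) * ep 0 s + poly Y22 (1 / s) = A s" if g: "good 0 s" "good (int m) s" for s
    unfolding Y_def row_p[OF g(1)] yp_def[symmetric] wp_def[symmetric] ypm_eq(1)[OF g] by (simp_all add: AB_def)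
  have Ym: "poly Y11 (1 / s) + poly Y12 (1 / s) * em 0 s = B s"
    "poly Y21 (1 / s) + poly Y22 (1 / s) * em 0 s = B s * em (int m) s" if g: "good 0 s" "good (int m) s" for s
    unfolding Y_def row_m[OF g(1)] ym_def[symmetric] wm_def[symmetric] ypm_eq(2)[OF g] by (simp_all add: AB_def)
  have lim: "((\<lambda>s. poly \<alpha> s + poly \<beta> s * wr s) \<longlongrightarrow> 2 * poly \<alpha> 0) (at_right 0)"
  proof -
    have "((\<lambda>s. poly \<alpha> s + poly \<beta> s * wr s) \<longlongrightarrow> poly \<alpha> 0 + poly \<beta> 0 * wr 0) (at_right 0)"
      by (intro tendsto_intros tendsto_poly_at_right tendsto_wr)
    then show ?thesis using branch by simp
  qed
  obtain l1 where "((\<lambda>s. s ^ m * wp m s) \<longlongrightarrow> l1) (at_right 0)" using wp_growth by blast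
  then have limA: "(A \<longlongrightarrow> l1 / (2 * poly \<alpha> 0)) (at_right 0)"
    unfolding AB_def[abs_def] using nz by (intro tendsto_divide lim) auto
  obtain l2 where "((\<lambda>s. ym m s / s ^ m) \<longlongrightarrow> l2) (at_right 0)" using ym_decay by blast
  then have limB: "(B \<longlongrightarrow> 2 * poly \<alpha> 0 * l2) (at_right 0)"
    unfolding AB_def[abs_def] by (intro tendsto_mult lim)
  obtain mm where mm: "(em (int m) \<longlongrightarrow> mm) (at_right 0)" using tendsto_em by blast
  have Yc: "poly Y11 z = poly Y11 0" "poly Y12 z = poly Y12 0" "poly Y21 z = poly Y21 0" "poly Y22 z = poly Y22 0" for z
    using row_limit[OF Yp(1) Ym(1) tendsto_mult[OF limA tendsto_ep] limB]
      row_limit[OF Yp(2) Ym(2) limA tendsto_mult[OF limB mm]] by blast+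
  have Y0: "poly Y11 0 = 1" "poly Y21 0 = 0" "poly Y22 0 = 1"
    by (simp_all add: Y_def r0 b_at_0)
  show ?thesis
  proof (intro exI[of _ "poly Y12 0"] allI impI)
    fix s :: real assume s: "s \<noteq> 0"
    define B11 B12 B21 B22 where B_def: "B11 = poly (b11 m) (1 / s)" "B12 = poly (b12 m) (1 / s)"
      "B21 = poly (b21 m) (1 / s)" "B22 = poly (b22 m) (1 / s)"
    define Q11 Q12 Q21 Q22 where Q_def: "Q11 = poly P11 s / s ^ m" "Q12 = poly P12 s / s ^ m"
      "Q21 = poly P21 s / s ^ m" "Q22 = poly P22 s / s ^ m"
    define c where "c = poly Y12 0"
    have "Q11 * Q22 - Q12 * Q21 = (poly P11 s * poly P22 s - poly P12 s * poly P21 s) / (s ^ m * s ^ m)"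
      by (simp add: Q_def diff_divide_distrib)
    also have "\<dots> = 1" unfolding detP using s by (simp add: mult_2 power_add)
    finally have det: "Q11 * Q22 - Q12 * Q21 = 1" .
    have Y: "B11 * Q22 - B12 * Q21 = 1" "B12 * Q11 - B11 * Q12 = c"
      "B21 * Q22 - B22 * Q21 = 0" "B22 * Q11 - B21 * Q12 = 1"
      using Yc[of "1 / s"] unfolding Y0 by (simp_all add: Y_def r[OF s] B_def Q_def c_def)
    \<comment> \<open>The inserted determinant undoes the adjugate: \<open>b = Y P\<close>.\<close>
    have "B11 = B11 * (Q11 * Q22 - Q12 * Q21)" "B12 = B12 * (Q11 * Q22 - Q12 * Q21)"
      "B21 = B21 * (Q11 * Q22 - Q12 * Q21)" "B22 = B22 * (Q11 * Q22 - Q12 * Q21)"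
      unfolding det by simp_all
    then have "B11 = (B11 * Q22 - B12 * Q21) * Q11 + (B12 * Q11 - B11 * Q12) * Q21"
      "B12 = (B11 * Q22 - B12 * Q21) * Q12 + (B12 * Q11 - B11 * Q12) * Q22"
      "B21 = (B21 * Q22 - B22 * Q21) * Q11 + (B22 * Q11 - B21 * Q12) * Q21"
      "B22 = (B21 * Q22 - B22 * Q21) * Q12 + (B22 * Q11 - B21 * Q12) * Q22"
      by (simp_all add: algebra_simps)
    then have "B11 = Q11 + c * Q21" "B12 = Q12 + c * Q22" "B21 = Q21" "B22 = Q22"
      unfolding Y by simp_all
    then show "transfer m s (poly \<alpha> s) (poly \<beta> s) (poly Y12 0)"
      unfolding transfer_def B_def Q_def c_def by (simp add: P_def add_divide_distrib)
  qed
qed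

end

section \<open>Closing of the trajectory\<close>

context billiard begin

text \<open>On the kernel of the Lax matrix the summand with \<open>r\<close> acts as 0, leaving the
  scalar \<open>p / s^m\<close> and the shear.\<close>

lemma kernel_transfer:
  assumes sol: "solution s y w" and s: "s \<noteq> 0"
    and ker: "V 0 s * y 0 + U 0 s * w 0 = 0" "W 0 s * y 0 - V 0 s * w 0 = 0"
    and b: "transfer m s p r c"
  shows "y (int m) = p / s ^ m * (y 0 + c * w 0)" "w (int m) = p / s ^ m * w 0"
proof -
  have lin: "x / e * y' + z / e * w' = (x * y' + z * w') / e" for x z y' w' e :: real
    by (simp add: add_divide_distrib)
  have "y (int m) = (p + r * V 0 s + c * (r * W 0 s)) / s ^ m * y 0 + (r * U 0 s + c * (p - r * V 0 s)) / s ^ m * w 0"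
    using solution_fund[OF sol, of m] b unfolding transfer_def by (simp only:)
  also have "\<dots> = ((p + r * V 0 s + c * (r * W 0 s)) * y 0 + (r * U 0 s + c * (p - r * V 0 s)) * w 0) / s ^ m"
    by (rule lin)
  also have "(p + r * V 0 s + c * (r * W 0 s)) * y 0 + (r * U 0 s + c * (p - r * V 0 s)) * w 0
      = p * (y 0 + c * w 0) + r * (V 0 s * y 0 + U 0 s * w 0) + c * r * (W 0 s * y 0 - V 0 s * w 0)"
    by (simp add: algebra_simps)
  finally show "y (int m) = p / s ^ m * (y 0 + c * w 0)" unfolding ker by simp
  have "w (int m) = r * W 0 s / s ^ m * y 0 + (p - r * V 0 s) / s ^ m * w 0"
    using solution_fund[OF sol, of m] b unfolding transfer_def by (simp only:)
  also have "\<dots> = (r * W 0 s * y 0 + (p - r * V 0 s) * w 0) / s ^ m"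
    by (rule lin)
  also have "r * W 0 s * y 0 + (p - r * V 0 s) * w 0 = p * w 0 + r * (W 0 s * y 0 - V 0 s * w 0)"
    by (simp add: algebra_simps)
  finally show "w (int m) = p / s ^ m * w 0" unfolding ker by simp
qed

text \<open>At \<open>a i\<close> the Lax matrix is a multiple of the column
  \<open>(q_i, u_i)\<close> times the row \<open>(u_i, - q_i)\<close>, and the row annihilates the
  column.\<close>

lemma coordinate_kernel:
  "V 0 (a i) * q 0 $ i + U 0 (a i) * u 0 $ i = 0" "W 0 (a i) * q 0 $ i - V 0 (a i) * u 0 $ i = 0"
  by (simp_all add: upoly_def poly_qpoly_at)

lemma Csol_kernel:
  assumes "c \<in> C"
  shows "V 0 c * yC c 0 + U 0 c * wC c 0 = 0" "W 0 c * yC c 0 - V 0 c * wC c 0 = 0"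
  unfolding Csol(4-6)[OF assms] by (simp_all add: power2_eq_square)

text \<open>Once the shear is excluded, the transfer matrix acts on kernel vectors by the scalar
  \<open>\<alpha> / s^m\<close>; at a root of \<open>\<beta>\<close> it is this scalar on all
  solutions.\<close>

lemma closing_branch:
  assumes pell: "\<And>s. (poly \<alpha> s)\<^sup>2 + (poly \<beta> s)\<^sup>2 * poly R s = s ^ (2 * m)"
    and deg: "degree \<alpha> \<le> m" "degree \<beta> + CARD('n) \<le> m" and lead: "coeff \<alpha> m = 1"
    and nz: "poly \<alpha> 0 \<noteq> 0" and branch: "poly \<alpha> 0 = poly \<beta> 0 * wr 0"
    and \<sigma>: "\<sigma> = 1 \<or> \<sigma> = -1" "\<And>i. poly \<alpha> (a i) = \<sigma> * a i ^ m"
  shows "q (int m) = \<sigma> *\<^sub>R q 0 \<and> u (int m) = \<sigma> *\<^sub>R u 0"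
    and "c \<in> C \<Longrightarrow> yC c (int m) = poly \<alpha> c / c ^ m * yC c 0 \<and> wC c (int m) = poly \<alpha> c / c ^ m * wC c 0"
    and "r \<noteq> 0 \<Longrightarrow> poly \<beta> r = 0 \<Longrightarrow> solution r y w \<Longrightarrow>
      y (int m) = poly \<alpha> r / r ^ m * y 0 \<and> w (int m) = poly \<alpha> r / r ^ m * w 0"
proof -
  obtain d where b: "\<And>s. s \<noteq> 0 \<Longrightarrow> transfer m s (poly \<alpha> s) (poly \<beta> s) d"
    using transfer_form[OF pell deg lead nz branch] by blast
  have "q (int m) $ i = \<sigma> * (q 0 $ i + d * u 0 $ i)" "u (int m) $ i = \<sigma> * u 0 $ i" for i
    using kernel_transfer[OF coordinate_solution[of i] a_nz coordinate_kernel b[OF a_nz[of i]]] a_nz[of i]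
    by (simp_all add: \<sigma>(2))
  then have qm: "q (int m) = \<sigma> *\<^sub>R (q 0 + d *\<^sub>R u 0)" and um: "u (int m) = \<sigma> *\<^sub>R u 0"
    by (simp_all add: vec_eq_iff)
  have \<sigma>\<sigma>': "\<sigma> * (\<sigma> * z) = z" for z using \<sigma>(1) by auto
  let ?Q = "quadric_form a 0"
  \<comment> \<open>\<open>q 0 + d u 0\<close> lies on the ellipsoid, and the direction \<open>u 0\<close> points inwards there.\<close>
  have "d = 0"
  proof (rule ccontr)
    assume d: "d \<noteq> 0"
    have "1 = ?Q (q 0 + d *\<^sub>R u 0) (q 0 + d *\<^sub>R u 0)"
      using q_on[of "int m"] unfolding qm by (simp add: quadric_form_linear(3,4) \<sigma>\<sigma>')
    also have "\<dots> = 1 + d * (2 * ?Q (q 0) (u 0) + d * ?Q (u 0) (u 0))"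
      using q_on[of 0] quadric_form_commute[of a 0 "u 0" "q 0"]
      by (simp add: quadric_form_linear algebra_simps)
    finally have "d * ?Q (u 0) (u 0) = - 2 * ?Q (q 0) (u 0)" using d by simp
    then have "d * ?Q (u 0) (u 0) = \<tau> 0 * ?Q (u 0) (u 0)" using qqu[of 0] by simp
    then have "d = \<tau> 0" using quu_pos[of 0] by simp
    then have "q 0 + d *\<^sub>R u 0 = q (0 + 1)" unfolding q_next by simp
    then have "?Q (q 0 + d *\<^sub>R u 0) (u 0) > 0" using outward[of 0] by simp
    moreover have "?Q (q 0 + d *\<^sub>R u 0) (u 0) < 0"
      using inward[of "int m"] unfolding qm um by (simp add: quadric_form_linear(3,4) \<sigma>\<sigma>')
    ultimately show False by simp
  qed
  note b0 = b[unfolded this]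
  show "q (int m) = \<sigma> *\<^sub>R q 0 \<and> u (int m) = \<sigma> *\<^sub>R u 0" using qm um \<open>d = 0\<close> by simp
  show "yC c (int m) = poly \<alpha> c / c ^ m * yC c 0 \<and> wC c (int m) = poly \<alpha> c / c ^ m * wC c 0" if c: "c \<in> C"
  proof -
    have c0: "c \<noteq> 0" using C_pos[OF c] by simp
    show ?thesis using kernel_transfer[OF Csol(2)[OF c] c0 Csol_kernel[OF c] b0[OF c0]] by simp
  qed
  show "y (int m) = poly \<alpha> r / r ^ m * y 0 \<and> w (int m) = poly \<alpha> r / r ^ m * w 0"
    if "r \<noteq> 0" "poly \<beta> r = 0" "solution r y w"
    using solution_fund[OF that(3), of m] b0[OF that(1)] that(2) by (simp add: transfer_def)
qed

end

text \<open>
  If \<open>\<alpha>\<^sup>2 + \<beta>\<^sup>2 R = s\<^bsup>2m\<^esup>\<close>, then \<open>\<alpha> + \<beta> L\<close> divided by \<open>s\<^sup>m\<close> has determinant 1 and turns out to be the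
  transfer matrix over \<open>m\<close> bounces. Since it commutes with \<open>L\<close>, the trajectory closes up to the sign \<open>\<sigma>\<close>.
\<close>

locale closing_billiard = billiard a lam q
  for a :: "'n::{finite,linorder} \<Rightarrow> real" and lam :: "nat \<Rightarrow> real" and q :: "int \<Rightarrow> (real, 'n) vec" +
  fixes m :: nat and \<alpha> \<beta> :: "real poly" and \<sigma> :: real
  assumes pell: "(poly \<alpha> s)\<^sup>2 + (poly \<beta> s)\<^sup>2 * poly R s = s ^ (2 * m)"
    and deg_\<alpha>: "degree \<alpha> \<le> m" and deg_\<beta>: "degree \<beta> + CARD('n) \<le> m" and lead_\<alpha>: "coeff \<alpha> m = 1"
    and \<alpha>_nz: "poly \<alpha> 0 \<noteq> 0"
    and \<sigma>: "\<sigma> = 1 \<or> \<sigma> = -1" and \<alpha>_a: "poly \<alpha> (a i) = \<sigma> * a i ^ m"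
begin

lemma m_pos: "m > 0"
  using deg_\<beta> n_pos by linarith

text \<open>At 0, \<open>pell\<close> gives \<open>\<alpha> = \<plusminus> \<beta> wr\<close> only.
  Since \<open>\<beta>\<close> enters \<open>pell\<close> squared, its sign can be adapted to the
  branch required by \<open>transfer_form\<close>.\<close>

lemma closing_0:
  shows "q (int m) = \<sigma> *\<^sub>R q 0 \<and> u (int m) = \<sigma> *\<^sub>R u 0"
    and "c \<in> C \<Longrightarrow> yC c (int m) = poly \<alpha> c / c ^ m * yC c 0 \<and> wC c (int m) = poly \<alpha> c / c ^ m * wC c 0"
    and "r \<noteq> 0 \<Longrightarrow> poly \<beta> r = 0 \<Longrightarrow> solution r y w \<Longrightarrow>
      y (int m) = poly \<alpha> r / r ^ m * y 0 \<and> w (int m) = poly \<alpha> r / r ^ m * w 0"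
proof -
  have "(poly \<alpha> 0)\<^sup>2 = (poly \<beta> 0 * wr 0)\<^sup>2"
  proof -
    have wr: "(wr 0)\<^sup>2 = - poly R 0"
      using wr_0(1)[of 0] mumford[of 0 0] by (simp add: U_0)
    show ?thesis
      unfolding power_mult_distrib wr
      using pell[of 0] m_pos by (simp add: power_0_left eq_neg_iff_add_eq_0)
  qed
  then consider "poly \<alpha> 0 = poly \<beta> 0 * wr 0" | "poly \<alpha> 0 = poly (- \<beta>) 0 * wr 0"
    by (auto simp: power2_eq_iff)
  then have "\<exists>\<beta>'. (\<beta>' = \<beta> \<or> \<beta>' = - \<beta>) \<and> poly \<alpha> 0 = poly \<beta>' 0 * wr 0" by cases blast+
  then obtain \<beta>' where \<beta>': "\<beta>' = \<beta> \<or> \<beta>' = - \<beta>" "poly \<alpha> 0 = poly \<beta>' 0 * wr 0" by blast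
  have pell': "(poly \<alpha> s)\<^sup>2 + (poly \<beta>' s)\<^sup>2 * poly R s = s ^ (2 * m)" for s
    using pell[of s] \<beta>'(1) by auto
  have deg': "degree \<beta>' + CARD('n) \<le> m" using deg_\<beta> \<beta>'(1) by auto
  note * = closing_branch[OF pell' deg_\<alpha> deg' lead_\<alpha> \<alpha>_nz \<beta>'(2) \<sigma> \<alpha>_a]
  show "q (int m) = \<sigma> *\<^sub>R q 0 \<and> u (int m) = \<sigma> *\<^sub>R u 0" by (rule *(1))
  show "c \<in> C \<Longrightarrow> yC c (int m) = poly \<alpha> c / c ^ m * yC c 0 \<and> wC c (int m) = poly \<alpha> c / c ^ m * wC c 0"
    by (rule *(2))
  show "r \<noteq> 0 \<Longrightarrow> poly \<beta> r = 0 \<Longrightarrow> solution r y w \<Longrightarrow>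
      y (int m) = poly \<alpha> r / r ^ m * y 0 \<and> w (int m) = poly \<alpha> r / r ^ m * w 0"
    using *(3)[of r y w] \<beta>'(1) by auto
qed

text \<open>\<open>R\<close> depends on the parameters alone, so all hypotheses survive renumbering
  the bounces, and the statement at bounce 0 applies to each bounce.\<close>

lemma closing: "q (k + int m) = \<sigma> *\<^sub>R q k" "u (k + int m) = \<sigma> *\<^sub>R u k"
proof -
  interpret shifted: billiard a lam "\<lambda>i. q (i + k)"
  proof
    show "billiard_trajectory a (\<lambda>i. q (i + k))"
      using traj unfolding billiard_trajectory_def
      by (metis (no_types, lifting) add.assoc add.commute add_diff_eq diff_add_eq)
    show "has_caustics a lam (\<lambda>i. q (i + k))"
      using caustics unfolding has_caustics_def by (metis add.assoc add.commute)
  qed (use a_pos a_mono lam_inj lam_a in auto)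
  interpret shifted: closing_billiard a lam "\<lambda>i. q (i + k)" m \<alpha> \<beta> \<sigma>
    by unfold_locales (use pell deg_\<alpha> deg_\<beta> lead_\<alpha> \<alpha>_nz \<sigma> \<alpha>_a in auto)
  have "shifted.u i = u (i + k)" for i by (simp add: shifted.u_def u_def add.commute add.left_commute)
  then show "q (k + int m) = \<sigma> *\<^sub>R q k" "u (k + int m) = \<sigma> *\<^sub>R u k"
    using shifted.closing_0(1) by (simp_all add: add.commute)
qed

lemma \<sigma>\<sigma>: "\<sigma> * \<sigma> = 1" using \<sigma> by auto

lemma \<tau>_periodic: "\<tau> (k + int m) = \<tau> k"
proof -
  have "q (k + int m + 1) = \<sigma> *\<^sub>R q (k + 1)" using closing(1)[of "k + 1"] by (simp add: algebra_simps)
  then have "q (k + int m + 1) - q (k + int m) = \<sigma> *\<^sub>R (q (k + 1) - q k)"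
    by (simp add: closing(1) scaleR_diff_right)
  then show ?thesis using \<sigma> by (auto simp: \<tau>_def)
qed

lemma \<kappa>_periodic: "\<kappa> (k + int m) = \<kappa> k"
proof -
  have "\<nu> (k + int m) = \<sigma> *\<^sub>R \<nu> k"
    by (simp add: \<nu>_def closing(1) ellipsoid_normal_def vec_eq_iff)
  moreover have "u (k + int m - 1) = \<sigma> *\<^sub>R u (k - 1)" using closing(2)[of "k - 1"] by (simp add: algebra_simps)
  ultimately show ?thesis using \<sigma> by (auto simp: \<kappa>_def)
qed

lemma solution_shift:
  assumes "solution s y w"
  shows "solution s (\<lambda>k. y (k + int m)) (\<lambda>k. w (k + int m))"
proof -
  have "y (k + 1 + int m) = y (k + int m) + \<tau> k * w (k + int m)"
    "w (k + 1 + int m) = w (k + int m) - \<kappa> (k + 1) / s * y (k + 1 + int m)" for k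
    using solution_pos[OF assms, of "k + int m"] solution_vel[OF assms, of "k + int m"]
      \<tau>_periodic[of k] \<kappa>_periodic[of "k + 1"] by (simp_all add: algebra_simps)
  then show ?thesis by (simp add: solution_def)
qed

lemma solution_multiplier:
  assumes sol: "solution s y w" and "y (int m) = \<rho> * y 0" "w (int m) = \<rho> * w 0"
  shows "y (k + int m) = \<rho> * y k \<and> w (k + int m) = \<rho> * w k"
  using solution_unique[OF solution_shift[OF sol] solution_scale[OF sol, of \<rho>], of 0 k] assms(2,3) by simp

lemma interp_multiplier:
  fixes y :: "int \<Rightarrow> 'a::real_vector"
  assumes "\<And>k. y (k + int l) = \<rho> *\<^sub>R y k"
  shows "interp y (t + real l) = \<rho> *\<^sub>R interp y t"
proof -
  have f: "\<lfloor>t + real l\<rfloor> = \<lfloor>t\<rfloor> + int l" by linarith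
  have "y (\<lfloor>t\<rfloor> + int l + 1) = \<rho> *\<^sub>R y (\<lfloor>t\<rfloor> + 1)" using assms[of "\<lfloor>t\<rfloor> + 1"] by (simp add: algebra_simps)
  then show ?thesis
    unfolding interp_def f assms by (simp add: frac_def f algebra_simps)
qed

lemma zeros_periodic:
  assumes sol: "solution s y w" and nz: "y 0 \<noteq> 0 \<or> w 0 \<noteq> 0" and mult: "\<And>k. y (k + int m) = \<rho> * y k" and \<rho>: "\<rho> \<noteq> 0"
  shows "periodic_discrete (real m) {t. interp y t = 0}"
  unfolding periodic_discrete_def
proof (intro conjI allI)
  show "real m > 0" using m_pos by simp
  show "(t + real m \<in> {t. interp y t = 0}) = (t \<in> {t. interp y t = 0})" for t
    using interp_multiplier[of y m \<rho> t] mult \<rho> by simp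
  show "finite ({t. interp y t = 0} \<inter> {x..z})" for x z by (rule finite_zeros[OF sol nz])
qed

section \<open>Counting oscillations over \<open>m\<close> bounces\<close>

abbreviation "Z c \<equiv> {t. interp (yC c) t = 0}"

lemma C_multiplier:
  assumes "c \<in> C"
  shows "yC c (k + int m) = poly \<alpha> c / c ^ m * yC c k" "wC c (k + int m) = poly \<alpha> c / c ^ m * wC c k"
  using solution_multiplier[OF Csol(2)[OF assms], of "poly \<alpha> c / c ^ m" k] closing_0(2)[OF assms] by auto

lemma C_multiplier_nz:
  assumes "c \<in> C"
  shows "poly \<alpha> c / c ^ m \<noteq> 0"
proof -
  have "(poly \<alpha> c)\<^sup>2 = c ^ (2 * m)"
  proof -
    have "poly R c = 0" using assms finite_C by (auto simp: poly_R)
    then show ?thesis using pell[of c] by simp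
  qed
  then have "poly \<alpha> c \<noteq> 0" using C_pos[OF assms] by auto
  then show ?thesis using C_pos[OF assms] by simp
qed

lemma Z_periodic: "c \<in> C \<Longrightarrow> periodic_discrete (real m) (Z c)"
  by (rule zeros_periodic[OF Csol(2,3) C_multiplier(1) C_multiplier_nz])

text \<open>\<open>upoly\<close> is even in the point, so the elliptic coordinates do not see the
  sign \<open>\<rho>\<close>.\<close>

lemma mu_periodic:
  assumes j: "j < CARD('n)" and path: "trajectory_path q (t + L) = \<rho> *\<^sub>R trajectory_path q t" and \<rho>: "\<rho> = 1 \<or> \<rho> = -1"
  shows "mu j (t + L) = mu j t"
proof -
  have "upoly a (trajectory_path q (t + L)) = upoly a (trajectory_path q t)"
    using \<rho> upoly_minus[of a "trajectory_path q t"] by (auto simp: path)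
  then show ?thesis
    unfolding mu_def[of j "t + L"] using mu_root(3) mu_less j
    by (intro elliptic_coordinate_eq[OF a_mono]) auto
qed

lemma mu_m: "j < CARD('n) \<Longrightarrow> mu j (t + real m) = mu j t"
  by (rule mu_periodic[OF _ _ \<sigma>]) (auto simp: path_eq intro: interp_multiplier closing(1))

text \<open>The number of oscillations of \<open>mu j\<close> over \<open>m\<close> bounces, equivalently of zeros of the solutions at its turning points.\<close>

definition zc :: "nat \<Rightarrow> nat" where "zc j = period_count (real m) {t. mu j t = cs (2 * j)}"

lemma zc_pos: "j < CARD('n) \<Longrightarrow> zc j > 0"
  unfolding zc_def using m_pos mu_m by (intro mu_round_trips(3)) auto

lemma zc_odd: "j < CARD('n) \<Longrightarrow> zc j = period_count (real m) (Z (cs (2 * j + 1)))"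
  unfolding zc_def using mu_round_trips(2)[of j "real m"] m_pos mu_m mu_eq_cs_iff[of j "2 * j + 1"] by simp

lemma zc_even: "j < CARD('n) \<Longrightarrow> 0 < j \<Longrightarrow> zc j = period_count (real m) (Z (cs (2 * j)))"
  unfolding zc_def using mu_eq_cs_iff[of j "2 * j"] by simp

lemma zc_0: "zc 0 = m"
proof -
  have "{t. mu 0 t = 0} \<inter> {0..<real m} = real ` {..<m}"
    unfolding mu_0_eq_iff
  proof (intro equalityI subsetI)
    fix t assume t: "t \<in> {t. t \<in> \<int>} \<inter> {0..<real m}"
    then obtain i where i: "t = of_int i" by (auto elim: Ints_cases)
    then have "0 \<le> i" "i < int m" using t by auto
    then have "t = real (nat i)" "nat i < m" using i by auto
    then show "t \<in> real ` {..<m}" by blast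
  qed auto
  then show ?thesis by (simp add: zc_def period_count_def card_image inj_on_def)
qed

lemma count_parity:
  assumes c: "c \<in> C" and N: "period_count (real m) (Z c) > 0"
  shows "0 < poly \<alpha> c * (- 1) ^ period_count (real m) (Z c)"
proof -
  have "Z c \<inter> {0..<real m} \<noteq> {}" using N by (auto simp: period_count_def)
  then obtain t0 where "interp (yC c) t0 = 0" by auto
  then have "0 < poly \<alpha> c / c ^ m * (- 1) ^ period_count (real m) (Z c)"
    by (rule zero_count_parity[OF Csol(2,3)[OF c] C_multiplier(2)[OF c] Z_periodic[OF c]])
  then show ?thesis using C_pos[OF c] by (simp add: zero_less_mult_iff zero_less_divide_iff divide_less_0_iff)
qed

text \<open>The oscillations of \<open>mu j\<close> are counted at its upper level
  \<open>cs (2j + 1)\<close>, those of \<open>mu (j + 1)\<close> at its lower level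
  \<open>cs (2j + 2)\<close>; Sturm comparison orders the counts at these adjacent
  parameters.\<close>

lemma zc_antimono:
  assumes "j + 1 < CARD('n)"
  shows "zc (j + 1) \<le> zc j"
proof -
  have j: "j < CARD('n)" "2 * j + 1 < 2 * CARD('n)" "2 * (j + 1) < 2 * CARD('n)" using assms by simp_all
  have C: "cs (2 * j + 1) \<in> C" "cs (2 * (j + 1)) \<in> C" using cs_C[OF _ j(2)] cs_C[OF _ j(3)] by simp_all
  have "period_count (real m) (Z (cs (2 * (j + 1)))) \<le> period_count (real m) (Z (cs (2 * j + 1)))"
    using C_pos[OF C(1)] cs_less[of "2 * j + 1" "2 * (j + 1)"] j
    by (intro sturm_count[OF Csol(2)[OF C(1)] Csol(2)[OF C(2)]] Z_periodic C) auto
  then show ?thesis using zc_odd[OF j(1)] zc_even[OF assms] by simp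
qed

lemma sign_\<alpha>_zc:
  assumes "j < CARD('n)" "i = 2 * j \<or> i = 2 * j + 1" "0 < i"
  shows "0 < poly \<alpha> (cs i) * (- 1) ^ zc j"
proof -
  have i: "cs i \<in> C" using assms by (intro cs_C) auto
  have "zc j = period_count (real m) (Z (cs i))"
    using zc_odd[OF assms(1)] zc_even[OF assms(1)] assms(2,3) by auto
  then show ?thesis using count_parity[OF i] zc_pos[OF assms(1)] by simp
qed

text \<open>Opposite signs of \<open>\<alpha>\<close> at the ends of a gap mean opposite parities of
  the counts, which excludes equality.\<close>

lemma zc_less_if_sign_change:
  assumes j: "j + 1 < CARD('n)" and sign: "poly \<alpha> (cs (2 * j + 1)) * poly \<alpha> (cs (2 * j + 2)) < 0"
  shows "zc (j + 1) < zc j"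
proof -
  have "zc (j + 1) \<noteq> zc j"
  proof
    assume eq: "zc (j + 1) = zc j"
    have A: "0 < poly \<alpha> (cs (2 * j + 1)) * (- 1) ^ zc j"
      by (rule sign_\<alpha>_zc) (use j in auto)
    have B: "0 < poly \<alpha> (cs (2 * (j + 1))) * (- 1) ^ zc (j + 1)"
      by (rule sign_\<alpha>_zc) (use j in auto)
    have "0 < (poly \<alpha> (cs (2 * j + 1)) * (- 1) ^ zc j) * (poly \<alpha> (cs (2 * (j + 1))) * (- 1) ^ zc (j + 1))"
      by (rule mult_pos_pos[OF A B])
    also have "\<dots> = poly \<alpha> (cs (2 * j + 1)) * poly \<alpha> (cs (2 * j + 2))"
      unfolding eq by (cases "even (zc j)") auto
    finally show False using sign by simp
  qed
  then show ?thesis using zc_antimono[OF j] by simp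
qed

text \<open>At a root \<open>r\<close> of \<open>\<beta>\<close> with \<open>\<alpha> r = r\<^sup>m\<close>, every solution is periodic, so that its zero count is even.\<close>

lemma zc_even_between:
  assumes j: "j + 1 < CARD('n)" and r: "cs (2 * j + 1) < r" "r < cs (2 * j + 2)" "poly \<beta> r = 0" "poly \<alpha> r = r ^ m"
  shows "\<exists>k. even k \<and> zc (j + 1) \<le> k \<and> k \<le> zc j"
proof -
  have jj: "j < CARD('n)" "2 * j + 1 < 2 * CARD('n)" "2 * (j + 1) < 2 * CARD('n)" using j by simp_all
  have C: "cs (2 * j + 1) \<in> C" "cs (2 * (j + 1)) \<in> C" using cs_C[OF _ jj(2)] cs_C[OF _ jj(3)] by simp_all
  have r0: "r > 0" using C_pos[OF C(1)] r(1) by simp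
  obtain y w where yw: "solution r y w" "y 0 = 0" "w 0 = 1" using solution_exists by blast
  have per: "y (k + int m) = 1 * y k" "w (k + int m) = 1 * w k" for k
    using solution_multiplier[OF yw(1), of 1 k] closing_0(3)[OF _ r(3) yw(1)] r0 r(4) by auto
  have nz: "y 0 \<noteq> 0 \<or> w 0 \<noteq> 0" using yw by simp
  have Zr: "periodic_discrete (real m) {t. interp y t = 0}"
    by (rule zeros_periodic[OF yw(1) nz per(1)]) simp
  have "interp y 0 = 0" using interp_of_int[of y 0] yw(2) by simp
  then have "0 < (1::real) * (- 1) ^ period_count (real m) {t. interp y t = 0}"
    by (rule zero_count_parity[OF yw(1) nz per(2) Zr])
  then have even: "even (period_count (real m) {t. interp y t = 0})"
    by (cases "even (period_count (real m) {t. interp y t = 0})") auto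
  have "period_count (real m) {t. interp y t = 0} \<le> period_count (real m) (Z (cs (2 * j + 1)))"
    using C_pos[OF C(1)] r by (intro sturm_count[OF Csol(2)[OF C(1)] yw(1)] Z_periodic C Zr)
  moreover have "period_count (real m) (Z (cs (2 * (j + 1)))) \<le> period_count (real m) {t. interp y t = 0}"
    using r0 r by (intro sturm_count[OF yw(1) Csol(2)[OF C(2)]] Z_periodic C Zr) auto
  ultimately show ?thesis using even zc_odd[OF jj(1)] zc_even[OF j] by auto
qed

text \<open>Counting over both periods gives \<open>m w_j = T z_j\<close> for the winding numbers
  \<open>w_j\<close> and the counts \<open>z_j\<close>; taking gcds, coprime \<open>z_j\<close> give
  \<open>m G = T\<close> with \<open>G\<close> the gcd of the \<open>w_j\<close>.\<close>

lemma elliptic_period_if_coprime: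
  assumes "Gcd (zc ` {..<CARD('n)}) = 1"
  shows "periodic_trajectory q \<and> elliptic_period a lam q = m"
proof
  have "q (k + int (2 * m)) = q k" for k
  proof -
    have eq: "k + int (2 * m) = (k + int m) + int m" by simp
    show ?thesis unfolding eq closing(1) by (simp add: \<sigma>\<sigma>)
  qed
  then show per: "periodic_trajectory q"
    unfolding periodic_trajectory_def using m_pos by (intro exI[of _ "2 * m"]) auto
  define T where "T = trajectory_period q"
  have T: "0 < T \<and> (\<forall>k. q (k + int T) = q k)"
    unfolding T_def trajectory_period_def using per[unfolded periodic_trajectory_def] by (rule LeastI_ex)
  have muT: "mu j (t + real T) = mu j t" if "j < CARD('n)" for j t
    by (rule mu_periodic[OF that, of _ _ 1]) (use T in \<open>auto simp: path_eq intro!: interp_multiplier[of _ _ 1, simplified]\<close>)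
  have w: "trajectory_winding_number a lam q j = period_count (real T) {t. mu j t = cs (2 * j)}" if j: "j < CARD('n)" for j
  proof -
    have eq: "(\<lambda>t. elliptic_coordinate a j (trajectory_path q t)) = mu j" by (simp add: mu_def fun_eq_iff)
    have rt: "round_trips (mu j) (cs (2 * j)) (cs (2 * j + 1)) (real T) k
        \<longleftrightarrow> k = period_count (real T) {t. mu j t = cs (2 * j)}" for k
      using mu_round_trips(1)[OF j _ muT[OF j]] T by simp
    show ?thesis
      unfolding trajectory_winding_number_def eq T_def[symmetric]
      by (rule the_equality) (simp_all only: rt)
  qed
  have pd: "periodic_discrete (real l) {t. mu j t = cs (2 * j)}"
    if "j < CARD('n)" "l > 0" "\<And>t. mu j (t + real l) = mu j t" for j l
    unfolding periodic_discrete_def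
  proof (intro conjI allI)
    show "finite ({t. mu j t = cs (2 * j)} \<inter> {x..y})" for x y
      by (rule finite_subset[OF _ finite_mu_hits[OF that(1), of x y]]) auto
  qed (use that in auto)
  have ratio: "m * trajectory_winding_number a lam q j = T * zc j" if "j < CARD('n)" for j
    unfolding w[OF that] zc_def
    using period_count_commute[OF pd[OF that m_pos mu_m[OF that]] pd[OF that _ muT[OF that]]] T by simp
  let ?G = "Gcd (trajectory_winding_number a lam q ` {..<CARD('n)})"
  have "m * ?G = Gcd ((*) m ` trajectory_winding_number a lam q ` {..<CARD('n)})"
    by (simp only: Gcd_mult normalize_nat_def id_apply)
  also have "(*) m ` trajectory_winding_number a lam q ` {..<CARD('n)} = (*) T ` zc ` {..<CARD('n)}"
    unfolding image_image by (rule image_cong) (auto simp: ratio)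
  also have "Gcd \<dots> = T" by (simp only: Gcd_mult normalize_nat_def id_apply assms mult_1_right)
  finally have G: "m * ?G = T" .
  then have "?G > 0" using T by (metis mult_0_right neq0_conv)
  then show "elliptic_period a lam q = m"
    unfolding elliptic_period_def T_def[symmetric] by (metis G nonzero_mult_div_cancel_right less_irrefl)
qed

end

section \<open>The three algebraic conditions\<close>

lemma degree_le_pred:
  assumes "degree p \<le> n" "coeff p n = 0" "n > 0"
  shows "degree p \<le> n - 1"
proof (rule degree_le, intro allI impI)
  fix i assume "i > n - 1"
  then consider "i = n" | "i > n" using assms(3) by linarith
  then show "coeff p i = 0" using assms(1,2) by cases (auto simp: coeff_eq_0)
qed

lemma poly_nonzero_if_finite_roots:
  assumes "finite {t. poly p t = 0}"
  shows "p \<noteq> (0 :: real poly)"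
proof
  assume "p = 0"
  then have "{t. poly p t = 0} = UNIV" by simp
  then show False using assms infinite_UNIV_char_0[where 'a = real] by simp
qed

lemma degree_prod_linear: "degree (\<Prod>i\<in>A. [:- f i, 1:]) = card A"
  and coeff_prod_linear: "coeff (\<Prod>i\<in>A. [:- f i, 1:]) (card A) = 1"
  for f :: "'b \<Rightarrow> 'a::idom"
proof -
  show d: "degree (\<Prod>i\<in>A. [:- f i, 1:]) = card A"
    by (subst degree_prod_sum_eq) auto
  show "coeff (\<Prod>i\<in>A. [:- f i, 1:]) (card A) = 1"
    using lead_coeff_prod[of "\<lambda>i. [:- f i, 1:]" A] unfolding d by simp
qed

text \<open>Logarithmic derivatives: at a multiple root \<open>n / z\<close> is the sum of the
  \<open>1 / (z - c)\<close>, and \<open>z / (z - c) - 1 = c / (z - c)\<close>.\<close>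

lemma critical_sum:
  fixes z :: "'a::field_char_0"
  assumes "finite C" and root: "poly (monom 1 (card C) - (\<Prod>c\<in>C. [:- c, 1:])) z = 0"
    and deriv: "poly (pderiv (monom 1 (card C) - (\<Prod>c\<in>C. [:- c, 1:]))) z = 0" and "z \<noteq> 0"
  shows "(\<Sum>c\<in>C. c / (z - c)) = 0"
proof (cases "C = {}")
  case False
  define n where "n = card C"
  have n: "n > 0" using False \<open>finite C\<close> by (simp add: n_def card_gt_0_iff)
  define F where "F = (\<Prod>c\<in>C. z - c)"
  have F: "z ^ n = F" using root by (simp add: poly_monom poly_prod F_def n_def)
  then have "F \<noteq> 0" using \<open>z \<noteq> 0\<close> by (metis power_not_zero)
  then have nz: "z - c \<noteq> 0" if "c \<in> C" for c
    using that \<open>finite C\<close> by (auto simp: F_def)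
  have "pderiv (monom 1 n) = (monom (of_nat n) (n - 1) :: 'a poly)"
    using pderiv_monom[of "1::'a" n] by simp
  then have "of_nat n * z ^ (n - 1) = (\<Sum>c\<in>C. \<Prod>d\<in>C - {c}. z - d)"
    using deriv by (simp add: pderiv_diff pderiv_prod pderiv_pCons poly_monom poly_sum poly_prod n_def)
  also have "\<dots> = (\<Sum>c\<in>C. F / (z - c))"
  proof (rule sum.cong)
    fix c assume "c \<in> C"
    then have "F = (z - c) * (\<Prod>d\<in>C - {c}. z - d)"
      unfolding F_def using \<open>finite C\<close> by (rule prod.remove[rotated])
    then show "(\<Prod>d\<in>C - {c}. z - d) = F / (z - c)" using nz[OF \<open>c \<in> C\<close>] by simp
  qed simp
  also have "\<dots> = z ^ n * (\<Sum>c\<in>C. 1 / (z - c))" by (simp add: F sum_distrib_left)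
  finally have "of_nat n * z ^ (n - 1) = z ^ (n - 1) * (z * (\<Sum>c\<in>C. 1 / (z - c)))"
    using n by (simp add: power_eq_if mult_ac)
  then have "of_nat n = z * (\<Sum>c\<in>C. 1 / (z - c))" using \<open>z \<noteq> 0\<close> by (simp add: mult.commute)
  moreover have "(\<Sum>c\<in>C. c / (z - c)) = (\<Sum>c\<in>C. z * (1 / (z - c)) - 1)"
    using nz by (intro sum.cong) (auto simp: field_simps)
  ultimately show ?thesis by (simp add: sum_subtractf sum_distrib_left n_def)
qed simp

context billiard begin

definition "Ap = (\<Prod>j\<in>(UNIV :: 'n set). [:- a j, 1:])"
definition "Lp = (\<Prod>k=1..CARD('n) - 1. [:- lam k, 1:])"

lemma Ap_range: "Ap = (\<Prod>r\<in>range a. [:- r, 1:])"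
  unfolding Ap_def using strict_mono_imp_inj_on[OF a_mono] by (simp add: prod.reindex)

lemma Lp_image: "Lp = (\<Prod>r\<in>lam ` {1..CARD('n) - 1}. [:- r, 1:])"
  unfolding Lp_def using lam_inj by (simp add: prod.reindex)

lemma R_split: "R = Ap * Lp"
  unfolding R_def C_def Ap_range Lp_image using lam_a by (intro prod.union_disjoint) auto

lemma degree_Ap: "degree Ap = CARD('n)" and coeff_Ap: "coeff Ap CARD('n) = 1"
  unfolding Ap_def by (rule degree_prod_linear coeff_prod_linear)+

lemma degree_Lp: "degree Lp = CARD('n) - 1" and coeff_Lp: "coeff Lp (CARD('n) - 1) = 1"
  unfolding Lp_def using degree_prod_linear[of lam "{1..CARD('n) - 1}"] coeff_prod_linear[of lam "{1..CARD('n) - 1}"]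
  by simp_all

lemma R_0_neg: "poly R 0 < 0"
proof -
  have "(V 0 0)\<^sup>2 > 0" using V_0_neg[of 0] by simp
  moreover have "(V 0 0)\<^sup>2 = - poly R 0" using mumford[of 0 0] by (simp add: U_0)
  ultimately show ?thesis by linarith
qed

lemma Ap_Lp_0: "poly Ap 0 * poly Lp 0 < 0"
  using R_0_neg by (simp add: R_split)

lemma card_range_a: "card (range a) = CARD('n)"
  using strict_mono_imp_inj_on[OF a_mono] by (simp add: card_image)

lemma card_image_lam: "card (lam ` {1..CARD('n) - 1}) = CARD('n) - 1"
  using lam_inj by (simp add: card_image)

lemma Ap_a [simp]: "poly Ap (a i) = 0"
  by (simp add: Ap_def poly_prod) auto

lemma Lp_lam: "k \<in> {1..CARD('n) - 1} \<Longrightarrow> poly Lp (lam k) = 0"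
  unfolding Lp_def poly_prod by (rule prod_zero) auto

lemma gap_sign_change:
  assumes "\<And>i. 0 < e * poly \<alpha> (a i)" "\<And>k. k \<in> {1..CARD('n) - 1} \<Longrightarrow> e * poly \<alpha> (lam k) < 0"
    and j: "j + 1 < CARD('n)" and e: "e = 1 \<or> e = -1"
  shows "poly \<alpha> (cs (2 * j + 1)) * poly \<alpha> (cs (2 * j + 2)) < 0"
proof -
  have ran: "0 < e * poly \<alpha> c" if "c \<in> range a" for c using assms(1) that by auto
  have nran: "e * poly \<alpha> c < 0" if "c \<in> C" "c \<notin> range a" for c
    using assms(2) that by (auto simp: C_def)
  have "cs (2 * j + 1) \<in> C" "cs (2 * j + 2) \<in> C" using j by (auto intro!: cs_C)
  then have "(e * poly \<alpha> (cs (2 * j + 1))) * (e * poly \<alpha> (cs (2 * j + 2))) < 0"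
    using gap_types[OF j] ran nran by (metis mult_neg_pos mult_pos_neg)
  then show ?thesis using e by auto
qed

text \<open>Here \<open>F = Ap\<close>, \<open>G = c Lp\<close> and \<open>\<beta>\<close> is the
  constant \<open>2 sqrt c\<close>. \<open>\<alpha>\<close> is negative at the \<open>a i\<close>
  and positive at the \<open>lam k\<close>, so each of the \<open>n - 1\<close> gaps gives a strict
  descent from \<open>zc 0 = n\<close>, and the last count is 1.\<close>

lemma condition_n:
  assumes "{t. poly (monom 1 CARD('n) - Ap) t = 0} = lam ` {1..CARD('n) - 1}"
  shows "periodic_trajectory q \<and> elliptic_period a lam q = CARD('n)"
proof -
  let ?n = "CARD('n)"
  define G where "G = monom 1 ?n - Ap"
  have "degree G \<le> ?n" unfolding G_def by (intro degree_diff_le degree_monom_le) (simp add: degree_Ap)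
  then have "degree G \<le> ?n - 1"
    by (rule degree_le_pred) (simp_all add: G_def coeff_Ap)
  then have "G = smult (coeff G (?n - 1)) Lp"
    using poly_eq_smult_prod_roots[of "lam ` {1..?n - 1}" G] assms unfolding card_image_lam Lp_image G_def by blast
  then obtain c where c: "G = smult c Lp" by blast
  have eq: "s ^ ?n = poly Ap s + c * poly Lp s" for s
    using arg_cong[OF c, of "\<lambda>p. poly p s"] by (simp add: G_def poly_monom)
  have A0: "poly Ap 0 = - c * poly Lp 0" using eq[of 0] n_pos by (simp add: power_0_left)
  \<comment> \<open>At 0 the identity reads \<open>Ap = - c Lp\<close>, where moreover
    \<open>Ap Lp = R < 0\<close>.\<close>
  have "c * (poly Lp 0)\<^sup>2 > 0" using Ap_Lp_0 unfolding A0 by (simp add: power2_eq_square)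
  then have c0: "c > 0" by (simp add: zero_less_mult_iff)
  define \<alpha> where "\<alpha> = Ap - smult c Lp"
  define \<beta> where "\<beta> = [:2 * sqrt c:]"
  have \<alpha>_a: "poly \<alpha> (a i) = - 1 * a i ^ ?n" for i
    using eq[of "a i"] by (simp add: \<alpha>_def)
  have \<alpha>_lam: "poly \<alpha> (lam k) = lam k ^ ?n" if "k \<in> {1..?n - 1}" for k
    using eq[of "lam k"] Lp_lam[OF that] by (simp add: \<alpha>_def)
  have lam_pos: "lam k > 0" if "k \<in> {1..?n - 1}" for k
    using C_pos[of "lam k"] that by (auto simp: C_def)
  interpret closing_billiard a lam q ?n \<alpha> \<beta> "-1"
  proof
    fix s
    have "(poly \<alpha> s)\<^sup>2 + (poly \<beta> s)\<^sup>2 * poly R s = (poly Ap s + c * poly Lp s)\<^sup>2"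
      using c0 by (simp add: \<alpha>_def \<beta>_def R_split power_mult_distrib) (simp add: power2_eq_square algebra_simps)
    then show "(poly \<alpha> s)\<^sup>2 + (poly \<beta> s)\<^sup>2 * poly R s = s ^ (2 * ?n)"
      unfolding eq[symmetric] by (simp only: power_even_eq)
    show "degree \<alpha> \<le> ?n"
      unfolding \<alpha>_def by (intro degree_diff_le order.trans[OF degree_smult_le]) (simp_all add: degree_Ap degree_Lp)
    have "coeff Lp ?n = 0" using n_pos by (intro coeff_eq_0) (simp add: degree_Lp)
    then show "coeff \<alpha> ?n = 1" by (simp add: \<alpha>_def coeff_Ap)
    show "poly \<alpha> 0 \<noteq> 0" using A0 Ap_Lp_0 by (auto simp: \<alpha>_def)
  qed (use \<alpha>_a in \<open>auto simp: \<beta>_def\<close>)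
  have less: "zc (j + 1) < zc j" if "j + 1 < ?n" for j
  proof (rule zc_less_if_sign_change[OF that], rule gap_sign_change[OF _ _ that, of "-1"])
    show "0 < - 1 * poly \<alpha> (a i)" for i unfolding \<alpha>_a using a_pos[of i] by simp
    show "- 1 * poly \<alpha> (lam k) < 0" if "k \<in> {1..?n - 1}" for k
      unfolding \<alpha>_lam[OF that] using lam_pos[OF that] by simp
  qed simp
  have "zc j + j \<le> ?n" if "j < ?n" for j
    using that
  proof (induction j)
    case (Suc j)
    then show ?case using less[of j] by simp
  qed (simp add: zc_0)
  from this[of "?n - 1"] have "zc (?n - 1) \<le> 1" using n_pos by simp
  then have "zc (?n - 1) = 1" using zc_pos[of "?n - 1"] n_pos by simp
  then have "1 \<in> zc ` {..<?n}" using n_pos by (metis diff_less imageI lessThan_iff zero_less_one)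
  then have "Gcd (zc ` {..<?n}) = 1" by (rule Gcd_1)
  then show ?thesis by (rule elliptic_period_if_coprime)
qed

text \<open>Here \<open>F = (s - d)^2 Lp\<close>, \<open>G = c Ap\<close> and
  \<open>\<beta> = 2 sqrt c (s - d)\<close>. Strict descents from \<open>n + 1\<close> leave 1 or 2
  for the last count; parity selects 2, and the count before it is then 3.\<close>

lemma condition_n_plus_1:
  assumes n2: "CARD('n) \<ge> 2"
    and roots: "{t. poly (monom 1 (CARD('n) + 1) - [:- d, 1:]\<^sup>2 * Lp) t = 0} = range a"
  shows "periodic_trajectory q \<and> elliptic_period a lam q = CARD('n) + 1"
proof -
  let ?n = "CARD('n)"
  define H where "H = [:- d, 1:]\<^sup>2 * Lp"
  define G where "G = monom 1 (?n + 1) - H"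
  have "degree [:- d, 1:] = 1" by simp
  then have d2: "degree ([:- d, 1:]\<^sup>2) \<le> 2" "coeff ([:- d, 1:]\<^sup>2) 2 = 1"
    by (simp_all add: power2_eq_square numeral_2_eq_2)
  have n1: "?n + 1 = 2 + (?n - 1)" using n2 by simp
  have degH: "degree H \<le> ?n + 1"
    unfolding H_def n1 using d2(1) degree_Lp by (intro order.trans[OF degree_mult_le] add_mono) auto
  have coeffH: "coeff H (?n + 1) = 1"
    unfolding H_def n1 using coeff_mult_top[OF d2(1), of Lp "?n - 1"] d2(2) by (simp add: degree_Lp coeff_Lp[simplified])
  have G0: "G \<noteq> 0"
    unfolding G_def H_def by (rule poly_nonzero_if_finite_roots) (simp only: roots finite_imageI finite)
  have "degree G \<le> ?n + 1" unfolding G_def by (intro degree_diff_le degree_monom_le degH)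
  then have "degree G \<le> ?n + 1 - 1"
    by (rule degree_le_pred) (simp_all add: G_def coeffH[simplified])
  then have "G = smult (coeff G ?n) Ap"
    using poly_eq_smult_prod_roots[of "range a" G] roots unfolding card_range_a Ap_range G_def H_def by auto
  then obtain c where c: "G = smult c Ap" by blast
  have eq: "s ^ (?n + 1) = (s - d)\<^sup>2 * poly Lp s + c * poly Ap s" for s
    using arg_cong[OF c, of "\<lambda>p. poly p s"] by (simp add: G_def H_def poly_monom algebra_simps)
  have A0: "d\<^sup>2 * poly Lp 0 = - c * poly Ap 0" using eq[of 0] by simp
  have cn: "c \<noteq> 0" using c G0 by auto
  \<comment> \<open>This yields \<open>c \<ge> 0\<close>; that \<open>c \<noteq> 0\<close> comes
    from the finiteness of the given root set.\<close>
  have "c * (poly Ap 0)\<^sup>2 = - (d\<^sup>2 * poly Lp 0) * poly Ap 0" unfolding A0 by (simp add: power2_eq_square)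
  also have "\<dots> = d\<^sup>2 * (- (poly Ap 0 * poly Lp 0))" by simp
  also have "\<dots> \<ge> 0" using Ap_Lp_0 by (intro mult_nonneg_nonneg) auto
  finally have "c * (poly Ap 0)\<^sup>2 \<ge> 0" .
  moreover have "poly Ap 0 \<noteq> 0" using Ap_Lp_0 by auto
  ultimately have c0: "c > 0" using cn by (auto simp: zero_le_mult_iff)
  define \<alpha> where "\<alpha> = H - smult c Ap"
  define \<beta> where "\<beta> = smult (2 * sqrt c) [:- d, 1:]"
  have \<alpha>_a: "poly \<alpha> (a i) = 1 * a i ^ (?n + 1)" for i
    unfolding eq[of "a i"] by (simp add: \<alpha>_def H_def algebra_simps)
  have \<alpha>_lam: "poly \<alpha> (lam k) = - (lam k ^ (?n + 1))" if "k \<in> {1..?n - 1}" for k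
    unfolding eq[of "lam k"] using Lp_lam[OF that] by (simp add: \<alpha>_def H_def)
  have lam_pos: "lam k > 0" if "k \<in> {1..?n - 1}" for k
    using C_pos[of "lam k"] that by (auto simp: C_def)
  interpret closing_billiard a lam q "?n + 1" \<alpha> \<beta> 1
  proof
    fix s
    have "(poly \<alpha> s)\<^sup>2 + (poly \<beta> s)\<^sup>2 * poly R s = ((s - d)\<^sup>2 * poly Lp s + c * poly Ap s)\<^sup>2"
    proof -
      have \<alpha>: "poly \<alpha> s = (s - d)\<^sup>2 * poly Lp s - c * poly Ap s" by (simp add: \<alpha>_def H_def algebra_simps)
      have \<beta>: "(poly \<beta> s)\<^sup>2 = 4 * c * (s - d)\<^sup>2"
      proof -
        have "poly \<beta> s = 2 * sqrt c * (s - d)" by (simp add: \<beta>_def algebra_simps)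
        then show ?thesis using c0 by (simp add: power_mult_distrib)
      qed
      show ?thesis unfolding \<alpha> \<beta> R_split poly_mult by (simp add: power2_eq_square algebra_simps)
    qed
    then show "(poly \<alpha> s)\<^sup>2 + (poly \<beta> s)\<^sup>2 * poly R s = s ^ (2 * (?n + 1))"
      unfolding eq[symmetric] by (simp only: power_even_eq)
    show "degree \<alpha> \<le> ?n + 1"
      unfolding \<alpha>_def by (intro degree_diff_le degH order.trans[OF degree_smult_le]) (simp add: degree_Ap)
    have "coeff Ap (?n + 1) = 0" by (intro coeff_eq_0) (simp add: degree_Ap)
    then show "coeff \<alpha> (?n + 1) = 1" by (simp add: \<alpha>_def coeffH[simplified])
    show "poly \<alpha> 0 \<noteq> 0" using A0 c0 \<open>poly Ap 0 \<noteq> 0\<close> by (simp add: \<alpha>_def H_def)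
    show "degree \<beta> + ?n \<le> ?n + 1" by (simp add: \<beta>_def)
  qed (use \<alpha>_a in auto)
  have less: "zc (j + 1) < zc j" if "j + 1 < ?n" for j
  proof (rule zc_less_if_sign_change[OF that], rule gap_sign_change[OF _ _ that, of 1])
    show "0 < 1 * poly \<alpha> (a i)" for i unfolding \<alpha>_a using a_pos[of i] by simp
    show "1 * poly \<alpha> (lam k) < 0" if "k \<in> {1..?n - 1}" for k
      unfolding \<alpha>_lam[OF that] using lam_pos[OF that] by simp
  qed simp
  have bound: "zc j + j \<le> ?n + 1" if "j < ?n" for j
    using that
  proof (induction j)
    case (Suc j)
    then show ?case using less[of j] by simp
  qed (simp add: zc_0[simplified])
  have last: "?n - 1 < ?n" "?n - 2 < ?n" "?n - 2 + 1 = ?n - 1" using n2 by auto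
  \<comment> \<open>The top parameter is some \<open>a i\<close>, where \<open>\<alpha>\<close> is
    positive, so the last count is even.\<close>
  obtain i where i: "cs (2 * ?n - 1) = a i" using cs_last by auto
  have "2 * (?n - 1) + 1 = 2 * ?n - 1" using n2 by linarith
  then have "0 < poly \<alpha> (a i) * (- 1) ^ zc (?n - 1)"
    using sign_\<alpha>_zc[OF last(1), of "2 * (?n - 1) + 1"] i by simp
  moreover have "poly \<alpha> (a i) > 0" unfolding \<alpha>_a using a_pos[of i] by simp
  ultimately have "even (zc (?n - 1))" by (cases "even (zc (?n - 1))") (auto simp: zero_less_mult_iff)
  then have z1: "zc (?n - 1) = 2"
    using zc_pos[OF last(1)] bound[OF last(1)] n2 by (auto elim!: evenE)
  have z2: "zc (?n - 2) = 3"
    using less[of "?n - 2"] bound[OF last(2)] z1 last n2 by simp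
  have "Gcd (zc ` {..<?n}) dvd zc (?n - 1)" "Gcd (zc ` {..<?n}) dvd zc (?n - 2)"
    using last by (auto intro!: Gcd_dvd)
  then have "Gcd (zc ` {..<?n}) dvd 3 - 2"
    unfolding z1 z2 by (intro dvd_diff_nat)
  then have "Gcd (zc ` {..<?n}) = 1" by simp
  then show ?thesis by (rule elliptic_period_if_coprime)
qed

text \<open>Here \<open>F = R\<close> and \<open>G = k Sp^2\<close>. The double roots are a priori
  complex; \<open>critical_sum\<close> makes them real and positive and places one in each gap.
  There every nontrivial solution with a zero has an even zero count, squeezed between two odd
  counts, so each descent is at least 2.\<close>

lemma condition_2n_minus_1:
  assumes double: "\<And>z. poly (monom 1 (2 * CARD('n) - 1) - (\<Prod>c\<in>C. [:- complex_of_real c, 1:])) z = 0 \<Longrightarrow>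
    order z (monom 1 (2 * CARD('n) - 1) - (\<Prod>c\<in>C. [:- complex_of_real c, 1:])) = 2"
  shows "periodic_trajectory q \<and> elliptic_period a lam q = 2 * CARD('n) - 1"
proof -
  let ?n = "CARD('n)"
  define m where "m = 2 * ?n - 1"
  have m: "m = Suc (2 * (?n - 1))" using n_pos unfolding m_def by linarith
  have cC: "card C = m" by (simp add: card_C m_def)
  have C_ne: "C \<noteq> {}" using cC m by auto
  define G where "G = monom 1 m - R"
  let ?C = "complex_of_real ` C"
  define Gc where "Gc = monom 1 m - (\<Prod>c\<in>?C. [:- c, 1:])"
  \<comment> \<open>Minus the second coefficient of \<open>R\<close>, hence the leading coefficient
    of \<open>t^m - R\<close>.\<close>
  define k where "k = (\<Sum>c\<in>C. c)"
  have k: "k > 0" unfolding k_def using C_pos finite_C C_ne by (intro sum_pos) auto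
  have degR: "degree R = m" "coeff R m = 1"
    unfolding R_def using degree_prod_linear[of "\<lambda>c. c" C] coeff_prod_linear[of "\<lambda>c. c" C] cC by simp_all
  have inj: "inj_on complex_of_real C" by (simp add: inj_on_def)
  have cC': "card ?C = m" using cC inj by (simp add: card_image)
  have GcC: "Gc = monom 1 m - (\<Prod>c\<in>C. [:- complex_of_real c, 1:])"
    unfolding Gc_def using inj by (simp add: prod.reindex)
  have degGc: "degree Gc = m - 1" "lead_coeff Gc = of_real k"
  proof -
    have "degree Gc \<le> m - 1"
    proof (rule degree_le_pred)
      show "degree Gc \<le> m"
        unfolding Gc_def using degree_prod_linear[of "\<lambda>c. c" ?C] cC' by (intro degree_diff_le degree_monom_le) simp
      show "coeff Gc m = 0"
        unfolding Gc_def using coeff_prod_linear[of "\<lambda>c. c" ?C] cC' by simp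
    qed (use m in simp)
    moreover have c: "coeff Gc (m - 1) = of_real k"
      unfolding Gc_def using coeff_prod_linear_second[of ?C] cC' finite_C C_ne m inj
      by (simp add: k_def sum.reindex)
    moreover have "of_real k \<noteq> (0::complex)" using k by simp
    ultimately show d: "degree Gc = m - 1" using le_degree[of Gc "m - 1"] by simp
    show "lead_coeff Gc = of_real k" unfolding d by (rule c)
  qed
  have dbl: "order z Gc = 2" if "poly Gc z = 0" for z
    using double[of z] that unfolding GcC m_def by blast
  have polyGc: "poly Gc (of_real s) = of_real (poly G s)" for s
    by (simp add: GcC G_def poly_monom poly_prod poly_R)
  have G_0: "poly G 0 > 0" using R_0_neg m by (simp add: G_def poly_monom)
  have crit: "(\<Sum>c\<in>complex_of_real ` C. c / (z - c)) = 0" if z: "poly Gc z = 0" for z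
  proof (rule critical_sum)
    show "finite (complex_of_real ` C)" using finite_C by simp
    show "poly (monom 1 (card (complex_of_real ` C)) - (\<Prod>c\<in>complex_of_real ` C. [:- c, 1:])) z = 0"
      unfolding cC' Gc_def[symmetric] by (rule z)
    have "[:- z, 1:] ^ 2 dvd Gc" using order_1[of z Gc] dbl[OF z] by simp
    then obtain H where "Gc = [:- z, 1:] ^ 2 * H" by (elim dvdE)
    then have H: "Gc = [:- z, 1:] * ([:- z, 1:] * H)" by (simp only: power2_eq_square mult.assoc)
    have z0: "poly [:- z, 1:] z = 0" by simp
    show "poly (pderiv (monom 1 (card (complex_of_real ` C)) - (\<Prod>c\<in>complex_of_real ` C. [:- c, 1:]))) z = 0"
      unfolding cC' Gc_def[symmetric] H by (simp only: pderiv_mult poly_add poly_mult z0 mult_zero_left mult_zero_right add_0_right)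
    show "z \<noteq> 0" using z polyGc[of 0] G_0 by auto
  qed
  have real_roots: "z \<in> \<real>" if z: "poly Gc z = 0" for z
  proof -
    \<comment> \<open>Each summand has imaginary part \<open>- Im z\<close> times a positive factor,
      so the sum can vanish only for real \<open>z\<close>.\<close>
    have "0 = Im (\<Sum>c\<in>complex_of_real ` C. c / (z - c))" using crit[OF z] by simp
    also have "\<dots> = (\<Sum>c\<in>C. Im (of_real c / (z - of_real c)))"
      by (subst sum.reindex) (auto simp: inj_on_def)
    also have "\<dots> = (\<Sum>c\<in>C. - Im z * (c / (cmod (z - of_real c))\<^sup>2))"
      by (rule sum.cong) (simp_all add: Im_divide')
    also have "\<dots> = - Im z * (\<Sum>c\<in>C. c / (cmod (z - of_real c))\<^sup>2)"
      by (simp add: sum_distrib_left)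
    finally have eq: "Im z * (\<Sum>c\<in>C. c / (cmod (z - of_real c))\<^sup>2) = 0" by simp
    show ?thesis
    proof (rule ccontr)
      assume "z \<notin> \<real>"
      then have "Im z \<noteq> 0" by (simp add: complex_is_Real_iff)
      then have "z \<noteq> of_real c" for c by auto
      then have "(\<Sum>c\<in>C. c / (cmod (z - of_real c))\<^sup>2) > 0"
        using C_pos finite_C C_ne by (intro sum_pos divide_pos_pos) auto
      then show False using eq \<open>Im z \<noteq> 0\<close> by simp
    qed
  qed
  define S where "S = {r. poly G r = 0}"
  have G_nz: "G \<noteq> 0" using G_0 by auto
  have finS: "finite S" unfolding S_def by (rule poly_roots_finite[OF G_nz])
  have roots: "{z. poly Gc z = 0} = complex_of_real ` S"
  proof (intro equalityI subsetI)
    fix z assume z: "z \<in> {z. poly Gc z = 0}"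
    then obtain s where s: "z = complex_of_real s" using real_roots[of z] by (auto elim: Reals_cases)
    then have "poly G s = 0" using z polyGc[of s] by simp
    then show "z \<in> complex_of_real ` S" using s by (simp add: S_def)
  qed (auto simp: S_def polyGc)
  define Sp where "Sp = (\<Prod>r\<in>S. [:- r, 1:])"
  have decomp: "Gc = smult (of_real k) (\<Prod>r\<in>S. [:- complex_of_real r, 1:]\<^sup>2)"
  proof -
    have "Gc = smult (lead_coeff Gc) (\<Prod>z\<in>{z. poly Gc z = 0}. [:- z, 1:] ^ order z Gc)"
      by (rule complex_poly_decompose[symmetric])
    also have "(\<Prod>z\<in>{z. poly Gc z = 0}. [:- z, 1:] ^ order z Gc) = (\<Prod>z\<in>{z. poly Gc z = 0}. [:- z, 1:]\<^sup>2)"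
      by (rule prod.cong) (simp_all add: dbl)
    also have "\<dots> = (\<Prod>r\<in>S. [:- complex_of_real r, 1:]\<^sup>2)"
      unfolding roots by (subst prod.reindex) (auto simp: inj_on_def)
    finally show ?thesis unfolding degGc(2) .
  qed
  have cardS: "card S = ?n - 1"
  proof -
    have "degree Gc = degree (\<Prod>r\<in>S. [:- complex_of_real r, 1:]\<^sup>2)"
      using decomp k by simp
    also have "\<dots> = (\<Sum>r\<in>S. 2)"
      by (subst degree_prod_sum_eq) (auto simp: degree_power_eq)
    finally show ?thesis using degGc(1) m by simp
  qed
  have polyG: "poly G s = k * (poly Sp s)\<^sup>2" for s
  proof -
    have "complex_of_real (poly G s) = of_real (k * (poly Sp s)\<^sup>2)"
      unfolding polyGc[symmetric] by (subst decomp) (simp add: poly_prod Sp_def prod_power_distrib)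
    then show ?thesis by (simp only: of_real_eq_iff)
  qed
  have eq: "s ^ m = poly R s + k * (poly Sp s)\<^sup>2" for s
    using polyG[of s] by (simp add: G_def poly_monom algebra_simps)
  have critS: "(\<Sum>c\<in>C. c / (r - c)) = 0" if r: "r \<in> S" for r
  proof -
    have "poly Gc (of_real r) = 0" using r by (simp add: polyGc S_def)
    from crit[OF this] have "complex_of_real (\<Sum>c\<in>C. c / (r - c)) = 0"
      by (subst (asm) sum.reindex) (auto simp: inj_on_def)
    then show ?thesis by (simp only: of_real_eq_0_iff)
  qed
  have S_pos: "r > 0" if r: "r \<in> S" for r
  proof (rule ccontr)
    assume "\<not> r > 0"
    have "(\<Sum>c\<in>C. - (c / (r - c))) > 0"
    proof (rule sum_pos[OF finite_C C_ne])
      fix c assume "c \<in> C"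
      then have "c > 0" "r - c < 0" using C_pos[of c] \<open>\<not> r > 0\<close> by linarith+
      then show "- (c / (r - c)) > 0" by (simp add: divide_pos_neg)
    qed
    then show False using critS[OF r] by (simp add: sum_negf)
  qed
  have R_S: "poly R r = r ^ m" if "r \<in> S" for r
    using that by (simp add: S_def G_def poly_monom)
  have S_C: "r \<notin> C" if r: "r \<in> S" for r
  proof
    assume "r \<in> C"
    then have "poly R r = 0" using finite_C by (auto simp: poly_R)
    then show False using R_S[OF r] S_pos[OF r] by simp
  qed
  define \<nu>S where "\<nu>S r = card {c \<in> C. c < r}" for r
  have \<nu>S_odd: "odd (\<nu>S r)" if r: "r \<in> S" for r
    using sign_R[OF S_C[OF r]] R_S[OF r] S_pos[OF r] by (simp add: \<nu>S_def)
  \<comment> \<open>To the right of all parameters every summand of the critical equation would be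
    positive.\<close>
  have \<nu>S_less: "\<nu>S r < m" if r: "r \<in> S" for r
  proof -
    have "\<nu>S r \<noteq> m"
    proof
      assume eq: "\<nu>S r = m"
      have "{c \<in> C. c < r} = C"
        using eq cC finite_C unfolding \<nu>S_def by (intro card_subset_eq) auto
      then have "(\<Sum>c\<in>C. c / (r - c)) > 0"
        using C_pos finite_C C_ne by (intro sum_pos divide_pos_pos) auto
      then show False using critS[OF r] by simp
    qed
    moreover have "\<nu>S r \<le> m" unfolding \<nu>S_def cC[symmetric] using finite_C by (intro card_mono) auto
    ultimately show ?thesis by simp
  qed
  have \<nu>S_inj: "r = r'" if r: "r \<in> S" "r' \<in> S" "\<nu>S r = \<nu>S r'" "r \<le> r'" for r r'
  proof (rule ccontr)
    assume "r \<noteq> r'"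
    then have lt: "r < r'" using r(4) by simp
    have sub: "{c \<in> C. c < r} = {c \<in> C. c < r'}"
      using r(3) finite_C lt unfolding \<nu>S_def by (intro card_subset_eq) auto
    \<comment> \<open>Between neighbouring parameters each \<open>c / (r - c)\<close> decreases
      strictly in \<open>r\<close>, so the critical equation has at most one solution there.\<close>
    have "(\<Sum>c\<in>C. c / (r' - c)) < (\<Sum>c\<in>C. c / (r - c))"
    proof (rule sum_strict_mono[OF finite_C C_ne])
      fix c assume c: "c \<in> C"
      have "c < r \<longleftrightarrow> c < r'" using sub c by blast
      moreover have "c \<noteq> r" "c \<noteq> r'" using S_C r c by auto
      ultimately have "(r - c) * (r' - c) > 0"
        using lt by (cases "c < r") (auto intro: mult_pos_pos mult_neg_neg)
      moreover have "r - c < r' - c" using lt by simp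
      ultimately show "c / (r' - c) < c / (r - c)"
        using C_pos[OF c] by (intro divide_strict_left_mono) (auto simp: mult.commute)
    qed
    then show False using critS r by simp
  qed
  have in_gap: "\<exists>r\<in>S. cs (2 * j + 1) < r \<and> r < cs (2 * j + 2)" if j: "j + 1 < ?n" for j
  proof -
    have "inj_on (\<lambda>r. \<nu>S r div 2) S"
    proof (rule inj_onI)
      fix r r' assume *: "r \<in> S" "r' \<in> S" "\<nu>S r div 2 = \<nu>S r' div 2"
      then have "\<nu>S r = \<nu>S r'" using \<nu>S_odd[OF *(1)] \<nu>S_odd[OF *(2)] by (metis odd_two_times_div_two_succ)
      then show "r = r'" using \<nu>S_inj[of r r'] \<nu>S_inj[of r' r] * by (cases "r \<le> r'") auto
    qed
    moreover have "(\<lambda>r. \<nu>S r div 2) ` S \<subseteq> {..<?n - 1}"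
    proof safe
      fix r assume r: "r \<in> S"
      then show "\<nu>S r div 2 < ?n - 1" using \<nu>S_less[OF r] \<nu>S_odd[OF r] m by (auto elim!: oddE)
    qed
    \<comment> \<open>\<open>n - 1\<close> distinct odd counts below \<open>2n - 1\<close> exhaust
      the odd numbers there, so every gap is occupied.\<close>
    ultimately have "(\<lambda>r. \<nu>S r div 2) ` S = {..<?n - 1}"
      using cardS by (intro card_subset_eq) (auto simp: card_image)
    moreover have "j \<in> {..<?n - 1}" using j by simp
    ultimately obtain r where r: "r \<in> S" "j = \<nu>S r div 2" by blast
    then have \<nu>: "\<nu>S r = 2 * j + 1" using \<nu>S_odd[OF r(1)] by (metis odd_two_times_div_two_succ)
    have iff: "cs i < r \<longleftrightarrow> i \<le> 2 * j + 1" if "i < 2 * ?n" for i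
      using cs_between_iff[OF S_pos[OF r(1)] S_C[OF r(1)] \<nu>[unfolded \<nu>S_def] that] .
    have b: "2 * j + 1 < 2 * ?n" "2 * j + 2 < 2 * ?n" using j by simp_all
    have "cs (2 * j + 2) \<noteq> r" using S_C[OF r(1)] cs_C[OF _ b(2)] by auto
    then show ?thesis using r(1) iff[OF b(1)] iff[OF b(2)] by (intro bexI[of _ r]) auto
  qed
  define \<alpha> where "\<alpha> = R - smult k (Sp\<^sup>2)"
  define \<beta> where "\<beta> = smult (2 * sqrt k) Sp"
  have degSp: "degree Sp = ?n - 1" unfolding Sp_def by (simp add: degree_prod_linear cardS)
  have degSp2: "degree (smult k (Sp\<^sup>2)) < m"
    using degree_power_le[of Sp 2] degree_smult_le[of k "Sp\<^sup>2"] degSp m by simp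
  have \<alpha>_C: "poly \<alpha> c = - 1 * c ^ m" if "c \<in> C" for c
  proof -
    have "poly R c = 0" using that finite_C by (auto simp: poly_R)
    then show ?thesis using eq[of c] by (simp add: \<alpha>_def)
  qed
  interpret closing_billiard a lam q m \<alpha> \<beta> "-1"
  proof
    fix s
    have "(poly \<alpha> s)\<^sup>2 + (poly \<beta> s)\<^sup>2 * poly R s = (poly R s + k * (poly Sp s)\<^sup>2)\<^sup>2"
    proof -
      have "(poly \<beta> s)\<^sup>2 = 4 * k * (poly Sp s)\<^sup>2" using k by (simp add: \<beta>_def power_mult_distrib)
      then show ?thesis by (simp add: \<alpha>_def power2_eq_square algebra_simps)
    qed
    then show "(poly \<alpha> s)\<^sup>2 + (poly \<beta> s)\<^sup>2 * poly R s = s ^ (2 * m)"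
      unfolding eq[symmetric] by (simp only: power_even_eq)
    show "degree \<alpha> \<le> m"
      unfolding \<alpha>_def by (intro degree_diff_le less_imp_le[OF degSp2]) (simp add: degR)
    show "coeff \<alpha> m = 1"
      using coeff_eq_0[OF degSp2] by (simp add: \<alpha>_def degR)
    show "poly \<alpha> 0 \<noteq> 0" using eq[of 0] R_0_neg m by (simp add: \<alpha>_def)
    show "degree \<beta> + ?n \<le> m" using degree_smult_le[of "2 * sqrt k" Sp] degSp m by (simp add: \<beta>_def)
    show "poly \<alpha> (a i) = - 1 * a i ^ m" for i by (rule \<alpha>_C) (simp add: C_def)
  qed simp
  have odd: "odd (zc j)" if j: "j < ?n" for j
  proof -
    have c: "cs (2 * j + 1) \<in> C" using j by (intro cs_C) auto
    have "0 < poly \<alpha> (cs (2 * j + 1)) * (- 1) ^ zc j" by (rule sign_\<alpha>_zc[OF j]) auto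
    moreover have "poly \<alpha> (cs (2 * j + 1)) < 0" unfolding \<alpha>_C[OF c] using C_pos[OF c] by simp
    ultimately show ?thesis by (cases "even (zc j)") auto
  qed
  have less: "zc (j + 1) + 2 \<le> zc j" if j: "j + 1 < ?n" for j
  proof -
    obtain r where r: "r \<in> S" "cs (2 * j + 1) < r" "r < cs (2 * j + 2)" using in_gap[OF j] by blast
    have "poly Sp r = 0" using r(1) finS by (auto simp: Sp_def poly_prod)
    then have "poly \<beta> r = 0" "poly \<alpha> r = r ^ m" using R_S[OF r(1)] by (simp_all add: \<alpha>_def \<beta>_def)
    then obtain l where l: "even l" "zc (j + 1) \<le> l" "l \<le> zc j"
      using zc_even_between[OF j r(2,3)] by blast
    then have "zc (j + 1) \<noteq> l" "l \<noteq> zc j" using odd[of j] odd[OF j] j by auto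
    then show ?thesis using l by simp
  qed
  have "zc j + 2 * j \<le> m" if "j < ?n" for j
    using that
  proof (induction j)
    case (Suc j)
    then show ?case using less[of j] by simp
  qed (simp add: zc_0)
  from this[of "?n - 1"] have "zc (?n - 1) \<le> 1" using n_pos m by simp
  then have "zc (?n - 1) = 1" using zc_pos[of "?n - 1"] n_pos by simp
  then have "1 \<in> zc ` {..<?n}" using n_pos by (metis diff_less imageI lessThan_iff zero_less_one)
  then have "Gcd (zc ` {..<?n}) = 1" by (rule Gcd_1)
  then show ?thesis unfolding m_def[symmetric] by (rule elliptic_period_if_coprime)
qed

end

theorem theorem8:
  fixes a :: "'n::{finite,linorder} \<Rightarrow> real" and lam :: "nat \<Rightarrow> real"
  assumes "CARD('n) \<ge> 2"
    and "\<And>i. 0 < a i"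
    and "strict_mono a"
    and "inj_on lam {1..CARD('n) - 1}"
    and "lam ` {1..CARD('n) - 1} \<inter> range a = {}"
  shows
    "({t::real. poly (monom 1 CARD('n) - (\<Prod>j\<in>UNIV. [:- a j, 1:])) t = 0}
         = lam ` {1..CARD('n) - 1}
       \<longrightarrow> all_periodic_with_elliptic_period a lam CARD('n))
   \<and> ((\<exists>d::real. {t::real. poly (monom 1 (CARD('n) + 1)
            - [:- d, 1:]\<^sup>2 * (\<Prod>k=1..CARD('n) - 1. [:- lam k, 1:])) t = 0} = range a)
       \<longrightarrow> all_periodic_with_elliptic_period a lam (CARD('n) + 1))
   \<and> ((\<forall>z::complex.
          let P = monom 1 (2 * CARD('n) - 1)
            - (\<Prod>j\<in>UNIV. [:- complex_of_real (a j), 1:])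
              * (\<Prod>k=1..CARD('n) - 1. [:- complex_of_real (lam k), 1:])
          in poly P z = 0 \<longrightarrow> order z P = 2)
       \<longrightarrow> all_periodic_with_elliptic_period a lam (2 * CARD('n) - 1))"
proof (intro conjI impI)
  have billiard: "billiard a lam q" if "billiard_trajectory a q \<and> has_caustics a lam q" for q
    by unfold_locales (use assms that in auto)
  show "all_periodic_with_elliptic_period a lam CARD('n)"
    if roots: "{t::real. poly (monom 1 CARD('n) - (\<Prod>j\<in>UNIV. [:- a j, 1:])) t = 0} = lam ` {1..CARD('n) - 1}"
    unfolding all_periodic_with_elliptic_period_def
  proof (intro allI impI)
    fix q assume "billiard_trajectory a q \<and> has_caustics a lam q"
    then interpret billiard a lam q by (rule billiard)
    show "periodic_trajectory q \<and> elliptic_period a lam q = CARD('n)"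
      using roots by (intro condition_n) (simp only: Ap_def)
  qed
  show "all_periodic_with_elliptic_period a lam (CARD('n) + 1)"
    if "\<exists>d::real. {t::real. poly (monom 1 (CARD('n) + 1)
            - [:- d, 1:]\<^sup>2 * (\<Prod>k=1..CARD('n) - 1. [:- lam k, 1:])) t = 0} = range a"
    unfolding all_periodic_with_elliptic_period_def
  proof (intro allI impI)
    fix q assume "billiard_trajectory a q \<and> has_caustics a lam q"
    then interpret billiard a lam q by (rule billiard)
    obtain d where "{t::real. poly (monom 1 (CARD('n) + 1)
            - [:- d, 1:]\<^sup>2 * (\<Prod>k=1..CARD('n) - 1. [:- lam k, 1:])) t = 0} = range a"
      using \<open>\<exists>d::real. _ d\<close> by blast
    then show "periodic_trajectory q \<and> elliptic_period a lam q = CARD('n) + 1"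
      by (intro condition_n_plus_1[OF assms(1)]) (simp only: Lp_def)
  qed
  show "all_periodic_with_elliptic_period a lam (2 * CARD('n) - 1)"
    if double: "\<forall>z::complex.
          let P = monom 1 (2 * CARD('n) - 1)
            - (\<Prod>j\<in>UNIV. [:- complex_of_real (a j), 1:])
              * (\<Prod>k=1..CARD('n) - 1. [:- complex_of_real (lam k), 1:])
          in poly P z = 0 \<longrightarrow> order z P = 2"
    unfolding all_periodic_with_elliptic_period_def
  proof (intro allI impI)
    fix q assume "billiard_trajectory a q \<and> has_caustics a lam q"
    then interpret billiard a lam q by (rule billiard)
    show "periodic_trajectory q \<and> elliptic_period a lam q = 2 * CARD('n) - 1"
    proof (rule condition_2n_minus_1)
      have "(\<Prod>c\<in>C. [:- complex_of_real c, 1:])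
          = (\<Prod>c\<in>range a. [:- complex_of_real c, 1:]) * (\<Prod>c\<in>lam ` {1..CARD('n) - 1}. [:- complex_of_real c, 1:])"
        unfolding C_def using lam_a by (intro prod.union_disjoint) auto
      also have "\<dots> = (\<Prod>j\<in>UNIV. [:- complex_of_real (a j), 1:]) * (\<Prod>k=1..CARD('n) - 1. [:- complex_of_real (lam k), 1:])"
        using strict_mono_imp_inj_on[OF a_mono] lam_inj by (simp add: prod.reindex)
      finally show "order z (monom 1 (2 * CARD('n) - 1) - (\<Prod>c\<in>C. [:- complex_of_real c, 1:])) = 2"
        if "poly (monom 1 (2 * CARD('n) - 1) - (\<Prod>c\<in>C. [:- complex_of_real c, 1:])) z = 0" for z
        using double that unfolding Let_def by metis
    qed
  qed
qed

end
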